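(* Suppose $(X,f)$ is a presentation of a topologically defined 1-solenoid. Then $X$ can be given a differentiable structure making it a branched manifold on which $f$ is an immersion presenting a Williams solenoid.
   Context: **Topologically defined 1-solenoids.** $X$ is a (finite) directed graph, regarded as a topological space, with vertex set $\mathcal V$ and edge set $\mathcal E$. $(X,f)$ is a presentation of a topologically defined 1-solenoid if $f\colon X\to X$ is a continuous map satisfying the following six axioms; the 1-solenoid is then the inverse limit $\overline X=\{(x_0,x_1,\dots): x_i\in X,\ f(x_{i+1})=x_i\}$ with the homeomorphism $\overline f(x_0,x_1,\dots)=(f(x_0),x_0,x_1,\dots)$, up to topological conjugacy. Axiom 0 (Indecomposability): $X$ cannot be split into two nonempty, closed, $f$-invariant subsets. Axiom 1 (Nonwandering): all points of $X$ are nonwandering under $f$. Axiom 2 (Flattening): there is $k\ge1$ such that every $x\in X$ has an open neighborhood $U$ with $f^k(U)$ homeomorphic to $(-\epsilon,\epsilon)$. Axiom 3 (Expansion): there are a metric $d$ compatible with the topology and constants $C>0$, $\lambda>1$ such that for all $n>0$ and all points $x,y$ on a common edge of $X$, if $f^n$ maps the interval $[x,y]$ into an edge, then $d(f^nx,f^ny)\ge C\lambda^n d(x,y)$. Axiom 4 (Nonfolding): $f^n|_{X-\mathcal V}$ is locally one-to-one for every positive integer $n$. Axiom 5 (Markov): $f(\mathcal V)\subseteq\mathcal V$. **Williams solenoids.** Here "branched manifold" and "immersion" are in the sense of R. F. Williams (differentiable branched 1-manifolds and their immersions). A Williams 1-solenoid is the inverse limit of a system $(X,f)$ satisfying Axioms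 0--3 (expansion being understood in Williams' sense, with arclength defined by derivatives) in which $X$ is a differentiable 1-dimensional branched manifold and $f\colon X\to X$ is an immersion. **The structure used.** The branched-manifold and immersion structure of the claim is derived from the following data on $X$: a finite open cover $V_1,\dots,V_k$ of $X$, each $V_i$ being an interval or a union of intervals intersecting at a vertex; charts $\pi_i\colon V_i\to I_i$ to open intervals, which are homeomorphisms when $V_i$ is an interval and otherwise restrict to homeomorphisms on each of the intervals making up $V_i$; for $i\ne j$ with $V_i\cap V_j\neq\emptyset$, $\pi_i$ is invertible on $V_i\cap V_j$ and the change of coordinates $\pi_j\circ\pi_i^{-1}\colon\pi_i(V_i\cap V_j)\to\pi_j(V_i\cap V_j)$ is invertible and affine; and whenever $f(V_i)\cap V_j\ne\emptyset$ there is an invertible affine map $f_{i,j}\colon I_i\to I_j$ with $f_{i,j}\circ\pi_i(x)=\pi_j\circ f(x)$ for all $x\in V_i\cap f^{-1}(V_j)$. *)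

theory Defs
  imports "HOL-Analysis.Analysis" "Graph_Theory.Digraph"
begin

text \<open>
  \<^term>\<open>\<phi> e\<close> is the characteristic map of the arc \<^term>\<open>e\<close>, running from its tail to its head.
  Loops and parallel arcs are allowed. As the data is finite and the space is Hausdorff, the
  topology is automatically the quotient topology of the disjoint union of the vertices and of
  the closed unit intervals, one for each arc.
\<close>
definition graph_space :: "'a topology \<Rightarrow> ('a, 'e) pre_digraph \<Rightarrow> ('e \<Rightarrow> real \<Rightarrow> 'a) \<Rightarrow> bool"
  where "graph_space X G \<phi> \<longleftrightarrow>
    fin_digraph G \<and> Hausdorff_space X \<and> verts G \<subseteq> topspace X \<and>
    (\<forall>e\<in>arcs G. continuous_map (top_of_set {0..1}) X (\<phi> e)
        \<and> \<phi> e 0 = tail G e \<and> \<phi> e 1 = head G e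
        \<and> \<phi> e ` {0<..<1} \<inter> verts G = {}) \<and>
    inj_on (\<lambda>(e, t). \<phi> e t) (arcs G \<times> {0<..<1}) \<and>
    topspace X = verts G \<union> (\<Union>e\<in>arcs G. \<phi> e ` {0..1})"


definition indecomposable :: "'a topology \<Rightarrow> ('a \<Rightarrow> 'a) \<Rightarrow> bool"
  where "indecomposable X f \<longleftrightarrow>
    \<not> (\<exists>A B. closedin X A \<and> closedin X B \<and> A \<noteq> {} \<and> B \<noteq> {} \<and>
           A \<union> B = topspace X \<and> A \<inter> B = {} \<and> f ` A \<subseteq> A \<and> f ` B \<subseteq> B)"

definition nonwandering :: "'a topology \<Rightarrow> ('a \<Rightarrow> 'a) \<Rightarrow> bool"
  where "nonwandering X f \<longleftrightarrow>
    (\<forall>x\<in>topspace X. \<forall>U. openin X U \<and> x \<in> U \<longrightarrow> (\<exists>n\<ge>1. (f ^^ n) ` U \<inter> U \<noteq> {}))"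

definition flattening :: "'a topology \<Rightarrow> ('a \<Rightarrow> 'a) \<Rightarrow> bool"
  where "flattening X f \<longleftrightarrow>
    (\<exists>k\<ge>1. \<forall>x\<in>topspace X. \<exists>U \<epsilon>. openin X U \<and> x \<in> U \<and> \<epsilon> > 0 \<and>
       subtopology X ((f ^^ k) ` U) homeomorphic_space top_of_set {- \<epsilon> <..< \<epsilon> :: real})"

text \<open>
  \<^term>\<open>\<delta> e s t\<close> is the distance between the points of the closed edge \<^term>\<open>e\<close> with parameters
  \<^term>\<open>s\<close> and \<^term>\<open>t\<close>, the edge being regarded as an interval. If \<^term>\<open>e\<close> is not a loop, this is
  the distance \<^term>\<open>d\<close> in \<^term>\<open>X\<close>. On a loop it is a distance along the edge, for which the two
  ends are different: with \<^term>\<open>d\<close> itself the inequality below could not hold for an arc wrapped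
  once around the loop, which has equal endpoints, so that no graph with loops would satisfy
  the axiom together with the others. Likewise, mapping an interval into a closed edge means
  that the map lifts through the characteristic map of the edge to a continuous map \<^term>\<open>g\<close>;
  for an edge that is not a loop this just says that the image is contained in the edge.
\<close>
definition expansion ::
    "'a topology \<Rightarrow> ('a, 'e) pre_digraph \<Rightarrow> ('e \<Rightarrow> real \<Rightarrow> 'a) \<Rightarrow> ('a \<Rightarrow> 'a) \<Rightarrow> bool"
  where "expansion X G \<phi> f \<longleftrightarrow>
    (\<exists>(d :: 'a \<Rightarrow> 'a \<Rightarrow> real) (\<delta> :: 'e \<Rightarrow> real \<Rightarrow> real \<Rightarrow> real) C \<mu>.
       Metric_space (topspace X) d \<and> Metric_space.mtopology (topspace X) d = X \<and>
       (\<forall>e\<in>arcs G.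
          Metric_space {0..1} (\<delta> e) \<and>
          Metric_space.mtopology {0..1} (\<delta> e) = top_of_set {0..1} \<and>
          (\<forall>s\<in>{0..1}. \<forall>t\<in>{0..1}. d (\<phi> e s) (\<phi> e t) \<le> \<delta> e s t) \<and>
          (tail G e \<noteq> head G e \<longrightarrow>
             (\<forall>s\<in>{0..1}. \<forall>t\<in>{0..1}. \<delta> e s t = d (\<phi> e s) (\<phi> e t)))) \<and>
       C > 0 \<and> \<mu> > 1 \<and>
       (\<forall>n>0. \<forall>e\<in>arcs G. \<forall>e'\<in>arcs G. \<forall>s\<in>{0..1}. \<forall>t\<in>{s..1}. \<forall>g.
          continuous_map (top_of_set {s..t}) (top_of_set {0..1}) g \<and>
          (\<forall>u\<in>{s..t}. (f ^^ n) (\<phi> e u) = \<phi> e' (g u))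
          \<longrightarrow> \<delta> e' (g s) (g t) \<ge> C * \<mu> ^ n * \<delta> e s t))"

definition nonfolding :: "'a topology \<Rightarrow> ('a, 'e) pre_digraph \<Rightarrow> ('a \<Rightarrow> 'a) \<Rightarrow> bool"
  where "nonfolding X G f \<longleftrightarrow>
    (\<forall>n>0. \<forall>x\<in>topspace X - verts G.
       \<exists>U. openin (subtopology X (topspace X - verts G)) U \<and> x \<in> U \<and> inj_on (f ^^ n) U)"

definition topological_solenoid_presentation ::
    "'a topology \<Rightarrow> ('a, 'e) pre_digraph \<Rightarrow> ('e \<Rightarrow> real \<Rightarrow> 'a) \<Rightarrow> ('a \<Rightarrow> 'a) \<Rightarrow> bool"
  where "topological_solenoid_presentation X G \<phi> f \<longleftrightarrow>
    graph_space X G \<phi> \<and> continuous_map X X f \<and>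
    indecomposable X f \<and> nonwandering X f \<and> flattening X f \<and>
    expansion X G \<phi> f \<and> nonfolding X G f \<and> f ` verts G \<subseteq> verts G"


text \<open>Only used for open subsets \<^term>\<open>S\<close> of the line, where it means \<open>C\<^sup>\<infinity>\<close>.\<close>
definition smooth_on :: "real set \<Rightarrow> (real \<Rightarrow> real) \<Rightarrow> bool"
  where "smooth_on S g \<longleftrightarrow> (\<forall>n. (deriv ^^ n) g differentiable_on S)"

record 'a chart =
  chart_dom :: "'a set"
  chart_map :: "'a \<Rightarrow> real"

text \<open>
  The domain of a chart is a union of finitely many arcs, each of them mapped homeomorphically
  onto an open interval, that intersect at a point \<^term>\<open>v\<close>. Two different arcs either meet in
  \<^term>\<open>v\<close> only or share exactly one of the two branches ending there: for a vertex with one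
  incoming and two outgoing edges, both arcs contain the incoming edge.
\<close>
definition branched_chart :: "'a topology \<Rightarrow> 'a chart \<Rightarrow> bool"
  where "branched_chart X c \<longleftrightarrow>
    openin X (chart_dom c) \<and>
    (\<exists>a b S. a < b \<and> finite S \<and> S \<noteq> {} \<and> \<Union>S = chart_dom c \<and>
       continuous_map (subtopology X (chart_dom c)) (top_of_set {a<..<b}) (chart_map c) \<and>
       (\<forall>s\<in>S. homeomorphic_map (subtopology X s) (top_of_set {a<..<b}) (chart_map c)) \<and>
       (\<exists>v\<in>\<Inter>S. \<forall>s\<in>S. \<forall>t\<in>S. s \<noteq> t \<longrightarrow>
          chart_map c ` (s \<inter> t)
            \<in> {{chart_map c v}, {a <.. chart_map c v}, {chart_map c v ..< b}}))"

definition smoothly_compatible :: "'a chart \<Rightarrow> 'a chart \<Rightarrow> bool"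
  where "smoothly_compatible c c' \<longleftrightarrow>
    (\<exists>\<alpha> \<beta>. smooth_on (chart_map c ` (chart_dom c \<inter> chart_dom c')) \<alpha> \<and>
           smooth_on (chart_map c' ` (chart_dom c \<inter> chart_dom c')) \<beta> \<and>
           (\<forall>x\<in>chart_dom c \<inter> chart_dom c'.
              chart_map c' x = \<alpha> (chart_map c x) \<and> chart_map c x = \<beta> (chart_map c' x)))"

definition branched_manifold :: "'a topology \<Rightarrow> 'a chart set \<Rightarrow> bool"
  where "branched_manifold X A \<longleftrightarrow>
    compact_space X \<and> Hausdorff_space X \<and> finite A \<and>
    (\<forall>c\<in>A. branched_chart X c) \<and> (\<Union>c\<in>A. chart_dom c) = topspace X \<and>
    (\<forall>c\<in>A. \<forall>c'\<in>A. smoothly_compatible c c')"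

text \<open>
  \<^term>\<open>\<sigma>\<close> parametrizes a smooth arc in the domain of the chart \<^term>\<open>c\<close> by the coordinate of the
  chart; \<^term>\<open>h\<close> maps this arc into the domain of \<^term>\<open>c'\<close>.
  Smooth maps, their derivatives and lengths of tangent vectors are read off along such arcs.
  At a branch point, any arc entering and any arc leaving it combine to a smooth arc, so the
  derivative there does not depend on the choice of \<^term>\<open>\<sigma>\<close>, and there is a well-defined
  tangent line.
\<close>
definition smooth_arc ::
    "'a topology \<Rightarrow> 'a chart \<Rightarrow> 'a chart \<Rightarrow> ('a \<Rightarrow> 'a) \<Rightarrow> real set \<Rightarrow> (real \<Rightarrow> 'a) \<Rightarrow> bool"
  where "smooth_arc X c c' h J \<sigma> \<longleftrightarrow>
    open J \<and> continuous_map (top_of_set J) X \<sigma> \<and> \<sigma> ` J \<subseteq> chart_dom c \<and>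
    (\<forall>t\<in>J. chart_map c (\<sigma> t) = t) \<and> h ` \<sigma> ` J \<subseteq> chart_dom c'"

definition smooth_map :: "'a topology \<Rightarrow> 'a chart set \<Rightarrow> ('a \<Rightarrow> 'a) \<Rightarrow> bool"
  where "smooth_map X A f \<longleftrightarrow>
    continuous_map X X f \<and>
    (\<forall>c\<in>A. \<forall>c'\<in>A. \<forall>J \<sigma>. smooth_arc X c c' f J \<sigma> \<longrightarrow> smooth_on J (chart_map c' \<circ> f \<circ> \<sigma>))"

definition immersion :: "'a topology \<Rightarrow> 'a chart set \<Rightarrow> ('a \<Rightarrow> 'a) \<Rightarrow> bool"
  where "immersion X A f \<longleftrightarrow>
    smooth_map X A f \<and>
    (\<forall>c\<in>A. \<forall>c'\<in>A. \<forall>J \<sigma>. smooth_arc X c c' f J \<sigma> \<longrightarrow>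
       (\<forall>t\<in>J. deriv (chart_map c' \<circ> f \<circ> \<sigma>) t \<noteq> 0))"

text \<open>
  \<^term>\<open>\<rho> c t\<close> is the length of the coordinate unit tangent vector of the chart \<^term>\<open>c\<close> at the
  points with coordinate \<^term>\<open>t\<close>.
\<close>
definition riemannian_metric :: "'a topology \<Rightarrow> 'a chart set \<Rightarrow> ('a chart \<Rightarrow> real \<Rightarrow> real) \<Rightarrow> bool"
  where "riemannian_metric X A \<rho> \<longleftrightarrow>
    (\<forall>c\<in>A. smooth_on (chart_map c ` chart_dom c) (\<rho> c) \<and>
           (\<forall>t\<in>chart_map c ` chart_dom c. \<rho> c t > 0)) \<and>
    (\<forall>c\<in>A. \<forall>c'\<in>A. \<forall>J \<sigma>. smooth_arc X c c' id J \<sigma> \<longrightarrow>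
       (\<forall>t\<in>J. \<rho> c t = \<rho> c' (chart_map c' (\<sigma> t)) * \<bar>deriv (chart_map c' \<circ> \<sigma>) t\<bar>))"


text \<open>The inequality says \<open>\<parallel>D(f\<^sup>n) v\<parallel> \<ge> C \<mu>\<^sup>n \<parallel>v\<parallel>\<close> for all tangent vectors \<open>v\<close>.\<close>
definition williams_expansion :: "'a topology \<Rightarrow> 'a chart set \<Rightarrow> ('a \<Rightarrow> 'a) \<Rightarrow> bool"
  where "williams_expansion X A f \<longleftrightarrow>
    (\<exists>\<rho> C \<mu>. riemannian_metric X A \<rho> \<and> C > 0 \<and> \<mu> > 1 \<and>
       (\<forall>n>0. \<forall>c\<in>A. \<forall>c'\<in>A. \<forall>J \<sigma>. smooth_arc X c c' (f ^^ n) J \<sigma> \<longrightarrow>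
          (\<forall>t\<in>J. \<rho> c' (chart_map c' ((f ^^ n) (\<sigma> t))) * \<bar>deriv (chart_map c' \<circ> (f ^^ n) \<circ> \<sigma>) t\<bar>
                   \<ge> C * \<mu> ^ n * \<rho> c t)))"

definition williams_solenoid_presentation :: "'a topology \<Rightarrow> 'a chart set \<Rightarrow> ('a \<Rightarrow> 'a) \<Rightarrow> bool"
  where "williams_solenoid_presentation X A f \<longleftrightarrow>
    branched_manifold X A \<and> immersion X A f \<and>
    indecomposable X f \<and> nonwandering X f \<and> flattening X f \<and> williams_expansion X A f"

end

theory Submission
  imports Defs
begin

text \<open>
  By nonfolding, \<open>f\<close> subdivides each edge into finitely many pieces, each of which it maps
  homeomorphically onto an edge; so \<open>f\<close> has a transition matrix and acts on the ends (germs) of the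
  edges. By flattening, some iterate \<open>f\<^sup>k\<close> maps the germs at a vertex to at most two germs. A germ
  counting argument, based on nonwandering and expansion, shows that no iterate maps the germs at a
  vertex, even those of an invariant subgraph, to a single one. So the germs at a vertex fall into two
  nonempty sides, respected by \<open>f\<close>, and by indecomposability the transition matrix is irreducible.
  A positive eigenvector of it, with eigenvalue \<open>\<mu> > 1\<close>, gives the lengths of the edges, and the edges
  carry length coordinates in which \<open>f\<close> has slope \<open>\<plusminus>\<mu>\<close>. The signed distance from a vertex, positive
  on one side of it and negative on the other, is a chart around the vertex. All transition maps are
  isometries, so the metric of constant norm \<open>1\<close> is expanded by \<open>f\<close> with the factor \<open>\<mu>\<close>.
\<close>

text \<open>The map need not be smooth in the given parametrization, so the coordinates have to come
  from the dynamics. Distance along an edge is found as the solution of the equation saying that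
  \<open>f\<close> stretches it by \<open>\<mu>\<close>; solving for it is a contraction because
  \<open>\<mu> > 1\<close>. The solution is at first only weakly increasing. Strictness comes from
  the density, in every edge, of the points that reach a vertex under iteration. Expansion enters
  through this density, which also forces \<open>\<mu> > 1\<close>. The vertices are the obstacle.
  Nonfolding speaks of interior points of edges only, and flattening limits the germs at a vertex
  only after \<open>k\<close> steps. So the sides are defined through \<open>f ^^ k\<close>, and it
  must be shown that \<open>f\<close> itself respects them. That needs two germs which stay apart
  for \<open>k + 1\<close> steps, hence a lower bound valid for every iterate. Loops are allowed and
  no compatible orientation of the edges is assumed. Everything is therefore expressed through ends
  of edges; \<open>f\<close> may exchange the two sides of a vertex, which is why slopes are
  controlled only up to sign.\<close>

section \<open>Preliminaries: injectivity on intervals and positive eigenvectors\<close>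

text \<open>Local injectivity excludes interior extrema on compact subintervals. Equal values at two
  points would produce one: either a maximum or minimum in between or, if both are attained at the
  ends only, a constant function.\<close>

lemma locally_inj_imp_inj_interval:
  fixes g :: "real \<Rightarrow> real"
  assumes cont: "continuous_on {a<..<b} g"
    and loc: "\<And>x. a < x \<Longrightarrow> x < b \<Longrightarrow> \<exists>e>0. inj_on g ({x - e<..<x + e} \<inter> {a<..<b})"
  shows "inj_on g {a<..<b}"
proof -
  have no_extr: False
    if st: "a < s" "t < b" and c: "s < c" "c < t"
      and ex: "(\<forall>y\<in>{s..t}. g y \<le> g c) \<or> (\<forall>y\<in>{s..t}. g c \<le> g y)" for s t c
  proof -
    obtain e where e: "e > 0" "inj_on g ({c - e<..<c + e} \<inter> {a<..<b})"
      using loc[of c] st c by auto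
    define l where "l = max s (c - e/2)"
    define u where "u = min t (c + e/2)"
    have lu: "l < c" "c < u" "s \<le> l" "u \<le> t" "{l..u} \<subseteq> {c - e<..<c + e} \<inter> {a<..<b}"
      using e(1) c st by (auto simp: l_def u_def)
    have "continuous_on {l..u} g"
      using cont lu(5) by (meson continuous_on_subset le_inf_iff)
    moreover have "inj_on g {l..u}"
      using e(2) lu(5) inj_on_subset by blast
    ultimately have "(g l < g c \<and> g c < g u) \<or> (g u < g c \<and> g c < g l)"
      using continuous_inj_imp_mono[of l c u g] lu by auto
    moreover have "(g l \<le> g c \<and> g u \<le> g c) \<or> (g c \<le> g l \<and> g c \<le> g u)"
      using ex lu c by auto
    ultimately show False by linarith
  qed
  have "g s \<noteq> g t" if "a < s" "s < t" "t < b" for s t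
  proof
    assume eq: "g s = g t"
    have cst: "continuous_on {s..t} g"
      using cont that by (auto elim!: continuous_on_subset)
    have ne: "{s..t} \<noteq> {}" using that by auto
    obtain m where m: "m \<in> {s..t}" "\<forall>y\<in>{s..t}. g y \<le> g m"
      using continuous_attains_sup[OF compact_Icc ne cst] by blast
    obtain n where n: "n \<in> {s..t}" "\<forall>y\<in>{s..t}. g n \<le> g y"
      using continuous_attains_inf[OF compact_Icc ne cst] by blast
    have "m = s \<or> m = t" using no_extr[of s t m] m that by force
    moreover have "n = s \<or> n = t" using no_extr[of s t n] n that by force
    ultimately have "\<forall>y\<in>{s..t}. g y = g s" using m n eq by force
    moreover have c: "s < (s + t)/2" "(s + t)/2 < t" using that by auto
    moreover have "(s + t)/2 \<in> {s..t}" using c by (auto intro: less_imp_le)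
    ultimately have "\<forall>y\<in>{s..t}. g y \<le> g ((s + t)/2)" by (metis order_refl)
    then show False
      using no_extr[OF that(1) that(3) c] by blast
  qed
  then show ?thesis
    unfolding inj_on_def by (metis greaterThanLessThan_iff linorder_neqE_linordered_idom)
qed

text \<open>If the end values agreed, a value halfway between them and the value at the middle would
  be taken on either side of the middle, against injectivity inside. Ends and interior points cannot
  collide because their values lie in disjoint sets.\<close>

lemma inj_continuous_endpoint_values:
  fixes g :: "real \<Rightarrow> real"
  assumes pq: "p < q" and cont: "continuous_on {p..q} g" and inj: "inj_on g {p<..<q}"
    and mid: "\<And>u. p < u \<Longrightarrow> u < q \<Longrightarrow> g u \<in> {0<..<1}"
    and ends: "g p \<in> {0,1}" "g q \<in> {0,1}"
  shows "g p \<noteq> g q" and "inj_on g {p..q}"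
proof -
  define m where "m = (p + q)/2"
  have m: "p < m" "m < q" using pq by (auto simp: m_def)
  have c1: "continuous_on {p..m} g" "continuous_on {m..q} g"
    using cont m by (auto elim!: continuous_on_subset)
  show ne: "g p \<noteq> g q"
  proof
    assume eq: "g p = g q"
    define y where "y = (g p + g m)/2"
    have gm: "g m \<in> {0<..<1}" using mid m by auto
    have "\<exists>u\<ge>p. u \<le> m \<and> g u = y"
    proof (cases "g p = 0")
      case True
      then show ?thesis using IVT'[of g p y m] gm c1 m by (auto simp: y_def)
    next
      case False
      then show ?thesis using IVT2'[of g m y p] gm c1 m ends by (auto simp: y_def)
    qed
    moreover have "\<exists>u\<ge>m. u \<le> q \<and> g u = y"
    proof (cases "g p = 0")
      case True
      then show ?thesis using IVT2'[of g q y m] gm c1 m eq by (auto simp: y_def)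
    next
      case False
      then show ?thesis using IVT'[of g m y q] gm c1 m ends eq by (auto simp: y_def)
    qed
    ultimately obtain u u' where u: "p \<le> u" "u \<le> m" "g u = y" "m \<le> u'" "u' \<le> q" "g u' = y" by auto
    have y: "y \<noteq> g p" "y \<noteq> g m" "y \<noteq> g q" using gm ends eq by (auto simp: y_def)
    have "u < u'" "u \<in> {p<..<q}" "u' \<in> {p<..<q}" using u y m by (auto simp: less_le)
    then show False using inj u by (metis inj_onD less_irrefl)
  qed
  show "inj_on g {p..q}"
  proof (rule inj_onI)
    fix x y assume xy: "x \<in> {p..q}" "y \<in> {p..q}" "g x = g y"
    show "x = y"
    proof (cases "x \<in> {p<..<q} \<and> y \<in> {p<..<q}")
      case True then show ?thesis using inj xy by (meson inj_onD)
    next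
      case False
      then have "x = p \<or> x = q \<or> y = p \<or> y = q" using xy by force
      then show ?thesis using xy mid[of x] mid[of y] ends ne by force
    qed
  qed
qed

text \<open>Collatz--Wielandt: a maximal \<open>r\<close> admitting a nonnegative \<open>x \<noteq> 0\<close> with \<open>M x \<ge> r x\<close>
  exists by compactness; if \<open>M x \<noteq> r x\<close>, then irreducibility makes all entries of
  \<open>M y - r y\<close> positive for \<open>y = (I + M)\<^sup>j x\<close>, so that \<open>r\<close> would not be maximal.\<close>
lemma irreducible_nonneg_matrix_eigenvector:
  fixes M :: "'e \<Rightarrow> 'e \<Rightarrow> real"
  assumes fin: "finite E" and ne: "E \<noteq> {}" and nonneg: "\<And>e e'. M e e' \<ge> 0"
    and irr: "\<And>Z. Z \<subseteq> E \<Longrightarrow> Z \<noteq> {} \<Longrightarrow> (\<And>e e'. e \<in> Z \<Longrightarrow> e' \<in> E \<Longrightarrow> M e e' > 0 \<Longrightarrow> e' \<in> Z) \<Longrightarrow> Z = E"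
  shows "\<exists>\<mu> x. (\<forall>e\<in>E. x e > 0) \<and> (\<forall>e\<in>E. (\<Sum>e'\<in>E. M e e' * x e') = \<mu> * x e)"
proof -
  define A where "A = (\<lambda>x e. \<Sum>e'\<in>E. M e e' * x e')"
  define B where "B = (\<Sum>e\<in>E. \<Sum>e'\<in>E. M e e')"
  \<comment> \<open>Functions are set to 0 outside \<open>E\<close>, so that the simplex is compact
    in the product topology on all functions.\<close>
  define \<Delta> where "\<Delta> = (PiE UNIV (\<lambda>e. if e \<in> E then {0..1::real} else {0})) \<inter> {x. (\<Sum>e\<in>E. x e) = 1}"
  define K where "K = {(r, x). r \<in> {0..B} \<and> x \<in> \<Delta> \<and> (\<forall>e\<in>E. r * x e \<le> A x e)}"
  have A_nonneg: "A x e \<ge> 0" if "\<And>e. e \<in> E \<Longrightarrow> x e \<ge> 0" for x e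
    unfolding A_def by (intro sum_nonneg mult_nonneg_nonneg nonneg that)
  have coord: "continuous_on S (\<lambda>x::'e \<Rightarrow> real. x e)" for S e
    by (rule continuous_on_product_coordinates[THEN continuous_on_subset]) simp
  have coord2: "continuous_on S (\<lambda>z::real \<times> ('e \<Rightarrow> real). snd z e)" for S e
    using continuous_on_compose2[OF coord[of UNIV e] continuous_on_snd[OF continuous_on_id]] by auto
  have comp0: "compact (PiE UNIV (\<lambda>e. if e \<in> E then {0..1::real} else {0}))"
    using compactin_PiE[of "\<lambda>_. euclidean" UNIV "\<lambda>e. if e \<in> E then {0..1::real} else {0}"]
    unfolding euclidean_product_topology compactin_euclidean_iff by auto
  have "closed {x::'e \<Rightarrow> real. (\<Sum>e\<in>E. x e) = 1}"
    by (intro closed_Collect_eq continuous_intros coord)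
  then have comp1: "compact \<Delta>"
    unfolding \<Delta>_def using comp0 by (rule compact_Int_closed[rotated])
  have Keq: "K = ({0..B} \<times> \<Delta>) \<inter> {z. \<forall>e\<in>E. fst z * snd z e \<le> A (snd z) e}"
    unfolding K_def by auto
  have "{z::real \<times> ('e \<Rightarrow> real). \<forall>e\<in>E. fst z * snd z e \<le> A (snd z) e}
      = (\<Inter>e\<in>E. {z. fst z * snd z e \<le> A (snd z) e})" by auto
  moreover have "closed {z::real \<times> ('e \<Rightarrow> real). fst z * snd z e \<le> A (snd z) e}" for e
    unfolding A_def by (intro closed_Collect_le continuous_intros coord2)
  ultimately have "closed {z::real \<times> ('e \<Rightarrow> real). \<forall>e\<in>E. fst z * snd z e \<le> A (snd z) e}"
    by auto
  then have compK: "compact K"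
    unfolding Keq by (intro compact_Int_closed compact_Times compact_Icc comp1)
  have cpos: "real (card E) > 0" using fin ne by (simp add: card_gt_0_iff)
  \<comment> \<open>Summing the inequalities over \<open>E\<close> gives \<open>r\<close> times
    total mass 1 on the left and, as all entries of \<open>x\<close> are at most 1, at most
    \<open>B\<close> on the right.\<close>
  have bound: "r \<le> B" if x: "\<And>e. e \<in> E \<Longrightarrow> 0 \<le> x e" "(\<Sum>e\<in>E. x e) = 1"
    and r: "\<forall>e\<in>E. r * x e \<le> A x e" for r x
  proof -
    have le1: "x e \<le> 1" if "e \<in> E" for e
      using x member_le_sum[of e E x] fin that by auto
    have "r = (\<Sum>e\<in>E. r * x e)" using x by (simp add: sum_distrib_left[symmetric])
    also have "\<dots> \<le> (\<Sum>e\<in>E. A x e)" using r by (intro sum_mono) auto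
    also have "\<dots> \<le> B" unfolding A_def B_def
      by (intro sum_mono) (use le1 nonneg mult_left_le in blast)
    finally show ?thesis .
  qed
  \<comment> \<open>The inequality is homogeneous, so any nonnegative vector with positive sum can
    be rescaled into \<open>K\<close>.\<close>
  have memK: "(r, \<lambda>e. if e \<in> E then x e / (\<Sum>e\<in>E. x e) else 0) \<in> K"
    if r: "r \<ge> 0" and x: "\<And>e. e \<in> E \<Longrightarrow> 0 \<le> x e" "(\<Sum>e\<in>E. x e) > 0" and rx: "\<forall>e\<in>E. r * x e \<le> A x e" for r x
  proof -
    define s where "s = (\<Sum>e\<in>E. x e)"
    define y where "y = (\<lambda>e. if e \<in> E then x e / s else 0)"
    have s: "s > 0" using x by (simp add: s_def)
    have y1: "(\<Sum>e\<in>E. y e) = 1" using s by (simp add: y_def sum_divide_distrib[symmetric] s_def[symmetric])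
    have y0: "0 \<le> y e" for e using s x by (auto simp: y_def)
    have yle: "y e \<le> 1" if "e \<in> E" for e using y1 y0 member_le_sum[of e E y] fin that by auto
    have Ay: "A y e = A x e / s" for e
      unfolding A_def sum_divide_distrib by (rule sum.cong) (auto simp: y_def)
    have ry: "\<forall>e\<in>E. r * y e \<le> A y e"
      using rx s unfolding Ay by (auto simp: y_def divide_right_mono)
    have "y \<in> (PiE UNIV (\<lambda>e. if e \<in> E then {0..1::real} else {0}))"
    proof (rule PiE_I)
      show "y e \<in> (if e \<in> E then {0..1} else {0})" for e
        using y0[of e] yle[of e] by (cases "e \<in> E") (auto, simp add: y_def)
    qed simp
    then have "y \<in> \<Delta>" using y1 by (simp add: \<Delta>_def)
    moreover have "r \<le> B" by (rule bound[OF y0 y1 ry])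
    ultimately show ?thesis using r ry unfolding K_def y_def s_def by auto
  qed
  have "(0, \<lambda>e. if e \<in> E then 1 / (\<Sum>e\<in>E. 1) else 0) \<in> K"
    by (rule memK) (use cpos in \<open>auto intro!: A_nonneg\<close>)
  then have "K \<noteq> {}" by blast
  then obtain z where z: "z \<in> K" "\<forall>z'\<in>K. fst z' \<le> fst z"
    using continuous_attains_sup[OF compK, of fst] continuous_on_fst[OF continuous_on_id] by blast
  obtain \<mu> x where zz: "z = (\<mu>, x)" by (cases z)
  have mu: "\<mu> \<ge> 0" and x0: "\<And>e. 0 \<le> x e" and x1: "(\<Sum>e\<in>E. x e) = 1"
    and mx: "\<forall>e\<in>E. \<mu> * x e \<le> A x e"
  proof -
    show "\<mu> \<ge> 0" "(\<Sum>e\<in>E. x e) = 1" "\<forall>e\<in>E. \<mu> * x e \<le> A x e"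
      using z zz by (auto simp: K_def \<Delta>_def)
    have xe: "x e \<in> (if e \<in> E then {0..1::real} else {0})" for e
      using z zz by (auto simp: K_def \<Delta>_def PiE_iff)
    show "0 \<le> x e" for e using xe[of e] by (auto split: if_splits)
  qed
  have eig: "A x e = \<mu> * x e" if eE: "e \<in> E" for e
  proof (rule ccontr)
    assume neq: "A x e \<noteq> \<mu> * x e"
    define T where "T = (\<lambda>y e. y e + A y e)"
    define y where "y = (\<lambda>j. (T ^^ j) x)"
    define w where "w = (\<lambda>j e. A (y j) e - \<mu> * y j e)"
    have y0: "0 \<le> y j e" for j e
      by (induction j arbitrary: e) (auto simp: y_def T_def x0 intro!: add_nonneg_nonneg A_nonneg)
    have ymono: "y j e \<le> y (Suc j) e" for j e
      using A_nonneg[of "y j" e] y0 by (simp add: y_def T_def)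
    have wS: "w (Suc j) e = w j e + A (w j) e" for j e
      unfolding w_def A_def y_def T_def funpow.simps o_def
      by (simp add: algebra_simps sum.distrib sum_subtractf sum_distrib_left)
    have w0: "0 \<le> w j e" if "e \<in> E" for j e
      using that
    proof (induction j arbitrary: e)
      case 0 then show ?case using mx by (auto simp: w_def y_def)
    next
      case (Suc j) then show ?case unfolding wS by (intro add_nonneg_nonneg A_nonneg) auto
    qed
    \<comment> \<open>The supports of the \<open>w j\<close> increase inside a finite set; a support
      of maximal cardinality is stable.\<close>
    define s where "s = (\<lambda>j. {e\<in>E. w j e > 0})"
    have fins: "finite (s j)" for j using fin by (simp add: s_def)
    have bd: "card (s j) < Suc (card E)" for j
      by (rule le_imp_less_Suc, rule card_mono) (use fin in \<open>auto simp: s_def\<close>)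
    have "finite ((\<lambda>j. card (s j)) ` UNIV)"
      by (rule finite_subset[of _ "{..<Suc (card E)}"]) (use bd in auto)
    then have fr: "finite (range (\<lambda>j. card (s j)))" .
    have "Max (range (\<lambda>j. card (s j))) \<in> range (\<lambda>j. card (s j))"
      by (rule Max_in[OF fr]) simp
    then obtain j where "Max (range (\<lambda>j. card (s j))) = card (s j)" by (rule imageE)
    then have j: "card (s i) \<le> card (s j)" for i
      using Max_ge[OF fr, of "card (s i)"] by simp
    have smono: "s i \<subseteq> s (Suc i)" for i
      unfolding s_def wS using w0 by (auto intro!: add_pos_nonneg A_nonneg)
    have sj: "s (Suc j) = s j"
      using smono j fins by (metis card_seteq)
    have s0: "e \<in> s 0" using neq mx eE by (auto simp: s_def w_def y_def less_le)
    have "s 0 \<subseteq> s i" for i by (induction i) (use smono in auto)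
    then have es: "e \<in> s j" using s0 by blast
    \<comment> \<open>Stability makes the complement of the support closed under positive entries of
      \<open>M\<close>. By irreducibility it is empty or all of \<open>E\<close>, and
      \<open>e\<close> rules out the latter.\<close>
    have "E - s j = {}"
    proof (rule ccontr)
      assume "E - s j \<noteq> {}"
      moreover have "e2 \<in> E - s j" if e12: "e1 \<in> E - s j" "e2 \<in> E" "M e1 e2 > 0" for e1 e2
      proof (rule ccontr)
        assume "e2 \<notin> E - s j"
        then have "w j e2 > 0" using e12 by (auto simp: s_def)
        have "0 < M e1 e2 * w j e2" using e12 \<open>w j e2 > 0\<close> by simp
        also have "\<dots> \<le> A (w j) e1"
          unfolding A_def using member_le_sum[of e2 E "\<lambda>e'. M e1 e' * w j e'"] fin e12 w0 nonneg by force
        finally have "e1 \<in> s (Suc j)" using e12 w0[of e1 j] by (auto simp: s_def wS)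
        then show False using e12 sj by auto
      qed
      ultimately have "E - s j = E" by (intro irr) auto
      then show False using es by (auto simp: s_def)
    qed
    then have wpos: "\<And>e. e \<in> E \<Longrightarrow> w j e > 0" by (auto simp: s_def)
    \<comment> \<open>The summand 1 avoids dividing by a possibly vanishing \<open>y j e\<close> and
      only makes the quotient smaller.\<close>
    define \<epsilon> where "\<epsilon> = Min ((\<lambda>e. w j e / (1 + y j e)) ` E)"
    have epos: "\<epsilon> > 0"
      unfolding \<epsilon>_def using fin ne wpos y0 by (subst Min_gr_iff) (auto intro!: divide_pos_pos add_pos_nonneg)
    have le: "(\<mu> + \<epsilon>) * y j e \<le> A (y j) e" if "e \<in> E" for e
    proof -
      have "\<epsilon> \<le> w j e / (1 + y j e)" unfolding \<epsilon>_def using fin that by auto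
      then have "\<epsilon> * (1 + y j e) \<le> w j e"
        using y0[of j e] by (simp add: pos_le_divide_eq)
      then have "\<epsilon> * y j e \<le> w j e" using epos by (simp add: algebra_simps)
      then show ?thesis by (simp add: w_def algebra_simps)
    qed
    have "x e \<le> y i e" for i e
    proof (induction i)
      case (Suc i) then show ?case using ymono[of i e] by linarith
    qed (simp add: y_def)
    then have "1 \<le> (\<Sum>e\<in>E. y j e)" using x1 by (metis sum_mono)
    then have "(\<mu> + \<epsilon>, \<lambda>e. if e \<in> E then y j e / (\<Sum>e\<in>E. y j e) else 0) \<in> K"
      by (intro memK) (use mu epos y0 le in auto)
    then have "\<mu> + \<epsilon> \<le> \<mu>" using z(2) zz by fastforce
    then show False using epos by simp
  qed
  \<comment> \<open>The eigenvector is so far only nonnegative. Its zero set is closed under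
    positive entries of \<open>M\<close> and is not everything, since the entries sum to 1.\<close>
  define Z where "Z = {e\<in>E. x e = 0}"
  have "Z = {}"
  proof (rule ccontr)
    assume "Z \<noteq> {}"
    moreover have "e' \<in> Z" if "e \<in> Z" "e' \<in> E" "M e e' > 0" for e e'
    proof (rule ccontr)
      assume "e' \<notin> Z"
      then have "x e' > 0" using that x0[of e'] by (auto simp: Z_def less_le)
      then have "0 < M e e' * x e'" using that by simp
      also have "\<dots> \<le> A x e"
        unfolding A_def using member_le_sum[of e' E "\<lambda>e'. M e e' * x e'"] fin that x0 nonneg by force
      finally show False using eig[of e] that by (auto simp: Z_def)
    qed
    ultimately have "Z = E" by (intro irr) (auto simp: Z_def)
    then have "(\<Sum>e\<in>E. x e) = 0" by (intro sum.neutral) (auto simp: Z_def)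
    then show False using x1 by simp
  qed
  then have "\<forall>e\<in>E. x e > 0" using x0 by (force simp: Z_def less_le)
  then show ?thesis using eig unfolding A_def by blast
qed

subsection \<open>The topology of the graph\<close>

text \<open>Near \<open>p\<close> the values cluster at 0 and 1 only, and the image of a short
  interval is connected, so they cannot jump from one cluster to the other.\<close>

lemma tendsto_01_at_right:
  fixes g :: "real \<Rightarrow> real"
  assumes pq: "p < q" and cont: "continuous_on {p<..<q} g"
    and near: "\<And>\<eta>. \<eta> > 0 \<Longrightarrow> \<exists>\<delta>>0. \<forall>t\<in>{p<..<q}. t < p + \<delta> \<longrightarrow> \<bar>g t\<bar> < \<eta> \<or> \<bar>g t - 1\<bar> < \<eta>"
  shows "\<exists>c\<in>{0,1}. (g \<longlongrightarrow> c) (at_right p)"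
proof -
  \<comment> \<open>With 1/4 the two clusters are separated by the value 1/2.\<close>
  obtain d where d: "d > 0" "\<forall>t\<in>{p<..<q}. t < p + d \<longrightarrow> \<bar>g t\<bar> < 1/4 \<or> \<bar>g t - 1\<bar> < 1/4"
    using near[of "1/4"] by auto
  define u where "u = min q (p + d)"
  have u: "p < u" "u \<le> q" "u \<le> p + d" using pq d by (auto simp: u_def)
  have conn: "connected (g ` {p<..<u})"
    by (rule connected_continuous_image) (use cont u in \<open>auto elim!: continuous_on_subset\<close>)
  have sep: "g ` {p<..<u} \<subseteq> {..<1/2} \<union> {1/2<..}"
  proof
    fix y assume "y \<in> g ` {p<..<u}"
    then obtain t where t: "t \<in> {p<..<u}" "y = g t" by auto
    then have "t \<in> {p<..<q}" "t < p + d" using u by auto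
    then have "\<bar>g t\<bar> < 1/4 \<or> \<bar>g t - 1\<bar> < 1/4" using d by blast
    then show "y \<in> {..<1/2} \<union> {1/2<..}" using t by (auto simp: abs_if split: if_splits)
  qed
  have "{..<1/2} \<inter> g ` {p<..<u} = {} \<or> {1/2<..} \<inter> g ` {p<..<u} = {}"
    by (rule connectedD[OF conn]) (use sep in auto)
  then obtain c :: real where c: "c \<in> {0,1}"
    and far: "\<And>t \<eta>. t \<in> {p<..<u} \<Longrightarrow> \<eta> \<le> 1/4 \<Longrightarrow> \<bar>g t\<bar> < \<eta> \<or> \<bar>g t - 1\<bar> < \<eta> \<Longrightarrow> \<bar>g t - c\<bar> < \<eta>"
  proof (elim disjE)
    assume h: "{..<1/2} \<inter> g ` {p<..<u} = {}"
    show thesis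
    proof (rule that[of 1])
      fix t \<eta> :: real assume *: "t \<in> {p<..<u}" "\<eta> \<le> 1/4" "\<bar>g t\<bar> < \<eta> \<or> \<bar>g t - 1\<bar> < \<eta>"
      then have "\<not> g t < 1/2" using h by blast
      then show "\<bar>g t - 1\<bar> < \<eta>" using * by (auto simp: abs_if split: if_splits)
    qed auto
  next
    assume h: "{1/2<..} \<inter> g ` {p<..<u} = {}"
    show thesis
    proof (rule that[of 0])
      fix t \<eta> :: real assume *: "t \<in> {p<..<u}" "\<eta> \<le> 1/4" "\<bar>g t\<bar> < \<eta> \<or> \<bar>g t - 1\<bar> < \<eta>"
      then have "\<not> g t > 1/2" using h by blast
      then show "\<bar>g t - 0\<bar> < \<eta>" using * by (auto simp: abs_if split: if_splits)
    qed auto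
  qed
  have "(g \<longlongrightarrow> c) (at_right p)"
  proof (rule tendstoI)
    fix e :: real assume e: "e > 0"
    define \<eta> where "\<eta> = min e (1/4)"
    have \<eta>: "\<eta> > 0" "\<eta> \<le> e" "\<eta> \<le> 1/4" using e by (auto simp: \<eta>_def)
    obtain \<delta> where \<delta>: "\<delta> > 0" "\<forall>t\<in>{p<..<q}. t < p + \<delta> \<longrightarrow> \<bar>g t\<bar> < \<eta> \<or> \<bar>g t - 1\<bar> < \<eta>"
      using near[OF \<eta>(1)] by auto
    show "\<forall>\<^sub>F x in at_right p. dist (g x) c < e"
      unfolding eventually_at_right_field
    proof (intro exI[of _ "min u (p + \<delta>)"] conjI allI impI)
      show "p < min u (p + \<delta>)" using u \<delta> by auto
      fix t assume t: "p < t" "t < min u (p + \<delta>)"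
      then have "\<bar>g t\<bar> < \<eta> \<or> \<bar>g t - 1\<bar> < \<eta>" using \<delta>(2) u by auto
      then have "\<bar>g t - c\<bar> < \<eta>" using far[of t \<eta>] t \<eta> by auto
      then show "dist (g t) c < e" using \<eta> by (auto simp: dist_real_def)
    qed
  qed
  then show ?thesis using c by blast
qed

lemma tendsto_01_at_left:
  fixes g :: "real \<Rightarrow> real"
  assumes pq: "p < q" and cont: "continuous_on {p<..<q} g"
    and near: "\<And>\<eta>. \<eta> > 0 \<Longrightarrow> \<exists>\<delta>>0. \<forall>t\<in>{p<..<q}. q - \<delta> < t \<longrightarrow> \<bar>g t\<bar> < \<eta> \<or> \<bar>g t - 1\<bar> < \<eta>"
  shows "\<exists>c\<in>{0,1}. (g \<longlongrightarrow> c) (at_left q)"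
proof -
  have "\<exists>c\<in>{0,1}. ((\<lambda>t. g (- t)) \<longlongrightarrow> c) (at_right (- q))"
  proof (rule tendsto_01_at_right)
    show "- q < - p" using pq by simp
    show "continuous_on {- q<..<- p} (\<lambda>t. g (- t))"
      by (rule continuous_on_compose2[OF cont]) (auto intro!: continuous_intros)
    fix \<eta> :: real assume "\<eta> > 0"
    then obtain \<delta> where d: "\<delta>>0" "\<forall>t\<in>{p<..<q}. q - \<delta> < t \<longrightarrow> \<bar>g t\<bar> < \<eta> \<or> \<bar>g t - 1\<bar> < \<eta>"
      using near by blast
    show "\<exists>\<delta>>0. \<forall>t\<in>{- q<..<- p}. t < - q + \<delta> \<longrightarrow> \<bar>g (- t)\<bar> < \<eta> \<or> \<bar>g (- t) - 1\<bar> < \<eta>"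
      by (rule exI[of _ \<delta>]) (use d in auto)
  qed
  then show ?thesis
    by (simp add: at_left_minus filterlim_filtermap)
qed

locale graph_map =
  fixes X :: "'a topology" and G :: "('a, 'e) pre_digraph"
    and \<phi> :: "'e \<Rightarrow> real \<Rightarrow> 'a" and f :: "'a \<Rightarrow> 'a"
  assumes graph_space: "graph_space X G \<phi>" and continuous_f: "continuous_map X X f"
    and nonfolding: "nonfolding X G f" and vertices: "f ` verts G \<subseteq> verts G"
begin

abbreviation "V \<equiv> verts G"
abbreviation "E \<equiv> arcs G"

text \<open>A germ \<open>(e, b)\<close> is an end of the edge \<open>e\<close>: the tail if \<open>b\<close> is false, the head if it is true.\<close>

definition ray :: "'e \<times> bool \<Rightarrow> real \<Rightarrow> 'a"
  where "ray \<gamma> t = \<phi> (fst \<gamma>) (if snd \<gamma> then 1 - t else t)"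

definition opp :: "'e \<times> bool \<Rightarrow> 'e \<times> bool"
  where "opp \<gamma> = (fst \<gamma>, \<not> snd \<gamma>)"

lemma fst_opp [simp]: "fst (opp \<gamma>) = fst \<gamma>" and opp_opp [simp]: "opp (opp \<gamma>) = \<gamma>"
  and opp_ne [simp]: "opp \<gamma> \<noteq> \<gamma>" "\<gamma> \<noteq> opp \<gamma>"
  by (auto simp: opp_def prod_eq_iff)

lemma opp_cases: "fst \<gamma> = fst \<gamma>' \<Longrightarrow> \<gamma>' = \<gamma> \<or> \<gamma>' = opp \<gamma>"
  by (auto simp: opp_def prod_eq_iff)

lemma ray_opp: "ray (opp \<gamma>) t = ray \<gamma> (1 - t)"
  by (simp add: ray_def opp_def)

lemma finite_V: "finite V" and finite_E: "finite E"
  and Hausdorff: "Hausdorff_space X" and V_subset: "V \<subseteq> topspace X"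
  and topspace_eq: "topspace X = V \<union> (\<Union>e\<in>E. \<phi> e ` {0..1})"
  using graph_space fin_digraph.finite_verts fin_digraph.finite_arcs
  by (auto simp: graph_space_def)

lemma phi_continuous: "e \<in> E \<Longrightarrow> continuous_map (top_of_set {0..1}) X (\<phi> e)"
  using graph_space by (simp add: graph_space_def)

lemma phi_V: "e \<in> E \<Longrightarrow> t \<in> {0..1} \<Longrightarrow> \<phi> e t \<in> V \<longleftrightarrow> t = 0 \<or> t = 1"
proof -
  assume e: "e \<in> E" and t: "t \<in> {0..1}"
  interpret fin_digraph G using graph_space by (simp add: graph_space_def)
  have "\<phi> e 0 \<in> V" "\<phi> e 1 \<in> V" "\<phi> e ` {0<..<1} \<inter> V = {}"
    using graph_space e by (auto simp: graph_space_def)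
  then show ?thesis using t by (cases "t = 0 \<or> t = 1") (auto simp: disjoint_iff)
qed

lemma phi_inj:
  assumes "e \<in> E" "e' \<in> E" "t \<in> {0<..<1}" "t' \<in> {0..1}" "\<phi> e t = \<phi> e' t'"
  shows "e' = e \<and> t' = t"
proof -
  have "\<phi> e t \<notin> V" using phi_V[of e t] assms by auto
  then have "t' \<in> {0<..<1}" using phi_V[of e' t'] assms by (auto simp: less_le)
  then have "(e, t) \<in> E \<times> {0<..<1}" "(e', t') \<in> E \<times> {0<..<1}" using assms by auto
  moreover have "inj_on (\<lambda>(e, t). \<phi> e t) (E \<times> {0<..<1})"
    using graph_space by (simp add: graph_space_def)
  ultimately have "(e, t) = (e', t')"
    using assms(5) inj_onD[of "\<lambda>(e, t). \<phi> e t" _ "(e, t)" "(e', t')"] by auto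
  then show ?thesis by simp
qed

lemma ray_continuous: "fst \<gamma> \<in> E \<Longrightarrow> continuous_map (top_of_set {0..1}) X (ray \<gamma>)"
proof -
  assume e: "fst \<gamma> \<in> E"
  have "continuous_map (top_of_set {0..1}) (top_of_set {0..1::real}) (\<lambda>t. if snd \<gamma> then 1 - t else t)"
    by (cases "snd \<gamma>") (auto intro!: continuous_intros)
  from continuous_map_compose[OF this phi_continuous[OF e]]
  show ?thesis by (simp add: ray_def[abs_def] o_def)
qed

lemma ray_in: "fst \<gamma> \<in> E \<Longrightarrow> t \<in> {0..1} \<Longrightarrow> ray \<gamma> t \<in> topspace X"
  using continuous_map_image_subset_topspace[OF ray_continuous, of \<gamma>] by auto

lemma ray_V: "fst \<gamma> \<in> E \<Longrightarrow> t \<in> {0..1} \<Longrightarrow> ray \<gamma> t \<in> V \<longleftrightarrow> t = 0 \<or> t = 1"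
  using phi_V[of "fst \<gamma>" "if snd \<gamma> then 1 - t else t"] by (auto simp: ray_def)

text \<open>Makes points comparable through germs: off the vertices a point has just two
  descriptions, one from each end of its edge.\<close>

lemma ray_eqD:
  assumes "fst \<gamma> \<in> E" "fst \<gamma>' \<in> E" "t \<in> {0<..<1}" "t' \<in> {0..1}" "ray \<gamma> t = ray \<gamma>' t'"
  shows "(\<gamma>' = \<gamma> \<and> t' = t) \<or> (\<gamma>' = opp \<gamma> \<and> t' = 1 - t)"
  using phi_inj[of "fst \<gamma>" "fst \<gamma>'" "if snd \<gamma> then 1 - t else t" "if snd \<gamma>' then 1 - t' else t'"] assms
  by (cases "snd \<gamma>"; cases "snd \<gamma>'") (auto simp: ray_def opp_def prod_eq_iff)

lemma ray_inj:
  assumes "fst \<gamma> \<in> E" "t \<in> {0<..<1}" "t' \<in> {0..1}" "ray \<gamma> t = ray \<gamma> t'"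
  shows "t' = t"
  using ray_eqD[of \<gamma> \<gamma> t t'] assms by auto

lemma point_cases:
  assumes "x \<in> topspace X"
  obtains "x \<in> V" | \<gamma> t where "fst \<gamma> \<in> E" "t \<in> {0<..<1}" "x = ray \<gamma> t"
proof (cases "x \<in> V")
  case False
  then obtain e t where et: "e \<in> E" "t \<in> {0..1}" "x = \<phi> e t" using assms topspace_eq by auto
  then have "t \<in> {0<..<1}" using False phi_V[of e t] by (auto simp: less_le)
  then show thesis using et that(2)[of "(e, False)" t] by (simp add: ray_def)
qed (use that in simp)

lemma closedin_phi_image: "e \<in> E \<Longrightarrow> closed C \<Longrightarrow> C \<subseteq> {0..1} \<Longrightarrow> closedin X (\<phi> e ` C)"
proof -
  assume *: "e \<in> E" "closed C" "C \<subseteq> {0..1}"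
  have "compact C" using * by (metis compact_Icc compact_Int_closed inf.absorb_iff2)
  then have "compactin (top_of_set {0..1}) C"
    using * by (simp add: compactin_subtopology)
  then show ?thesis
    using image_compactin[OF _ phi_continuous] Hausdorff * by (metis compactin_imp_closedin)
qed

lemma closedin_V: "U \<subseteq> V \<Longrightarrow> closedin X U"
  using Hausdorff finite_V V_subset closedin_Hausdorff_finite finite_subset
  by (metis subset_trans)

lemma compact_X: "compact_space X"
proof -
  have "compactin X (V \<union> (\<Union>e\<in>E. \<phi> e ` {0..1}))"
  proof (rule compactin_Un)
    show "compactin X V" using finite_V V_subset by (simp add: finite_imp_compactin)
    show "compactin X (\<Union>e\<in>E. \<phi> e ` {0..1})"
      by (rule compactin_Union) (use finite_E in \<open>auto intro!: image_compactin[OF _ phi_continuous] simp: compactin_subtopology\<close>)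
  qed
  then show ?thesis by (simp add: compact_space_def topspace_eq)
qed

text \<open>The quotient topology: the complement of \<open>W\<close> is a finite union of
  continuous images of compact sets, hence closed in a Hausdorff space.\<close>

lemma openin_iff:
  "openin X W \<longleftrightarrow> W \<subseteq> topspace X \<and>
    (\<forall>\<gamma>::'e \<times> bool. fst \<gamma> \<in> E \<longrightarrow> openin (top_of_set {0..1}) {t\<in>{0..1}. ray \<gamma> t \<in> W})"
proof
  assume W: "openin X W"
  show "W \<subseteq> topspace X \<and>
    (\<forall>\<gamma>::'e \<times> bool. fst \<gamma> \<in> E \<longrightarrow> openin (top_of_set {0..1}) {t\<in>{0..1}. ray \<gamma> t \<in> W})"
    using openin_subset[OF W] openin_continuous_map_preimage[OF ray_continuous W] by auto
next
  assume W: "W \<subseteq> topspace X \<and>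
    (\<forall>\<gamma>::'e \<times> bool. fst \<gamma> \<in> E \<longrightarrow> openin (top_of_set {0..1}) {t\<in>{0..1}. ray \<gamma> t \<in> W})"
  have "closedin X (\<phi> e ` {t\<in>{0..1}. \<phi> e t \<notin> W})" if e: "e \<in> E" for e
  proof (rule closedin_phi_image[OF e])
    have "openin (top_of_set {0..1}) {t\<in>{0..1}. ray (e, False) t \<in> W}" using W e by auto
    then have "closedin (top_of_set {0..1}) ({0..1} - {t\<in>{0..1}. ray (e, False) t \<in> W})"
      by (metis closedin_diff closedin_topspace topspace_euclidean_subtopology)
    then have "closed ({0..1} - {t\<in>{0..1}. ray (e, False) t \<in> W})"
      by (simp add: closedin_closed_eq)
    moreover have "{0..1} - {t\<in>{0..1}. ray (e, False) t \<in> W} = {t\<in>{0..1}. \<phi> e t \<notin> W}"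
      by (auto simp: ray_def)
    ultimately show "closed {t\<in>{0..1}. \<phi> e t \<notin> W}" by simp
  qed auto
  then have "closedin X ((V - W) \<union> (\<Union>e\<in>E. \<phi> e ` {t\<in>{0..1}. \<phi> e t \<notin> W}))"
    using finite_E closedin_V[of "V - W"] by (intro closedin_Un closedin_Union) auto
  moreover have "topspace X - W = (V - W) \<union> (\<Union>e\<in>E. \<phi> e ` {t\<in>{0..1}. \<phi> e t \<notin> W})"
    unfolding topspace_eq by auto
  ultimately show "openin X W"
    using W by (simp add: openin_closedin_eq)
qed

lemma openin_ray_image:
  assumes \<gamma>: "fst \<gamma> \<in> E" and S: "open S" "S \<subseteq> {0<..<1}"
  shows "openin X (ray \<gamma> ` S)"
  unfolding openin_iff
proof (intro conjI allI impI)
  show "ray \<gamma> ` S \<subseteq> topspace X" using ray_in[OF \<gamma>] S by force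
  fix \<gamma>' :: "'e \<times> bool" assume \<gamma>': "fst \<gamma>' \<in> E"
  have "{t\<in>{0..1}. ray \<gamma>' t \<in> ray \<gamma> ` S}
      = {0..1} \<inter> (if \<gamma>' = \<gamma> then S else if \<gamma>' = opp \<gamma> then (\<lambda>t. 1 - t) -` S else {})"
    (is "?L = ?R")
  proof (intro equalityI subsetI)
    fix t assume "t \<in> ?L"
    then obtain s where "s \<in> S" "ray \<gamma> s = ray \<gamma>' t" "t \<in> {0..1}" by force
    moreover from this have "s \<in> {0<..<1}" using S by auto
    ultimately have "(\<gamma>' = \<gamma> \<and> t = s) \<or> (\<gamma>' = opp \<gamma> \<and> t = 1 - s)"
      using ray_eqD[OF \<gamma> \<gamma>', of s t] by blast
    then show "t \<in> ?R" using \<open>s \<in> S\<close> \<open>t \<in> {0..1}\<close> by auto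
  qed (use ray_opp in \<open>auto split: if_splits\<close>)
  moreover have "open ((\<lambda>t::real. 1 - t) -` S)"
    by (intro open_vimage S continuous_intros)
  ultimately show "openin (top_of_set {0..1}) {t\<in>{0..1}. ray \<gamma>' t \<in> ray \<gamma> ` S}"
    using S by (auto intro: openin_open_Int)
qed

lemma openin_interior: "openin X (topspace X - V)"
  using closedin_V by blast

text \<open>The subdivision points of the edge, seen from the end \<open>\<gamma>\<close>. The
  Markov axiom puts both ends of the edge among them.\<close>

definition P :: "'e \<times> bool \<Rightarrow> real set"
  where "P \<gamma> = {t\<in>{0..1}. f (ray \<gamma> t) \<in> V}"

lemma funpow_continuous: "continuous_map X X (f ^^ n)"
proof (induction n)
  case (Suc n)
  show ?case unfolding funpow.simps by (rule continuous_map_compose[OF Suc continuous_f])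
qed (simp add: id_def)

lemma iterate_ray_continuous:
  "fst \<gamma> \<in> E \<Longrightarrow> continuous_map (top_of_set {0..1}) X (\<lambda>t. (f ^^ n) (ray \<gamma> t))"
  using continuous_map_compose[OF ray_continuous funpow_continuous] by (simp add: o_def)

lemma f_ray_continuous: "fst \<gamma> \<in> E \<Longrightarrow> continuous_map (top_of_set {0..1}) X (\<lambda>t. f (ray \<gamma> t))"
  using iterate_ray_continuous[of \<gamma> 1] by simp

lemma closed_P: "fst \<gamma> \<in> E \<Longrightarrow> closed (P \<gamma>)"
  using closedin_continuous_map_preimage[OF f_ray_continuous closedin_V[OF subset_refl]]
  by (simp add: P_def closedin_closed_eq)

lemma P_ends: "fst \<gamma> \<in> E \<Longrightarrow> 0 \<in> P \<gamma>" "fst \<gamma> \<in> E \<Longrightarrow> 1 \<in> P \<gamma>" "P \<gamma> \<subseteq> {0..1}"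
  using vertices ray_V[of \<gamma> 0] ray_V[of \<gamma> 1] by (auto simp: P_def)

lemma P_opp: "t \<in> P (opp \<gamma>) \<longleftrightarrow> 1 - t \<in> P \<gamma>"
  by (auto simp: P_def ray_opp)

lemma open_preimage_interval:
  assumes \<gamma>: "fst \<gamma> \<in> E" and W: "openin X W" and pq: "{p<..<q} \<subseteq> {0..1}"
  shows "open {t\<in>{p<..<q}. f (ray \<gamma> t) \<in> W}"
proof -
  have "openin (top_of_set {0..1}) {t\<in>{0..1}. f (ray \<gamma> t) \<in> W}"
    using openin_continuous_map_preimage[OF f_ray_continuous[OF \<gamma>] W] by simp
  then obtain T where T: "open T" "{t\<in>{0..1}. f (ray \<gamma> t) \<in> W} = {0..1} \<inter> T"
    by (auto simp: openin_open)
  have "{t\<in>{p<..<q}. f (ray \<gamma> t) \<in> W} = {p<..<q} \<inter> T" using T(2) pq by blast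
  then show ?thesis using T by auto
qed

lemma near_preimage:
  assumes \<gamma>: "fst \<gamma> \<in> E" and W: "openin X W" and t: "t \<in> {0..1}" "f (ray \<gamma> t) \<in> W"
  shows "\<exists>\<delta>>0. \<forall>u\<in>{0..1}. \<bar>u - t\<bar> < \<delta> \<longrightarrow> f (ray \<gamma> u) \<in> W"
proof -
  have "openin (top_of_set {0..1}) {t\<in>{0..1}. f (ray \<gamma> t) \<in> W}"
    using openin_continuous_map_preimage[OF f_ray_continuous[OF \<gamma>] W] by simp
  then have "\<exists>\<delta>>0. \<forall>u\<in>{0..1}. dist u t < \<delta> \<longrightarrow> u \<in> {t\<in>{0..1}. f (ray \<gamma> t) \<in> W}"
    unfolding openin_euclidean_subtopology_iff using t by simp
  then show ?thesis unfolding dist_real_def by blast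
qed

text \<open>Nonfolding, transferred from neighbourhoods in the space to intervals of
  parameters.\<close>

lemma locally_inj:
  assumes \<gamma>: "fst \<gamma> \<in> E" and t: "t \<in> {0<..<1}" and n: "n > 0"
  shows "\<exists>\<delta>>0. {t - \<delta><..<t + \<delta>} \<subseteq> {0<..<1} \<and> inj_on (\<lambda>u. (f ^^ n) (ray \<gamma> u)) {t - \<delta><..<t + \<delta>}"
proof -
  have "ray \<gamma> t \<in> topspace X - V" using ray_V[OF \<gamma>, of t] ray_in[OF \<gamma>, of t] t by auto
  then obtain U where U: "openin (subtopology X (topspace X - V)) U" "ray \<gamma> t \<in> U" "inj_on (f ^^ n) U"
    using nonfolding n unfolding nonfolding_def by blast
  have "openin X U" using U(1) openin_interior openin_trans_full by blast
  then have "openin (top_of_set {0..1}) {t\<in>{0..1}. ray \<gamma> t \<in> U}" using openin_iff \<gamma> by blast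
  moreover have "t \<in> {t\<in>{0..1}. ray \<gamma> t \<in> U}" using U(2) t by auto
  ultimately have "\<exists>\<delta>>0. \<forall>u\<in>{0..1}. dist u t < \<delta> \<longrightarrow> u \<in> {t\<in>{0..1}. ray \<gamma> t \<in> U}"
    unfolding openin_euclidean_subtopology_iff by simp
  then obtain \<delta> where d: "\<delta> > 0" "\<forall>u\<in>{0..1}. dist u t < \<delta> \<longrightarrow> ray \<gamma> u \<in> U"
    by blast
  define \<epsilon> where "\<epsilon> = min \<delta> (min t (1 - t))"
  have e: "\<epsilon> > 0" "\<epsilon> \<le> \<delta>" "\<epsilon> \<le> t" "\<epsilon> \<le> 1 - t" using d t by (auto simp: \<epsilon>_def)
  have sub: "{t - \<epsilon><..<t + \<epsilon>} \<subseteq> {0<..<1}" using e by auto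
  have inU: "ray \<gamma> u \<in> U" if "u \<in> {t - \<epsilon><..<t + \<epsilon>}" for u
    using d(2) that e sub by (auto simp: dist_real_def abs_if)
  have "inj_on (\<lambda>u. (f ^^ n) (ray \<gamma> u)) {t - \<epsilon><..<t + \<epsilon>}"
  proof (rule inj_onI)
    fix u w assume uw: "u \<in> {t - \<epsilon><..<t + \<epsilon>}" "w \<in> {t - \<epsilon><..<t + \<epsilon>}"
      "(f ^^ n) (ray \<gamma> u) = (f ^^ n) (ray \<gamma> w)"
    then have "ray \<gamma> u = ray \<gamma> w" using U(3) inU by (auto dest: inj_onD)
    then show "u = w" using ray_inj[OF \<gamma>, of u w] uw(1,2) sub by fastforce
  qed
  then show ?thesis using e sub by blast
qed

end

subsection \<open>Subdivision of the edges by the map\<close>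

lemma continuous_on_Icc_extend:
  fixes g :: "real \<Rightarrow> real"
  assumes pq: "p < q" and g: "continuous_on {p<..<q} g"
    and l: "(g \<longlongrightarrow> c) (at_right p)" and r: "(g \<longlongrightarrow> d) (at_left q)"
  shows "continuous_on {p..q} (\<lambda>t. if t \<le> p then c else if t \<ge> q then d else g t)"
    (is "continuous_on _ ?k")
  unfolding continuous_on
proof
  fix x assume x: "x \<in> {p..q}"
  have k: "?k t = g t" if "p < t" "t < q" for t using that by auto
  consider "x = p" | "x = q" | "p < x" "x < q" using x by force
  then show "(?k \<longlongrightarrow> ?k x) (at x within {p..q})"
  proof cases
    case 1
    have "\<forall>\<^sub>F t in at_right p. g t = ?k t"
      unfolding eventually_at_right_field using pq by (intro exI[of _ q]) auto
    then have "(?k \<longlongrightarrow> c) (at_right p)" using l tendsto_cong by fast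
    then show ?thesis using 1 pq by (simp add: at_within_Icc_at_right)
  next
    case 2
    have "\<forall>\<^sub>F t in at_left q. g t = ?k t"
      unfolding eventually_at_left_field using pq by (intro exI[of _ p]) auto
    then have "(?k \<longlongrightarrow> d) (at_left q)" using r tendsto_cong by fast
    then show ?thesis using 2 pq by (simp add: at_within_Icc_at_left)
  next
    case 3
    have "continuous_on {p<..<q} ?k"
      using g by (rule continuous_on_eq) auto
    then have "isCont ?k x" using 3 by (simp add: continuous_on_eq_continuous_at)
    then show ?thesis using continuous_within continuous_at_imp_continuous_at_within by blast
  qed
qed

lemma strict_mono_on_if_continuous_inj:
  fixes g :: "real \<Rightarrow> real"
  assumes cont: "continuous_on {p..q} g" and inj: "inj_on g {p..q}" and pq: "p < q" "g p < g q"
  shows "strict_mono_on {p..q} g"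
proof (rule strict_mono_onI)
  have mid: "g p < g x \<and> g x < g q" if "p < x" "x < q" for x
    using continuous_inj_imp_mono[OF that cont inj] pq by auto
  fix x y assume xy: "x \<in> {p..q}" "y \<in> {p..q}" "x < y"
  consider "x = p" "y = q" | "x = p" "y < q" | "p < x" "y = q" | "p < x" "y < q" using xy by force
  then show "g x < g y"
  proof cases
    case 4
    have "continuous_on {p..y} g" "inj_on g {p..y}"
      using cont inj xy by (auto elim!: continuous_on_subset inj_on_subset)
    then have "(g p < g x \<and> g x < g y) \<or> (g y < g x \<and> g x < g p)"
      using continuous_inj_imp_mono[of p x y g] 4 xy by auto
    then show ?thesis using mid[of x] 4 xy by auto
  qed (use pq mid xy in auto)
qed

lemma finite_if_locally_finite:
  fixes S :: "real set"
  assumes "compact S" and loc: "\<And>x. x \<in> S \<Longrightarrow> \<exists>\<delta>>0. finite (S \<inter> {x - \<delta><..<x + \<delta>})"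
  shows "finite S"
proof -
  obtain \<delta> where d: "\<And>x. x \<in> S \<Longrightarrow> \<delta> x > 0 \<and> finite (S \<inter> {x - \<delta> x<..<x + \<delta> x})"
    using loc by metis
  have "S \<subseteq> (\<Union>x\<in>S. {x - \<delta> x<..<x + \<delta> x})" using d by force
  then obtain C where C: "C \<subseteq> S" "finite C" "S \<subseteq> (\<Union>x\<in>C. {x - \<delta> x<..<x + \<delta> x})"
    using compactE_image[OF assms(1), of S "\<lambda>x. {x - \<delta> x<..<x + \<delta> x}"] by auto
  then have "S = (\<Union>x\<in>C. S \<inter> {x - \<delta> x<..<x + \<delta> x})" by blast
  moreover have "finite (\<Union>x\<in>C. S \<inter> {x - \<delta> x<..<x + \<delta> x})" using C d by blast
  ultimately show ?thesis by simp
qed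

context graph_map
begin

text \<open>The part \<open>{p..q}\<close> of the edge of \<open>\<gamma>\<close> is stretched by \<open>f\<close> over the whole edge of \<open>\<gamma>'\<close>,
  starting at the end \<open>\<gamma>'\<close>.\<close>
definition piece :: "'e \<times> bool \<Rightarrow> real \<Rightarrow> real \<Rightarrow> 'e \<times> bool \<Rightarrow> (real \<Rightarrow> real) \<Rightarrow> bool"
  where "piece \<gamma> p q \<gamma>' \<kappa> \<longleftrightarrow> fst \<gamma> \<in> E \<and> fst \<gamma>' \<in> E \<and> 0 \<le> p \<and> p < q \<and> q \<le> 1 \<and>
    p \<in> P \<gamma> \<and> q \<in> P \<gamma> \<and> (\<forall>t\<in>{p<..<q}. t \<notin> P \<gamma>) \<and>
    continuous_on {p..q} \<kappa> \<and> strict_mono_on {p..q} \<kappa> \<and> \<kappa> p = 0 \<and> \<kappa> q = 1 \<and>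
    (\<forall>t\<in>{p..q}. f (ray \<gamma> t) = ray \<gamma>' (\<kappa> t))"

text \<open>Between consecutive subdivision points the image avoids the vertices and stays in one
  open edge. Its coordinate \<open>g\<close> there is injective by nonfolding and tends to 0 or 1 at
  both ends; injectivity makes the two limits different, so the image runs over the whole edge
  once.\<close>

lemma piece_between:
  assumes \<gamma>: "fst \<gamma> \<in> E" and pq: "p < q" "p \<in> P \<gamma>" "q \<in> P \<gamma>" and gap: "\<forall>t\<in>{p<..<q}. t \<notin> P \<gamma>"
  shows "\<exists>\<gamma>' \<kappa>. piece \<gamma> p q \<gamma>' \<kappa>"
proof -
  define F where "F = (\<lambda>t. f (ray \<gamma> t))"
  have pq01: "0 \<le> p" "q \<le> 1" using pq P_ends(3) by fastforce+
  have FX: "F t \<in> topspace X" if "t \<in> {0..1}" for t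
    unfolding F_def using continuous_map_image_subset_topspace[OF f_ray_continuous[OF \<gamma>]] that by auto
  have FnV: "F t \<notin> V" if "t \<in> {p<..<q}" for t
    using gap that pq01 by (auto simp: P_def F_def)
  define I where "I = (\<lambda>e. \<phi> e ` {0<..<1})"
  have I_open: "openin X (I e)" if "e \<in> E" for e
    using openin_ray_image[of "(e, False)" "{0<..<1}"] that by (simp add: ray_def I_def)
  have FI: "\<exists>e\<in>E. F t \<in> I e" if t: "t \<in> {p<..<q}" for t
  proof (rule point_cases[of "F t"])
    show "F t \<in> topspace X" using FX t pq01 by auto
    fix \<gamma>' s assume *: "fst \<gamma>' \<in> E" "s \<in> {0<..<1}" "F t = ray \<gamma>' s"
    then have "F t \<in> I (fst \<gamma>')" by (cases "snd \<gamma>'") (auto simp: ray_def I_def)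
    then show ?thesis using * by blast
  qed (use FnV t in auto)
  obtain e where e: "e \<in> E" "F ((p+q)/2) \<in> I e" using FI[of "(p+q)/2"] pq by auto
  have I_disj: "e' = e" if I: "e' \<in> E" "x \<in> I e" "x \<in> I e'" for x e'
  proof -
    obtain s where s: "s \<in> {0<..<1}" "x = \<phi> e s" using I(2) by (auto simp: I_def)
    obtain s' where s': "s' \<in> {0<..<1}" "x = \<phi> e' s'" using I(3) by (auto simp: I_def)
    have "s \<in> {0<..<1}" "s' \<in> {0<..<1}" "\<phi> e s = \<phi> e' s'" using s s' by simp_all
    then show ?thesis using phi_inj[OF e(1) I(1), of s s'] by auto
  qed
  \<comment> \<open>The open edges are open and disjoint, so the connected interval stays in the one
    that contains the image of its midpoint.\<close>
  have Fe: "F t \<in> I e" if t: "t \<in> {p<..<q}" for t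
  proof -
    define U where "U = {t\<in>{p<..<q}. F t \<in> I e}"
    define W where "W = {t\<in>{p<..<q}. F t \<in> (\<Union>e'\<in>E - {e}. I e')}"
    have sub: "{p<..<q} \<subseteq> {0..1}" using pq01 by auto
    have "open U" "open W"
      unfolding U_def W_def F_def
      by (intro open_preimage_interval \<gamma> sub I_open e openin_Union; use I_open in blast)+
    moreover have "U \<inter> W \<inter> {p<..<q} = {}"
    proof -
      have "e' = e" if "u \<in> U" "u \<in> W" "F u \<in> I e'" "e' \<in> E" for u e'
        using I_disj[of e' "F u"] that unfolding U_def by blast
      then show ?thesis unfolding W_def by blast
    qed
    moreover have "{p<..<q} \<subseteq> U \<union> W" using FI unfolding U_def W_def by blast
    ultimately have "U \<inter> {p<..<q} = {} \<or> W \<inter> {p<..<q} = {}"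
      by (intro connectedD) auto
    moreover have "(p+q)/2 \<in> U \<inter> {p<..<q}" using e pq by (auto simp: U_def)
    ultimately show ?thesis using FI[OF t] t unfolding W_def by blast
  qed
  then have "\<forall>t\<in>{p<..<q}. \<exists>s. s \<in> {0<..<1} \<and> F t = \<phi> e s"
    unfolding I_def image_iff by blast
  then obtain g where g: "\<And>t. t \<in> {p<..<q} \<Longrightarrow> g t \<in> {0<..<1} \<and> F t = \<phi> e (g t)" by metis
  have g_cont: "continuous_on {p<..<q} g"
  proof (subst continuous_on_open_vimage, simp, intro allI impI)
    fix B :: "real set" assume B: "open B"
    have "openin X (ray (e, False) ` (B \<inter> {0<..<1}))"
      by (rule openin_ray_image) (use e B in auto)
    then have "open {t\<in>{p<..<q}. f (ray \<gamma> t) \<in> ray (e, False) ` (B \<inter> {0<..<1})}"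
      by (rule open_preimage_interval[OF \<gamma>]) (use pq01 in auto)
    moreover have "{t\<in>{p<..<q}. f (ray \<gamma> t) \<in> ray (e, False) ` (B \<inter> {0<..<1})} = g -` B \<inter> {p<..<q}"
      (is "?L = ?R")
    proof (intro equalityI subsetI)
      fix t assume "t \<in> ?L"
      then obtain s where s: "t \<in> {p<..<q}" "s \<in> B" "s \<in> {0<..<1}" "F t = \<phi> e s"
        by (auto simp: F_def ray_def)
      then have "s = g t" using g[of t] phi_inj[OF e(1) e(1), of s "g t"] by auto
      then show "t \<in> ?R" using s by auto
    next
      fix t assume "t \<in> ?R"
      then show "t \<in> ?L" using g[of t] by (auto simp: F_def ray_def)
    qed
    ultimately show "open (g -` B \<inter> {p<..<q})" by simp
  qed
  have g_inj: "inj_on g {p<..<q}"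
  proof (rule locally_inj_imp_inj_interval[OF g_cont])
    fix x assume x: "p < x" "x < q"
    then obtain \<delta> where d: "\<delta> > 0" "inj_on (\<lambda>u. (f ^^ 1) (ray \<gamma> u)) {x - \<delta><..<x + \<delta>}"
      using locally_inj[OF \<gamma>, of x 1] pq01 by auto
    have "inj_on g ({x - \<delta><..<x + \<delta>} \<inter> {p<..<q})"
    proof (rule inj_onI)
      fix u w assume uw: "u \<in> {x - \<delta><..<x + \<delta>} \<inter> {p<..<q}" "w \<in> {x - \<delta><..<x + \<delta>} \<inter> {p<..<q}" "g u = g w"
      then have "F u = F w" using g[of u] g[of w] by auto
      then show "u = w" using inj_onD[OF d(2), of u w] uw by (auto simp: F_def)
    qed
    then show "\<exists>\<delta>>0. inj_on g ({x - \<delta><..<x + \<delta>} \<inter> {p<..<q})" using d by blast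
  qed
  \<comment> \<open>The endpoint is mapped to a vertex, hence off the compact middle part of
    \<open>e\<close>; by continuity nearby points avoid that part too.\<close>
  have near: "\<exists>\<delta>>0. \<forall>t\<in>{p<..<q}. \<bar>t - c\<bar> < \<delta> \<longrightarrow> \<bar>g t\<bar> < \<eta> \<or> \<bar>g t - 1\<bar> < \<eta>"
    if c: "c \<in> {p, q}" and \<eta>: "\<eta> > 0" for c \<eta>
  proof -
    have c01: "c \<in> {0..1}" "f (ray \<gamma> c) \<in> V" using c pq by (auto simp: P_def)
    have cl: "closedin X (\<phi> e ` {\<eta>..1 - \<eta>})"
      using closedin_phi_image[OF e(1)] \<eta> by auto
    have "f (ray \<gamma> c) \<notin> \<phi> e ` {\<eta>..1 - \<eta>}"
    proof
      assume "f (ray \<gamma> c) \<in> \<phi> e ` {\<eta>..1 - \<eta>}"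
      then obtain s where "s \<in> {\<eta>..1 - \<eta>}" "\<phi> e s \<in> V" using c01 by auto
      then show False using phi_V[OF e(1), of s] \<eta> by auto
    qed
    then have "f (ray \<gamma> c) \<in> topspace X - \<phi> e ` {\<eta>..1 - \<eta>}" using c01 V_subset by blast
    then obtain \<delta> where d: "\<delta> > 0" "\<forall>u\<in>{0..1}. \<bar>u - c\<bar> < \<delta> \<longrightarrow> f (ray \<gamma> u) \<in> topspace X - \<phi> e ` {\<eta>..1 - \<eta>}"
      using near_preimage[OF \<gamma> openin_diff[OF openin_topspace cl] c01(1)] by blast
    have "\<bar>g t\<bar> < \<eta> \<or> \<bar>g t - 1\<bar> < \<eta>" if t: "t \<in> {p<..<q}" "\<bar>t - c\<bar> < \<delta>" for t
    proof -
      have "\<phi> e (g t) \<notin> \<phi> e ` {\<eta>..1 - \<eta>}" using d t g[of t] pq01 by (auto simp: F_def)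
      then have "g t \<notin> {\<eta>..1 - \<eta>}" by blast
      then show ?thesis using g[of t] t by auto
    qed
    then show ?thesis using d by blast
  qed
  have "\<exists>c\<in>{0,1}. (g \<longlongrightarrow> c) (at_right p)"
  proof (rule tendsto_01_at_right[OF pq(1) g_cont])
    fix \<eta> :: real assume "\<eta> > 0"
    then obtain \<delta> where d: "\<delta> > 0" "\<forall>t\<in>{p<..<q}. \<bar>t - p\<bar> < \<delta> \<longrightarrow> \<bar>g t\<bar> < \<eta> \<or> \<bar>g t - 1\<bar> < \<eta>"
      using near[of p \<eta>] by auto
    then show "\<exists>\<delta>>0. \<forall>t\<in>{p<..<q}. t < p + \<delta> \<longrightarrow> \<bar>g t\<bar> < \<eta> \<or> \<bar>g t - 1\<bar> < \<eta>"
      by (intro exI[of _ \<delta>]) auto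
  qed
  then obtain c where c: "c \<in> {0,1}" "(g \<longlongrightarrow> c) (at_right p)" by blast
  have "\<exists>c\<in>{0,1}. (g \<longlongrightarrow> c) (at_left q)"
  proof (rule tendsto_01_at_left[OF pq(1) g_cont])
    fix \<eta> :: real assume "\<eta> > 0"
    then obtain \<delta> where d: "\<delta> > 0" "\<forall>t\<in>{p<..<q}. \<bar>t - q\<bar> < \<delta> \<longrightarrow> \<bar>g t\<bar> < \<eta> \<or> \<bar>g t - 1\<bar> < \<eta>"
      using near[of q \<eta>] by auto
    then show "\<exists>\<delta>>0. \<forall>t\<in>{p<..<q}. q - \<delta> < t \<longrightarrow> \<bar>g t\<bar> < \<eta> \<or> \<bar>g t - 1\<bar> < \<eta>"
      by (intro exI[of _ \<delta>]) auto
  qed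
  then obtain d where d: "d \<in> {0,1}" "(g \<longlongrightarrow> d) (at_left q)" by blast
  define k where "k = (\<lambda>t. if t \<le> p then c else if t \<ge> q then d else g t)"
  have k_cont: "continuous_on {p..q} k"
    unfolding k_def by (rule continuous_on_Icc_extend[OF pq(1) g_cont c(2) d(2)])
  have kg: "k t = g t" if "t \<in> {p<..<q}" for t using that by (auto simp: k_def)
  have kends: "k p = c" "k q = d" using pq by (auto simp: k_def)
  have k_inj: "k p \<noteq> k q" "inj_on k {p..q}"
  proof -
    have "inj_on k {p<..<q}" using g_inj kg by (simp add: inj_on_def)
    then show "k p \<noteq> k q" "inj_on k {p..q}"
      using inj_continuous_endpoint_values[OF pq(1) k_cont] kg g kends c d by auto
  qed
  have k01: "k t \<in> {0..1}" if "t \<in> {p..q}" for t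
  proof (cases "t \<in> {p<..<q}")
    case True then show ?thesis using kg g[of t] by auto
  next
    case False then show ?thesis using that c d by (auto simp: k_def)
  qed
  \<comment> \<open>Inside the interval this is the choice of \<open>g\<close>. The coincidence set
    is closed because the space is Hausdorff, so it contains the ends.\<close>
  have Fk: "F t = \<phi> e (k t)" if t: "t \<in> {p..q}" for t
  proof -
    have 1: "continuous_map (top_of_set {p..q}) X F"
      unfolding F_def by (rule continuous_map_from_subtopology_mono[OF f_ray_continuous[OF \<gamma>]]) (use pq01 in auto)
    have "continuous_map (top_of_set {p..q}) (top_of_set {0..1}) k"
      using k_cont k01 by auto
    from continuous_map_compose[OF this phi_continuous[OF e(1)]]
    have 2: "continuous_map (top_of_set {p..q}) X (\<lambda>t. \<phi> e (k t))" by (simp add: o_def)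
    have "closed {t\<in>{p..q}. F t = \<phi> e (k t)}"
      using closedin_continuous_maps_eq[OF Hausdorff 1 2] by (simp add: closedin_closed_eq)
    moreover have "{p<..<q} \<subseteq> {t\<in>{p..q}. F t = \<phi> e (k t)}" using kg g by auto
    ultimately have "closure {p<..<q} \<subseteq> {t\<in>{p..q}. F t = \<phi> e (k t)}" by (rule closure_minimal[rotated])
    then show ?thesis using t pq(1) by auto
  qed
  \<comment> \<open>The target germ is the end of \<open>e\<close> where the image starts, so that
    the lift increases from 0.\<close>
  define \<gamma>' where "\<gamma>' = (e, k p \<noteq> 0)"
  define \<kappa> where "\<kappa> = (\<lambda>t. if k p = 0 then k t else 1 - k t)"
  have ke: "(k p = 0 \<and> k q = 1) \<or> (k p = 1 \<and> k q = 0)" using k_inj kends c d by auto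
  have "continuous_on {p..q} \<kappa>" unfolding \<kappa>_def using k_cont by (cases "k p = 0") (auto intro!: continuous_intros)
  moreover have "inj_on \<kappa> {p..q}" using k_inj(2) unfolding \<kappa>_def inj_on_def by auto
  moreover have "\<kappa> p = 0" "\<kappa> q = 1" using ke by (auto simp: \<kappa>_def)
  moreover have "\<forall>t\<in>{p..q}. f (ray \<gamma> t) = ray \<gamma>' (\<kappa> t)"
    using Fk by (auto simp: F_def ray_def \<gamma>'_def \<kappa>_def)
  ultimately have "piece \<gamma> p q \<gamma>' \<kappa>"
    using strict_mono_on_if_continuous_inj[of p q \<kappa>] \<gamma> e pq pq01 gap
    by (auto simp: piece_def \<gamma>'_def)
  then show ?thesis by blast
qed

lemma locally_finite_preimage:
  assumes \<gamma>: "fst \<gamma> \<in> E" and t: "t \<in> {0<..<1}" and A: "finite A"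
  shows "\<exists>\<delta>>0. finite ({u\<in>{0..1}. f (ray \<gamma> u) \<in> A} \<inter> {t - \<delta><..<t + \<delta>})"
proof -
  obtain \<delta> where d: "\<delta> > 0" "inj_on (\<lambda>u. (f ^^ 1) (ray \<gamma> u)) {t - \<delta><..<t + \<delta>}"
    using locally_inj[OF \<gamma> t, of 1] by auto
  have "finite ({u\<in>{0..1}. f (ray \<gamma> u) \<in> A} \<inter> {t - \<delta><..<t + \<delta>})"
  proof (rule inj_on_finite)
    show "inj_on (\<lambda>u. f (ray \<gamma> u)) ({u\<in>{0..1}. f (ray \<gamma> u) \<in> A} \<inter> {t - \<delta><..<t + \<delta>})"
      using d(2) by (auto elim!: inj_on_subset)
    show "(\<lambda>u. f (ray \<gamma> u)) ` ({u\<in>{0..1}. f (ray \<gamma> u) \<in> A} \<inter> {t - \<delta><..<t + \<delta>}) \<subseteq> A" by auto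
  qed (rule A)
  then show ?thesis using d by blast
qed

text \<open>Nonfolding makes \<open>P \<gamma>\<close> locally finite inside the edge, so it
  contains no interval. Accumulation at the two ends is not excluded at this stage.\<close>

lemma exists_outside_P:
  assumes \<gamma>: "fst \<gamma> \<in> E" and ab: "0 \<le> a" "a < b" "b \<le> 1"
  shows "\<exists>w\<in>{a<..<b}. w \<notin> P \<gamma>"
proof (rule ccontr)
  assume *: "\<not> ?thesis"
  define m where "m = (a+b)/2"
  have m: "a < m" "m < b" using ab by (auto simp: m_def)
  then obtain \<delta> where d: "\<delta> > 0" "finite ({u\<in>{0..1}. f (ray \<gamma> u) \<in> V} \<inter> {m - \<delta><..<m + \<delta>})"
    using locally_finite_preimage[OF \<gamma>, of m V] finite_V ab by auto
  have "{max a (m - \<delta>)<..<min b (m + \<delta>)} \<subseteq> {u\<in>{0..1}. f (ray \<gamma> u) \<in> V} \<inter> {m - \<delta><..<m + \<delta>}"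
    using * ab by (auto simp: P_def)
  then have "finite {max a (m - \<delta>)<..<min b (m + \<delta>)}" using d(2) finite_subset by blast
  then show False using m d(1) infinite_Ioo[of "max a (m - \<delta>)" "min b (m + \<delta>)"] by auto
qed

text \<open>\<open>P \<gamma>\<close> is closed but not yet known to be finite, so the neighbouring
  subdivision points are a supremum and an infimum.\<close>

lemma piece_around:
  assumes \<gamma>: "fst \<gamma> \<in> E" and w: "w \<in> {0..1}" "w \<notin> P \<gamma>"
    and ab: "a \<in> P \<gamma>" "a < w" "b \<in> P \<gamma>" "w < b"
  shows "\<exists>p q \<gamma>' \<kappa>. piece \<gamma> p q \<gamma>' \<kappa> \<and> a \<le> p \<and> p < w \<and> w < q \<and> q \<le> b"
proof -
  define A where "A = P \<gamma> \<inter> {a..w}"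
  define B where "B = P \<gamma> \<inter> {w..b}"
  have cA: "closed A" "A \<noteq> {}" "bdd_above A" using closed_P[OF \<gamma>] ab by (auto simp: A_def)
  have cB: "closed B" "B \<noteq> {}" "bdd_below B" using closed_P[OF \<gamma>] ab by (auto simp: B_def)
  have p: "Sup A \<in> A" by (rule closed_contains_Sup) (use cA in auto)
  have q: "Inf B \<in> B" by (rule closed_contains_Inf) (use cB in auto)
  have pw: "Sup A < w" using p w by (auto simp: A_def less_le)
  have qw: "w < Inf B" using q w by (auto simp: B_def less_le)
  have "t \<notin> P \<gamma>" if t: "Sup A < t" "t < Inf B" for t
  proof
    assume tP: "t \<in> P \<gamma>"
    show False
    proof (cases "t \<le> w")
      case True
      then have "t \<in> A" using tP t p by (auto simp: A_def)
      then show False using cSup_upper[of t A] cA t by auto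
    next
      case False
      then have "t \<in> B" using tP t q by (auto simp: B_def)
      then show False using cInf_lower[of t B] cB t by auto
    qed
  qed
  then obtain \<gamma>' \<kappa> where "piece \<gamma> (Sup A) (Inf B) \<gamma>' \<kappa>"
    using piece_between[OF \<gamma>, of "Sup A" "Inf B"] p q pw qw by (auto simp: A_def B_def)
  moreover have "a \<le> Sup A" "Inf B \<le> b" using p q by (auto simp: A_def B_def)
  ultimately show ?thesis using pw qw by blast
qed

lemma piece_mid:
  assumes "piece \<gamma> p q \<gamma>' \<kappa>"
  shows "\<exists>u\<in>{p<..<q}. f (ray \<gamma> u) = ray \<gamma>' (1/2)"
proof -
  have "\<exists>u\<ge>p. u \<le> q \<and> \<kappa> u = 1/2"
    using assms IVT'[of \<kappa> p "1/2" q] by (auto simp: piece_def)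
  then obtain u where u: "p \<le> u" "u \<le> q" "\<kappa> u = 1/2" by auto
  then have "u \<noteq> p" "u \<noteq> q" using assms by (auto simp: piece_def)
  moreover have "f (ray \<gamma> u) = ray \<gamma>' (\<kappa> u)" using u assms by (auto simp: piece_def)
  ultimately show ?thesis using u by (intro bexI[of _ u]) auto
qed

text \<open>Between two points of \<open>P \<gamma>\<close> there is a point that is mapped to the midpoint of an edge,
  and there are only finitely many of these.\<close>
lemma finite_P:
  assumes \<gamma>: "fst \<gamma> \<in> E"
  shows "finite (P \<gamma>)"
proof -
  define M where "M = (\<lambda>e. \<phi> e (1/2)) ` E"
  define Q where "Q = {u\<in>{0..1}. f (ray \<gamma> u) \<in> M}"
  have MV: "M \<inter> V = {}" using phi_V[of _ "1/2"] by (auto simp: M_def)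
  have "M \<subseteq> topspace X" using topspace_eq by (force simp: M_def)
  then have "closedin X M"
    using finite_E Hausdorff by (intro closedin_Hausdorff_finite) (auto simp: M_def)
  then have "closed Q"
    using closedin_continuous_map_preimage[OF f_ray_continuous[OF \<gamma>]]
    by (simp add: Q_def closedin_closed_eq)
  moreover have "Q \<subseteq> {0..1}" by (auto simp: Q_def)
  ultimately have "compact Q"
    using bounded_subset[OF bounded_closed_interval, of Q 0 1] by (simp add: compact_eq_bounded_closed)
  moreover have "\<exists>\<delta>>0. finite (Q \<inter> {t - \<delta><..<t + \<delta>})" if t: "t \<in> Q" for t
  proof -
    \<comment> \<open>The ends are mapped to vertices, not to midpoints of edges. So
      \<open>Q\<close> misses exactly the points where nonfolding gives no local finiteness.\<close>
    have "t \<noteq> 0" "t \<noteq> 1" using P_ends[of \<gamma>] \<gamma> t MV by (auto simp: Q_def P_def)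
    then have "t \<in> {0<..<1}" using t by (auto simp: Q_def)
    then show ?thesis using locally_finite_preimage[OF \<gamma>, of t M] finite_E by (auto simp: Q_def M_def)
  qed
  ultimately have fQ: "finite Q" by (rule finite_if_locally_finite)
  have betw: "\<exists>u\<in>Q. a < u \<and> u < b" if ab: "a \<in> P \<gamma>" "b \<in> P \<gamma>" "a < b" for a b
  proof -
    have ab01: "0 \<le> a" "b \<le> 1" using ab P_ends(3) by fastforce+
    obtain w where w: "w \<in> {a<..<b}" "w \<notin> P \<gamma>" using exists_outside_P[OF \<gamma>] ab01 ab by blast
    then obtain p q \<gamma>' \<kappa> where pc: "piece \<gamma> p q \<gamma>' \<kappa>" "a \<le> p" "q \<le> b"
      using piece_around[OF \<gamma>, of w a b] ab ab01 by auto
    obtain u where u: "u \<in> {p<..<q}" "f (ray \<gamma> u) = ray \<gamma>' (1/2)" using piece_mid[OF pc(1)] by blast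
    have "ray \<gamma>' (1/2) \<in> M" using pc(1) by (cases "snd \<gamma>'") (auto simp: piece_def ray_def M_def)
    then have "u \<in> Q" using u pc(1) by (auto simp: Q_def piece_def)
    then show ?thesis using u pc by force
  qed
  \<comment> \<open>Any two points of \<open>P \<gamma>\<close> are separated by a point of
    \<open>Q\<close>, so \<open>P \<gamma>\<close> embeds into the power set of the finite set
    \<open>Q\<close>.\<close>
  have inj: "inj_on (\<lambda>a. Q \<inter> {..a}) (P \<gamma>)"
  proof (rule linorder_inj_onI)
    fix a b assume "a \<in> P \<gamma>" "b \<in> P \<gamma>" "a < b"
    then obtain u where "u \<in> Q" "a < u" "u < b" using betw by blast
    then have "u \<in> Q \<inter> {..b}" "u \<notin> Q \<inter> {..a}" by auto
    then show "Q \<inter> {..a} \<noteq> Q \<inter> {..b}" by blast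
  qed auto
  show ?thesis
    by (rule inj_on_finite[OF inj, of "Pow Q"]) (use fQ in auto)
qed

text \<open>The convention \<open>p \<le> t < q\<close> selects, at a subdivision point, the piece
  that starts there; hence \<open>t < 1\<close>.\<close>

lemma next_point:
  assumes \<gamma>: "fst \<gamma> \<in> E" and t: "0 \<le> t" "t < 1"
  shows "\<exists>p q \<gamma>' \<kappa>. piece \<gamma> p q \<gamma>' \<kappa> \<and> p \<le> t \<and> t < q"
proof -
  define p where "p = Max (P \<gamma> \<inter> {..t})"
  define q where "q = Min (P \<gamma> \<inter> {t<..})"
  have A: "finite (P \<gamma> \<inter> {..t})" "P \<gamma> \<inter> {..t} \<noteq> {}"
    and B: "finite (P \<gamma> \<inter> {t<..})" "P \<gamma> \<inter> {t<..} \<noteq> {}"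
    using finite_P[OF \<gamma>] P_ends[of \<gamma>] \<gamma> t by auto
  have p: "p \<in> P \<gamma>" "p \<le> t" and q: "q \<in> P \<gamma>" "t < q"
    using Max_in[OF A] Min_in[OF B] by (auto simp: p_def q_def)
  have "u \<notin> P \<gamma>" if "p < u" "u < q" for u
    using Max_ge[OF A(1), of u] Min_le[OF B(1), of u] that by (force simp: p_def q_def not_le)
  then show ?thesis using piece_between[OF \<gamma>, of p q] p q by (meson greaterThanLessThan_iff le_less_trans)
qed

end

subsection \<open>Germs and expansion\<close>

lemma IVT_strict_mono:
  fixes k :: "real \<Rightarrow> real"
  assumes "continuous_on {a..b} k" "a \<le> b" "k a < s" "s \<le> k b"
  obtains u where "a < u" "u \<le> b" "k u = s"
proof -
  obtain u where "a \<le> u" "u \<le> b" "k u = s" using IVT'[of k a s b] assms by auto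
  moreover from this have "u \<noteq> a" using assms(3) by auto
  ultimately show thesis using that[of u] by simp
qed

context graph_map
begin

lemma pieceD:
  assumes "piece \<gamma> p q \<gamma>' \<kappa>"
  shows "fst \<gamma> \<in> E" "fst \<gamma>' \<in> E" "0 \<le> p" "p < q" "q \<le> 1" "p \<in> P \<gamma>" "q \<in> P \<gamma>"
    and "\<And>t. p < t \<Longrightarrow> t < q \<Longrightarrow> t \<notin> P \<gamma>"
    and "continuous_on {p..q} \<kappa>" "strict_mono_on {p..q} \<kappa>" "\<kappa> p = 0" "\<kappa> q = 1"
    and "\<And>t. p \<le> t \<Longrightarrow> t \<le> q \<Longrightarrow> f (ray \<gamma> t) = ray \<gamma>' (\<kappa> t)"
    and "\<And>s t. p \<le> s \<Longrightarrow> s < t \<Longrightarrow> t \<le> q \<Longrightarrow> \<kappa> s < \<kappa> t"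
  using assms by (auto simp: piece_def strict_mono_on_def)

lemma piece_opp:
  assumes "piece \<gamma> p q \<gamma>' \<kappa>"
  shows "piece (opp \<gamma>) (1 - q) (1 - p) (opp \<gamma>') (\<lambda>u. 1 - \<kappa> (1 - u))"
proof -
  note D = pieceD[OF assms]
  have "continuous_on {1 - q..1 - p} (\<lambda>u. \<kappa> (1 - u))"
    by (rule continuous_on_compose2[OF D(9)]) (auto intro!: continuous_intros)
  then have "continuous_on {1 - q..1 - p} (\<lambda>u. 1 - \<kappa> (1 - u))"
    by (intro continuous_intros)
  moreover have "strict_mono_on {1 - q..1 - p} (\<lambda>u. 1 - \<kappa> (1 - u))"
    using D(14) by (intro strict_mono_onI) auto
  ultimately show ?thesis
    using D by (auto simp: piece_def P_opp ray_opp)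
qed

lemma piece_range:
  assumes "piece \<gamma> p q \<gamma>' \<kappa>"
  shows "p \<le> t \<Longrightarrow> t \<le> q \<Longrightarrow> \<kappa> t \<in> {0..1}" "p < t \<Longrightarrow> t < q \<Longrightarrow> \<kappa> t \<in> {0<..<1}"
proof -
  note D = pieceD[OF assms]
  show "\<kappa> t \<in> {0<..<1}" if "p < t" "t < q" for t
    using D(14)[of p t] D(14)[of t q] that D by auto
  then show "p \<le> t \<Longrightarrow> t \<le> q \<Longrightarrow> \<kappa> t \<in> {0..1}"
    using D(11,12) by (cases "t = p \<or> t = q") (auto simp: less_le)
qed

text \<open>Neither endpoint can lie inside the other piece, so the pieces coincide. Different
  target germs would be the two ends of one edge, and then one lift would be 1 minus the other,
  although both increase.\<close>

lemma piece_unique: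
  assumes 1: "piece \<gamma> p q1 \<gamma>1 \<kappa>1" and 2: "piece \<gamma> p q2 \<gamma>2 \<kappa>2"
  shows "q2 = q1 \<and> \<gamma>2 = \<gamma>1"
proof -
  note D1 = pieceD[OF 1] and D2 = pieceD[OF 2]
  have q: "q2 = q1"
    using D1(8)[of q2] D2(8)[of q1] D1(4,7) D2(4,7) by (meson linorder_neqE_linordered_idom)
  have "\<gamma>2 = \<gamma>1"
  proof (rule ccontr)
    assume ne: "\<gamma>2 \<noteq> \<gamma>1"
    have rel: "\<kappa>2 t = 1 - \<kappa>1 t" if t: "p < t" "t < q1" for t
    proof -
      have "ray \<gamma>1 (\<kappa>1 t) = ray \<gamma>2 (\<kappa>2 t)" using D1(13)[of t] D2(13)[of t] t q by auto
      then show ?thesis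
        using ray_eqD[OF D1(2) D2(2), of "\<kappa>1 t" "\<kappa>2 t"] ne
          piece_range(2)[OF 1, of t] piece_range(1)[OF 2, of t] t q by auto
    qed
    obtain u where u: "p < u" "u \<le> q1" "\<kappa>1 u = 1/2"
      using IVT_strict_mono[OF D1(9), of "1/2"] D1 by auto
    have "u < q1" using u D1(12) by (cases "u = q1") auto
    define w where "w = (p + u)/2"
    have w: "p < w" "w < u" using u by (auto simp: w_def)
    show False
      using rel[of u] rel[of w] u w \<open>u < q1\<close> D1(14)[of w u] D2(14)[of w u] q by auto
  qed
  then show ?thesis using q by simp
qed

lemma first_piece:
  assumes \<gamma>: "fst \<gamma> \<in> E" and t: "t \<in> P \<gamma>" "t < 1"
  shows "\<exists>q \<gamma>' \<kappa>. piece \<gamma> t q \<gamma>' \<kappa>"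
proof -
  have "t \<in> {0..1}" using t P_ends(3) by blast
  then obtain p q \<gamma>' \<kappa> where pc: "piece \<gamma> p q \<gamma>' \<kappa>" "p \<le> t" "t < q"
    using next_point[OF \<gamma>, of t] t by auto
  have "p = t"
  proof (rule ccontr)
    assume "p \<noteq> t"
    then show False using t pc pieceD(8)[OF pc(1), of t] by auto
  qed
  then show ?thesis using pc by blast
qed

text \<open>The action of \<open>f\<close> on directions at vertices, a combinatorial derivative. By
  \<open>piece_unique\<close> the choice is no choice.\<close>

definition DF :: "'e \<times> bool \<Rightarrow> 'e \<times> bool"
  where "DF \<gamma> = (SOME \<gamma>'. \<exists>q \<kappa>. piece \<gamma> 0 q \<gamma>' \<kappa>)"

lemma DF_piece: "fst \<gamma> \<in> E \<Longrightarrow> \<exists>q \<kappa>. piece \<gamma> 0 q (DF \<gamma>) \<kappa>"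
proof -
  assume "fst \<gamma> \<in> E"
  then have "\<exists>\<gamma>' q \<kappa>. piece \<gamma> 0 q \<gamma>' \<kappa>" using first_piece[of \<gamma> 0] P_ends(1)[of \<gamma>] by auto
  then show ?thesis unfolding DF_def by (rule someI_ex)
qed

lemma DF_in: "fst \<gamma> \<in> E \<Longrightarrow> fst (DF \<gamma>) \<in> E"
  using DF_piece pieceD(2) by blast

lemma DF_base: "fst \<gamma> \<in> E \<Longrightarrow> ray (DF \<gamma>) 0 = f (ray \<gamma> 0)"
proof -
  assume "fst \<gamma> \<in> E"
  then obtain q \<kappa> where p: "piece \<gamma> 0 q (DF \<gamma>) \<kappa>" using DF_piece by blast
  then show ?thesis using pieceD(13)[OF p, of 0] pieceD(4,11)[OF p] by auto
qed

lemma DF_pow_in: "fst \<gamma> \<in> E \<Longrightarrow> fst ((DF ^^ n) \<gamma>) \<in> E"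
  by (induction n) (auto intro: DF_in)

lemma DF_pow_base: "fst \<gamma> \<in> E \<Longrightarrow> ray ((DF ^^ n) \<gamma>) 0 = (f ^^ n) (ray \<gamma> 0)"
  by (induction n) (auto simp: DF_base DF_pow_in)

text \<open>Near its base a germ is carried monotonically by every iterate; the neighbourhood
  shrinks with \<open>n\<close>.\<close>

lemma germ_push:
  assumes \<gamma>: "fst \<gamma> \<in> E"
  shows "\<exists>\<epsilon> \<kappa>. 0 < \<epsilon> \<and> \<epsilon> \<le> 1 \<and> continuous_on {0..\<epsilon>} \<kappa> \<and> strict_mono_on {0..\<epsilon>} \<kappa> \<and> \<kappa> 0 = 0 \<and>
    (\<forall>t\<in>{0..\<epsilon>}. \<kappa> t \<in> {0..1} \<and> (f ^^ n) (ray \<gamma> t) = ray ((DF ^^ n) \<gamma>) (\<kappa> t))"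
proof (induction n)
  case 0
  show ?case by (intro exI[of _ 1] exI[of _ id]) (auto simp: strict_mono_on_def)
next
  case (Suc n)
  then obtain \<epsilon> \<kappa> where *: "0 < \<epsilon>" "\<epsilon> \<le> 1" "continuous_on {0..\<epsilon>} \<kappa>" "strict_mono_on {0..\<epsilon>} \<kappa>" "\<kappa> 0 = 0"
    and eq: "\<And>t. t \<in> {0..\<epsilon>} \<Longrightarrow> \<kappa> t \<in> {0..1} \<and> (f ^^ n) (ray \<gamma> t) = ray ((DF ^^ n) \<gamma>) (\<kappa> t)"
    by blast
  obtain q k where pc: "piece ((DF ^^ n) \<gamma>) 0 q (DF ((DF ^^ n) \<gamma>)) k"
    using DF_piece DF_pow_in[OF \<gamma>] by blast
  note D = pieceD[OF pc]
  have kmono: "\<kappa> s < \<kappa> t" if "0 \<le> s" "s < t" "t \<le> \<epsilon>" for s t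
    using *(4) that by (auto simp: strict_mono_on_def)
  \<comment> \<open>Shrinking keeps the lift found so far inside the first piece of the next
    germ.\<close>
  obtain \<epsilon>' where e': "0 < \<epsilon>'" "\<epsilon>' \<le> \<epsilon>" "\<kappa> \<epsilon>' \<le> q"
  proof (cases "\<kappa> \<epsilon> \<le> q")
    case True
    then show thesis using that[of \<epsilon>] * by auto
  next
    case False
    then obtain u where "0 < u" "u \<le> \<epsilon>" "\<kappa> u = q"
      using IVT_strict_mono[OF *(3), of q] * D(4) by auto
    then show thesis using that by auto
  qed
  have rng: "\<kappa> t \<in> {0..q}" if "t \<in> {0..\<epsilon>'}" for t
    using eq[of t] kmono[of t \<epsilon>'] that e' by (cases "t = \<epsilon>'") auto
  have "continuous_on {0..\<epsilon>'} (\<lambda>t. k (\<kappa> t))"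
    by (rule continuous_on_compose2[OF D(9)]) (use * e' rng in \<open>auto elim!: continuous_on_subset\<close>)
  moreover have "strict_mono_on {0..\<epsilon>'} (\<lambda>t. k (\<kappa> t))"
  proof (rule strict_mono_onI)
    fix s t assume st: "s \<in> {0..\<epsilon>'}" "t \<in> {0..\<epsilon>'}" "s < t"
    then have "\<kappa> s < \<kappa> t" using kmono e' by auto
    then show "k (\<kappa> s) < k (\<kappa> t)" using D(14) rng st by auto
  qed
  moreover have "k (\<kappa> t) \<in> {0..1} \<and> (f ^^ Suc n) (ray \<gamma> t) = ray ((DF ^^ Suc n) \<gamma>) (k (\<kappa> t))"
    if t: "t \<in> {0..\<epsilon>'}" for t
    using piece_range(1)[OF pc, of "\<kappa> t"] D(13)[of "\<kappa> t"] rng[OF t] eq[of t] t e' by auto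
  ultimately show ?case
    using e' *(2,5) D(11) by (intro exI[of _ \<epsilon>'] exI[of _ "\<lambda>t. k (\<kappa> t)"]) auto
qed

text \<open>Germs with the same image are folded together arbitrarily close to their bases: both
  lifts start at 0, so each takes the smaller of the two values reached. This is what nonfolding
  will contradict.\<close>

lemma germs_merge:
  assumes \<gamma>: "fst \<gamma>1 \<in> E" "fst \<gamma>2 \<in> E" and eq: "(DF ^^ n) \<gamma>1 = (DF ^^ n) \<gamma>2" and \<delta>: "\<delta> > 0"
  obtains t1 t2 where "0 < t1" "t1 < \<delta>" "t1 \<le> 1" "0 < t2" "t2 < \<delta>" "t2 \<le> 1"
    "(f ^^ n) (ray \<gamma>1 t1) = (f ^^ n) (ray \<gamma>2 t2)"
proof -
  obtain \<epsilon>1 k1 where 1: "0 < \<epsilon>1" "\<epsilon>1 \<le> 1" "continuous_on {0..\<epsilon>1} k1" "strict_mono_on {0..\<epsilon>1} k1" "k1 0 = 0"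
    "\<And>t. t \<in> {0..\<epsilon>1} \<Longrightarrow> (f ^^ n) (ray \<gamma>1 t) = ray ((DF ^^ n) \<gamma>1) (k1 t)"
    using germ_push[OF \<gamma>(1), of n] by blast
  obtain \<epsilon>2 k2 where 2: "0 < \<epsilon>2" "\<epsilon>2 \<le> 1" "continuous_on {0..\<epsilon>2} k2" "strict_mono_on {0..\<epsilon>2} k2" "k2 0 = 0"
    "\<And>t. t \<in> {0..\<epsilon>2} \<Longrightarrow> (f ^^ n) (ray \<gamma>2 t) = ray ((DF ^^ n) \<gamma>2) (k2 t)"
    using germ_push[OF \<gamma>(2), of n] by blast
  define a where "a = min (\<delta>/2) \<epsilon>1"
  define b where "b = min (\<delta>/2) \<epsilon>2"
  have a: "0 < a" "a < \<delta>" "a \<le> \<epsilon>1" and b: "0 < b" "b < \<delta>" "b \<le> \<epsilon>2"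
    using 1(1) 2(1) \<delta> by (auto simp: a_def b_def)
  have "k1 0 < k1 a" "k2 0 < k2 b"
    using 1(4) 2(4) a b by (auto simp: strict_mono_on_def)
  then have s: "0 < min (k1 a) (k2 b)" using 1(5) 2(5) by auto
  have ca: "continuous_on {0..a} k1" "continuous_on {0..b} k2"
    using 1(3) 2(3) a b by (auto elim!: continuous_on_subset)
  obtain t1 where t1: "0 < t1" "t1 \<le> a" "k1 t1 = min (k1 a) (k2 b)"
    using IVT_strict_mono[OF ca(1), of "min (k1 a) (k2 b)"] a s 1(5) by auto
  obtain t2 where t2: "0 < t2" "t2 \<le> b" "k2 t2 = min (k1 a) (k2 b)"
    using IVT_strict_mono[OF ca(2), of "min (k1 a) (k2 b)"] b s 2(5) by auto
  show thesis
    by (rule that[of t1 t2]) (use t1 t2 a b 1 2 eq in auto)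
qed

text \<open>The two germs at \<open>f x\<close>, for an interior point \<open>x\<close> of an edge that is mapped to a vertex,
  into which the two directions at \<open>x\<close> are mapped.\<close>
lemma turn_distinct:
  assumes pc1: "piece \<gamma> t q1 \<gamma>1 \<kappa>1" and pc2: "piece (opp \<gamma>) (1 - t) q2 \<gamma>2 \<kappa>2" and t: "t \<in> {0<..<1}"
  shows "(DF ^^ n) \<gamma>1 \<noteq> (DF ^^ n) \<gamma>2"
proof
  assume eq: "(DF ^^ n) \<gamma>1 = (DF ^^ n) \<gamma>2"
  note D1 = pieceD[OF pc1] and D2 = pieceD[OF pc2]
  \<comment> \<open>If the germs merged after \<open>n\<close> steps, \<open>f ^^ Suc n\<close>
    would fold at the interior point; the extra step is the one that takes this point to the
    vertex.\<close>
  obtain \<delta> where d: "\<delta> > 0" "inj_on (\<lambda>u. (f ^^ Suc n) (ray \<gamma> u)) {t - \<delta><..<t + \<delta>}"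
    using locally_inj[OF D1(1) t, of "Suc n"] by auto
  define u1 where "u1 = min q1 (t + \<delta>/2)"
  define u2 where "u2 = min q2 (1 - t + \<delta>/2)"
  have u1: "t < u1" "u1 \<le> q1" "u1 < t + \<delta>" and u2: "1 - t < u2" "u2 \<le> q2" "u2 < 1 - t + \<delta>"
    using D1(4) D2(4) d by (auto simp: u1_def u2_def)
  have pos: "0 < min (\<kappa>1 u1) (\<kappa>2 u2)" using D1(14)[of t u1] D2(14)[of "1-t" u2] u1 u2 D1(11) D2(11) by auto
  obtain s1 s2 where s: "0 < s1" "s1 < min (\<kappa>1 u1) (\<kappa>2 u2)" "0 < s2" "s2 < min (\<kappa>1 u1) (\<kappa>2 u2)"
    "(f ^^ n) (ray \<gamma>1 s1) = (f ^^ n) (ray \<gamma>2 s2)"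
    using germs_merge[OF D1(2) D2(2) eq pos] by metis
  have c: "continuous_on {t..u1} \<kappa>1" "continuous_on {1-t..u2} \<kappa>2"
    using D1(9) D2(9) u1 u2 by (auto elim!: continuous_on_subset)
  obtain w1 where w1: "t < w1" "w1 \<le> u1" "\<kappa>1 w1 = s1"
    using IVT_strict_mono[OF c(1), of s1] u1 s D1(11) by auto
  obtain w2 where w2: "1 - t < w2" "w2 \<le> u2" "\<kappa>2 w2 = s2"
    using IVT_strict_mono[OF c(2), of s2] u2 s D2(11) by auto
  have "f (ray \<gamma> w1) = ray \<gamma>1 s1" using D1(13)[of w1] w1 u1 by auto
  moreover have "f (ray \<gamma> (1 - w2)) = ray \<gamma>2 s2" using D2(13)[of w2] w2 u2 by (auto simp: ray_opp)
  ultimately have "(f ^^ Suc n) (ray \<gamma> w1) = (f ^^ Suc n) (ray \<gamma> (1 - w2))"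
    using s(5) by (simp add: funpow_swap1)
  then have "w1 = 1 - w2" using inj_onD[OF d(2), of w1 "1 - w2"] w1 w2 u1 u2 by auto
  then show False using w1 w2 by auto
qed

end

section \<open>Points that reach a vertex, and invariant sets of edges\<close>

locale solenoid = graph_map X G \<phi> f
  for X :: "'a topology" and G :: "('a, 'e) pre_digraph"
    and \<phi> :: "'e \<Rightarrow> real \<Rightarrow> 'a" and f :: "'a \<Rightarrow> 'a" +
  assumes indecomposable: "indecomposable X f" and nonwandering: "nonwandering X f"
    and flattening: "flattening X f" and expansion: "expansion X G \<phi> f"
begin

text \<open>An interval that never meets a preimage of a vertex is mapped by every iterate
  monotonically into a single edge. Expansion would make its length grow exponentially, while the
  edges are compact and hence bounded.\<close>

lemma hits_vertex_aux:
  assumes e: "e \<in> E" and st: "0 \<le> s" "s < t" "t \<le> 1"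
  shows "\<exists>n. \<exists>u\<in>{s<..<t}. (f ^^ n) (\<phi> e u) \<in> V"
proof (rule ccontr)
  assume no: "\<not> ?thesis"
  have lift: "\<exists>\<gamma>' g. fst \<gamma>' \<in> E \<and> continuous_on {s..t} g \<and> strict_mono_on {s..t} g \<and>
      (\<forall>u\<in>{s..t}. g u \<in> {0..1} \<and> (f ^^ n) (\<phi> e u) = ray \<gamma>' (g u))" for n
  proof (induction n)
    case 0
    show ?case
      by (rule exI[of _ "(e, False)"], rule exI[of _ id])
        (use e st in \<open>auto simp: ray_def strict_mono_on_def\<close>)
  next
    case (Suc n)
    then obtain \<gamma>' g where *: "fst \<gamma>' \<in> E" "continuous_on {s..t} g" "strict_mono_on {s..t} g"
      and eq: "\<And>u. u \<in> {s..t} \<Longrightarrow> g u \<in> {0..1} \<and> (f ^^ n) (\<phi> e u) = ray \<gamma>' (g u)" by blast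
    have gm: "g u < g w" if "s \<le> u" "u < w" "w \<le> t" for u w
      using *(3) that by (auto simp: strict_mono_on_def)
    have "0 \<le> g s" "g s < 1" using gm[of s t] eq[of s] eq[of t] st by auto
    then obtain p q \<gamma>2 \<kappa> where pc: "piece \<gamma>' p q \<gamma>2 \<kappa>" "p \<le> g s" "g s < q"
      using next_point[OF *(1), of "g s"] by blast
    note D = pieceD[OF pc(1)]
    \<comment> \<open>The image could leave the piece only through \<open>q\<close>, which is mapped
      to a vertex.\<close>
    have le: "g t \<le> q"
    proof (rule ccontr)
      assume "\<not> g t \<le> q"
      then obtain u where u: "s < u" "u \<le> t" "g u = q"
        using IVT_strict_mono[OF *(2), of q] st pc by auto
      then have "u < t" using \<open>\<not> g t \<le> q\<close> by (cases "u = t") auto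
      have "(f ^^ Suc n) (\<phi> e u) = f (ray \<gamma>' q)" using eq[of u] u by auto
      then have "(f ^^ Suc n) (\<phi> e u) \<in> V" using D(7) by (auto simp: P_def)
      moreover have "u \<in> {s<..<t}" using u \<open>u < t\<close> by auto
      ultimately show False using no by blast
    qed
    have rng: "g u \<in> {p..q}" if "u \<in> {s..t}" for u
      using gm[of s u] gm[of u t] le pc that by (cases "u = s"; cases "u = t") auto
    have "continuous_on {s..t} (\<lambda>u. \<kappa> (g u))"
      by (rule continuous_on_compose2[OF D(9) *(2)]) (use rng in auto)
    moreover have "strict_mono_on {s..t} (\<lambda>u. \<kappa> (g u))"
      by (rule strict_mono_onI) (use D(14) gm rng in auto)
    moreover have "\<forall>u\<in>{s..t}. \<kappa> (g u) \<in> {0..1} \<and> (f ^^ Suc n) (\<phi> e u) = ray \<gamma>2 (\<kappa> (g u))"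
      using piece_range(1)[OF pc(1)] D(13) rng eq by auto
    ultimately show ?case using D(2) by blast
  qed
  obtain d \<delta> C \<mu> where
    ms: "\<And>e. e \<in> E \<Longrightarrow> Metric_space {0..1} (\<delta> e) \<and> Metric_space.mtopology {0..1} (\<delta> e) = top_of_set {0..1}"
    and C: "C > 0" and \<mu>: "\<mu> > 1"
    and ex: "\<And>n e e' s t g. n > 0 \<Longrightarrow> e\<in>E \<Longrightarrow> e'\<in>E \<Longrightarrow> s\<in>{0..1} \<Longrightarrow> t\<in>{s..1} \<Longrightarrow>
       continuous_map (top_of_set {s..t}) (top_of_set {0..1}) g \<and>
          (\<forall>u\<in>{s..t}. (f ^^ n) (\<phi> e u) = \<phi> e' (g u))
          \<Longrightarrow> \<delta> e' (g s) (g t) \<ge> C * \<mu> ^ n * \<delta> e s t"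
    using expansion unfolding expansion_def by metis
  have "\<exists>B. \<forall>x\<in>{0..1}. \<forall>y\<in>{0..1}. \<delta> e x y \<le> B" if e: "e \<in> E" for e
  proof -
    interpret M: Metric_space "{0..1}" "\<delta> e" using ms e by blast
    have "compactin M.mtopology {0..1}" using ms[OF e] by (simp add: compactin_subtopology)
    then have "M.mbounded {0..1}" by (rule M.compactin_imp_mbounded)
    then show ?thesis by (auto simp: M.mbounded_alt)
  qed
  then obtain B where B: "\<And>e x y. e \<in> E \<Longrightarrow> x \<in> {0..1} \<Longrightarrow> y \<in> {0..1} \<Longrightarrow> \<delta> e x y \<le> B e" by metis
  define b where "b = Max (B ` E)"
  have b: "\<delta> e x y \<le> b" if "e \<in> E" "x \<in> {0..1}" "y \<in> {0..1}" for e x y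
  proof -
    have "B e \<le> b" using that finite_E by (simp add: b_def)
    then show ?thesis using B[OF that] by simp
  qed
  have pos: "\<delta> e s t > 0"
  proof -
    interpret M: Metric_space "{0..1}" "\<delta> e" using ms e by blast
    show ?thesis using M.mdist_pos_less[of s t] st by auto
  qed
  have grow: "C * \<mu> ^ n * \<delta> e s t \<le> b" if n: "n > 0" for n
  proof -
    obtain \<gamma>' g where *: "fst \<gamma>' \<in> E" "continuous_on {s..t} g"
      "\<And>u. u \<in> {s..t} \<Longrightarrow> g u \<in> {0..1} \<and> (f ^^ n) (\<phi> e u) = ray \<gamma>' (g u)"
      using lift[of n] by blast
    \<comment> \<open>The expansion axiom parametrizes an edge from its tail, so the lift to a head
      germ is reversed.\<close>
    define h where "h = (\<lambda>u. if snd \<gamma>' then 1 - g u else g u)"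
    have "continuous_on {s..t} h" unfolding h_def using *(2) by (cases "snd \<gamma>'") (auto intro!: continuous_intros)
    moreover have h01: "h u \<in> {0..1}" if "u \<in> {s..t}" for u using *(3)[OF that] by (auto simp: h_def)
    ultimately have "continuous_map (top_of_set {s..t}) (top_of_set {0..1}) h" by auto
    moreover have "\<forall>u\<in>{s..t}. (f ^^ n) (\<phi> e u) = \<phi> (fst \<gamma>') (h u)"
      using *(3) by (auto simp: h_def ray_def)
    ultimately have "C * \<mu> ^ n * \<delta> e s t \<le> \<delta> (fst \<gamma>') (h s) (h t)"
      by (intro ex[OF n e *(1)]) (use st in auto)
    also have "\<dots> \<le> b" using b[OF *(1)] h01 st by auto
    finally show ?thesis .
  qed
  obtain n where n: "b / (C * \<delta> e s t) < \<mu> ^ n" using real_arch_pow[OF \<mu>] by blast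
  also have "\<dots> \<le> \<mu> ^ Suc n" using \<mu> by simp
  finally have "b < C * \<mu> ^ Suc n * \<delta> e s t" using pos C by (simp add: field_simps)
  then show False using grow[of "Suc n"] by simp
qed

lemma hits_vertex:
  assumes \<gamma>: "fst \<gamma> \<in> E" and st: "0 \<le> s" "s < t" "t \<le> 1"
  shows "\<exists>n. \<exists>u\<in>{s<..<t}. (f ^^ n) (ray \<gamma> u) \<in> V"
proof (cases "snd \<gamma>")
  case True
  obtain n u where "u \<in> {1 - t<..<1 - s}" "(f ^^ n) (\<phi> (fst \<gamma>) u) \<in> V"
    using hits_vertex_aux[OF \<gamma>, of "1 - t" "1 - s"] st by auto
  then show ?thesis using True by (intro exI[of _ n] bexI[of _ "1 - u"]) (auto simp: ray_def)
next
  case False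
  then show ?thesis using hits_vertex_aux[OF \<gamma> st] by (simp add: ray_def)
qed

text \<open>Combinatorial form of an \<open>f\<close>-invariant subgraph; it is the closedness
  condition that irreducibility of the transition matrix is about.\<close>

definition invariant_edges :: "'e set \<Rightarrow> bool"
  where "invariant_edges S \<longleftrightarrow> S \<subseteq> E \<and>
    (\<forall>\<gamma> p q \<gamma>' \<kappa>. piece \<gamma> p q \<gamma>' \<kappa> \<longrightarrow> fst \<gamma> \<in> S \<longrightarrow> fst \<gamma>' \<in> S)"

text \<open>Without subdivision, interiors of edges in \<open>S\<close> would be mapped into
  interiors of edges in \<open>S\<close> forever, and no interior point would reach a
  vertex.\<close>

lemma invariant_edges_subdivided:
  assumes S: "invariant_edges S" "S \<noteq> {}"
  shows "\<exists>\<gamma>. fst \<gamma> \<in> S \<and> \<not> P \<gamma> \<subseteq> {0, 1}"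
proof (rule ccontr)
  assume no: "\<not> ?thesis"
  obtain e where e: "e \<in> S" using S by blast
  have SE: "S \<subseteq> E" using S by (simp add: invariant_edges_def)
  define \<gamma> where "\<gamma> = (e, False)"
  obtain n u where u: "u \<in> {0<..<1}" "(f ^^ n) (ray \<gamma> u) \<in> V"
    using hits_vertex[of \<gamma> 0 1] subsetD[OF SE e] by (auto simp: \<gamma>_def)
  have "\<exists>\<gamma>' s. fst \<gamma>' \<in> S \<and> s \<in> {0<..<1} \<and> (f ^^ n) (ray \<gamma> u) = ray \<gamma>' s" for n
  proof (induction n)
    case 0
    show ?case by (rule exI[of _ \<gamma>], rule exI[of _ u]) (use u e in \<open>auto simp: \<gamma>_def\<close>)
  next
    case (Suc n)
    then obtain \<gamma>' s where *: "fst \<gamma>' \<in> S" "s \<in> {0<..<1}" "(f ^^ n) (ray \<gamma> u) = ray \<gamma>' s" by blast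
    have "fst \<gamma>' \<in> E" using * SE by blast
    then obtain p q \<gamma>2 \<kappa> where pc: "piece \<gamma>' p q \<gamma>2 \<kappa>" "p \<le> s" "s < q"
      using next_point[of \<gamma>' s] *(2) by auto
    have "P \<gamma>' \<subseteq> {0, 1}" using no *(1) by blast
    then have "p \<in> {0, 1}" using pieceD(6)[OF pc(1)] by blast
    then have "p < s" using pc(2) *(2) by auto
    moreover have "fst \<gamma>2 \<in> S" using S(1) pc(1) *(1) unfolding invariant_edges_def by blast
    ultimately show ?case
      using piece_range(2)[OF pc(1), of s] pc pieceD(13)[OF pc(1), of s] *
      by (intro exI[of _ \<gamma>2] exI[of _ "\<kappa> s"]) auto
  qed
  then obtain \<gamma>' s where "fst \<gamma>' \<in> S" "s \<in> {0<..<1}" "(f ^^ n) (ray \<gamma> u) = ray \<gamma>' s" by blast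
  then show False using u ray_V[of \<gamma>' s] SE by auto
qed

end

subsection \<open>Irreducibility and the sides of a vertex\<close>

text \<open>Both arcs start at \<open>c\<close> and must pass through the nearer of the two end
  values.\<close>

lemma two_arcs_on_one_side_meet:
  fixes y1 y2 :: "real \<Rightarrow> real"
  assumes 1: "0 \<le> a1" "continuous_on {0..a1} y1" "y1 0 = c"
    and 2: "0 \<le> a2" "continuous_on {0..a2} y2" "y2 0 = c"
    and side: "(c < y1 a1 \<and> c < y2 a2) \<or> (y1 a1 < c \<and> y2 a2 < c)"
  shows "\<exists>t1\<in>{0<..a1}. \<exists>t2\<in>{0<..a2}. y1 t1 = y2 t2"
  using side
proof
  assume s: "c < y1 a1 \<and> c < y2 a2"
  define m where "m = min (y1 a1) (y2 a2)"
  have m: "c < m" "m \<le> y1 a1" "m \<le> y2 a2" using s by (auto simp: m_def)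
  obtain t1 where "0 < t1" "t1 \<le> a1" "y1 t1 = m" using IVT_strict_mono[OF 1(2,1), of m] m 1 by auto
  moreover obtain t2 where "0 < t2" "t2 \<le> a2" "y2 t2 = m" using IVT_strict_mono[OF 2(2,1), of m] m 2 by auto
  ultimately show ?thesis by (intro bexI[of _ t1] bexI[of _ t2]) auto
next
  assume s: "y1 a1 < c \<and> y2 a2 < c"
  define m where "m = max (y1 a1) (y2 a2)"
  have m: "m < c" "y1 a1 \<le> m" "y2 a2 \<le> m" using s by (auto simp: m_def)
  have n: "continuous_on {0..a1} (\<lambda>t. - y1 t)" "continuous_on {0..a2} (\<lambda>t. - y2 t)"
    using 1 2 by (auto intro!: continuous_intros)
  obtain t1 where "0 < t1" "t1 \<le> a1" "- y1 t1 = - m" using IVT_strict_mono[OF n(1) 1(1), of "- m"] m 1 by auto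
  moreover obtain t2 where "0 < t2" "t2 \<le> a2" "- y2 t2 = - m" using IVT_strict_mono[OF n(2) 2(1), of "- m"] m 2 by auto
  ultimately show ?thesis by (intro bexI[of _ t1] bexI[of _ t2]) auto
qed

context solenoid
begin

declare split_paired_All [simp del] split_paired_Ex [simp del]

definition subgraph :: "'e set \<Rightarrow> 'a set"
  where "subgraph S = (\<Union>e\<in>S. \<phi> e ` {0..1})"

lemma ray_in_subgraph: "fst \<gamma> \<in> S \<Longrightarrow> t \<in> {0..1} \<Longrightarrow> ray \<gamma> t \<in> subgraph S"
  by (auto simp: subgraph_def ray_def intro!: bexI[of _ "fst \<gamma>"])

text \<open>The head of an edge is described as the start of the reversed ray, so
  \<open>t < 1\<close> can always be arranged, as \<open>next_point\<close> requires.\<close>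

lemma subgraph_cases:
  assumes "x \<in> subgraph S"
  obtains \<gamma> t where "fst \<gamma> \<in> S" "0 \<le> t" "t < 1" "x = ray \<gamma> t"
proof -
  obtain e t where e: "e \<in> S" "t \<in> {0..1}" "x = \<phi> e t" using assms by (auto simp: subgraph_def)
  show thesis
  proof (cases "t = 1")
    case True
    then show thesis using that[of "(e, True)" 0] e by (simp add: ray_def)
  next
    case False
    then show thesis using that[of "(e, False)" t] e by (simp add: ray_def)
  qed
qed

lemma closedin_subgraph: "S \<subseteq> E \<Longrightarrow> closedin X (subgraph S)"
  unfolding subgraph_def
  by (rule closedin_Union) (use finite_E finite_subset closedin_phi_image in \<open>auto simp: subset_iff\<close>)

lemma invariant_E: "invariant_edges E"
  by (auto simp: invariant_edges_def dest: pieceD(2))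

lemma invariant_subset: "invariant_edges S \<Longrightarrow> fst \<gamma> \<in> S \<Longrightarrow> fst \<gamma> \<in> E"
  by (auto simp: invariant_edges_def)

lemma invariant_piece: "invariant_edges S \<Longrightarrow> piece \<gamma> p q \<gamma>' \<kappa> \<Longrightarrow> fst \<gamma> \<in> S \<Longrightarrow> fst \<gamma>' \<in> S"
  unfolding invariant_edges_def by blast

lemma invariant_DF: "invariant_edges S \<Longrightarrow> fst \<gamma> \<in> S \<Longrightarrow> fst (DF \<gamma>) \<in> S"
  using DF_piece[of \<gamma>] invariant_piece invariant_subset by metis

lemma invariant_DF_pow: "invariant_edges S \<Longrightarrow> fst \<gamma> \<in> S \<Longrightarrow> fst ((DF ^^ n) \<gamma>) \<in> S"
  by (induction n) (auto intro: invariant_DF)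

lemma subgraph_invariant:
  assumes S: "invariant_edges S" and x: "x \<in> subgraph S"
  shows "f x \<in> subgraph S"
proof -
  obtain \<gamma> t where t: "fst \<gamma> \<in> S" "0 \<le> t" "t < 1" "x = ray \<gamma> t" using subgraph_cases[OF x] by metis
  obtain p q \<gamma>' \<kappa> where pc: "piece \<gamma> p q \<gamma>' \<kappa>" "p \<le> t" "t < q"
    using next_point[OF invariant_subset[OF S t(1)] t(2,3)] by blast
  have "f x = ray \<gamma>' (\<kappa> t)" using pieceD(13)[OF pc(1)] pc t by auto
  then show ?thesis
    using ray_in_subgraph[OF invariant_piece[OF S pc(1) t(1)]] piece_range(1)[OF pc(1)] pc by auto
qed

lemma subgraph_invariant_pow:
  "invariant_edges S \<Longrightarrow> x \<in> subgraph S \<Longrightarrow> (f ^^ n) x \<in> subgraph S"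
  by (induction n) (auto intro: subgraph_invariant)

text \<open>Points of an edge outside \<open>S\<close> that are mapped into the subgraph would be wandering.\<close>
lemma invariant_complement:
  assumes S: "invariant_edges S"
  shows "invariant_edges (E - S)"
  unfolding invariant_edges_def
proof (intro conjI allI impI)
  fix \<gamma> p q \<gamma>' \<kappa> assume pc: "piece \<gamma> p q \<gamma>' \<kappa>" and \<gamma>: "fst \<gamma> \<in> E - S"
  note D = pieceD[OF pc]
  show "fst \<gamma>' \<in> E - S"
  proof (rule ccontr)
    assume "fst \<gamma>' \<notin> E - S"
    then have \<gamma>'S: "fst \<gamma>' \<in> S" using D(2) by blast
    define U where "U = ray \<gamma> ` {p<..<q}"
    have "openin X U" unfolding U_def by (rule openin_ray_image) (use D in auto)
    moreover have "ray \<gamma> ((p + q)/2) \<in> U" using D(4) by (auto simp: U_def)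
    moreover have "ray \<gamma> ((p + q)/2) \<in> topspace X" using ray_in[OF D(1)] D(3,4,5) by auto
    ultimately obtain n where n: "n \<ge> 1" "(f ^^ n) ` U \<inter> U \<noteq> {}"
      using nonwandering unfolding nonwandering_def by blast
    then obtain z where "z \<in> (f ^^ n) ` ray \<gamma> ` {p<..<q}" "z \<in> ray \<gamma> ` {p<..<q}"
      unfolding U_def by blast
    then obtain u w where uw: "u \<in> {p<..<q}" "z = (f ^^ n) (ray \<gamma> u)" "w \<in> {p<..<q}" "z = ray \<gamma> w"
      by blast
    then have u: "u \<in> {p<..<q}" "w \<in> {p<..<q}" "(f ^^ n) (ray \<gamma> u) = ray \<gamma> w" by simp_all
    obtain m where m: "n = Suc m" using n by (cases n) auto
    have "f (ray \<gamma> u) = ray \<gamma>' (\<kappa> u)" using D(13) u by auto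
    then have "f (ray \<gamma> u) \<in> subgraph S"
      using ray_in_subgraph[OF \<gamma>'S, of "\<kappa> u"] piece_range(1)[OF pc, of u] u by auto
    then have "ray \<gamma> w \<in> subgraph S"
      using subgraph_invariant_pow[OF S, of "f (ray \<gamma> u)" m] u(3) m by (simp add: funpow_swap1)
    then obtain \<gamma>2 t where "fst \<gamma>2 \<in> S" "0 \<le> t" "t < 1" "ray \<gamma> w = ray \<gamma>2 t"
      by (rule subgraph_cases)
    then have "\<gamma>2 = \<gamma> \<or> \<gamma>2 = opp \<gamma>"
      using ray_eqD[OF D(1) invariant_subset[OF S], of \<gamma>2 w t] u D(3,5) by auto
    then show False using \<open>fst \<gamma>2 \<in> S\<close> \<gamma> by auto
  qed
qed auto

lemma invariant_subdivided:
  assumes S: "invariant_edges S" "S \<noteq> {}"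
  obtains \<gamma> t q \<gamma>' \<kappa> where "fst \<gamma> \<in> S" "0 < t" "t < 1" "piece \<gamma> t q \<gamma>' \<kappa>"
proof -
  obtain \<gamma> where \<gamma>: "fst \<gamma> \<in> S" "\<not> P \<gamma> \<subseteq> {0, 1}" using invariant_edges_subdivided[OF S] by blast
  then obtain t where t: "t \<in> P \<gamma>" "t \<noteq> 0" "t \<noteq> 1" by blast
  have "t \<in> {0..1}" using t P_ends(3) by blast
  then have t': "0 < t" "t < 1" using t by auto
  then show thesis using that first_piece[OF invariant_subset[OF S(1) \<gamma>(1)] t(1)] \<gamma> by blast
qed

text \<open>Call a vertex bad if some iterate of \<open>f\<close> folds all germs of \<open>S\<close> at it to a single germ.
  By nonfolding, \<open>f\<close> maps only bad vertices to bad vertices. So edges without a bad end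
  span an invariant subgraph, hence so do the edges with a bad end. As \<open>f\<close> maps no interior point of
  an edge to a bad vertex, it does not subdivide these edges, against expansion.\<close>
lemma two_germs:
  assumes S: "invariant_edges S" and \<gamma>0: "fst \<gamma>0 \<in> S"
  shows "\<exists>\<gamma>1 \<gamma>2. fst \<gamma>1 \<in> S \<and> fst \<gamma>2 \<in> S \<and> ray \<gamma>1 0 = ray \<gamma>0 0 \<and> ray \<gamma>2 0 = ray \<gamma>0 0 \<and>
    (DF ^^ n) \<gamma>1 \<noteq> (DF ^^ n) \<gamma>2"
proof -
  define bad where "bad = (\<lambda>v. \<exists>n. \<forall>\<gamma>1 \<gamma>2. fst \<gamma>1 \<in> S \<longrightarrow> fst \<gamma>2 \<in> S \<longrightarrow> ray \<gamma>1 0 = v \<longrightarrow> ray \<gamma>2 0 = v \<longrightarrow>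
    (DF ^^ n) \<gamma>1 = (DF ^^ n) \<gamma>2)"
  have bad_step: "bad (ray \<gamma> 0)" if \<gamma>: "fst \<gamma> \<in> S" and b: "bad (f (ray \<gamma> 0))" for \<gamma>
  proof -
    obtain n where n: "\<And>\<gamma>1 \<gamma>2. fst \<gamma>1 \<in> S \<Longrightarrow> fst \<gamma>2 \<in> S \<Longrightarrow> ray \<gamma>1 0 = f (ray \<gamma> 0) \<Longrightarrow>
        ray \<gamma>2 0 = f (ray \<gamma> 0) \<Longrightarrow> (DF ^^ n) \<gamma>1 = (DF ^^ n) \<gamma>2"
      using b unfolding bad_def by blast
    have "(DF ^^ Suc n) \<gamma>1 = (DF ^^ Suc n) \<gamma>2"
      if "fst \<gamma>1 \<in> S" "fst \<gamma>2 \<in> S" "ray \<gamma>1 0 = ray \<gamma> 0" "ray \<gamma>2 0 = ray \<gamma> 0" for \<gamma>1 \<gamma>2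
      unfolding funpow_Suc_right o_apply
      using that invariant_DF[OF S] DF_base[OF invariant_subset[OF S]] by (intro n) auto
    then show ?thesis unfolding bad_def by blast
  qed
  \<comment> \<open>For \<open>0 < t < 1\<close> the two directions at the point are mapped to germs
    at a bad vertex, which some iterate would identify, against
    \<open>turn_distinct\<close>.\<close>
  have bad_pre: "t = 0 \<and> bad (ray \<gamma> 0)"
    if \<gamma>: "fst \<gamma> \<in> S" and t: "t \<in> P \<gamma>" "t < 1" and b: "bad (f (ray \<gamma> t))" for \<gamma> t
  proof -
    have \<gamma>E: "fst \<gamma> \<in> E" using invariant_subset[OF S \<gamma>] .
    have "t = 0"
    proof (rule ccontr)
      assume "t \<noteq> 0"
      moreover have "t \<in> {0..1}" using t P_ends(3) by blast
      ultimately have t01: "t \<in> {0<..<1}" using t by auto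
      obtain q1 \<gamma>1 \<kappa>1 where p1: "piece \<gamma> t q1 \<gamma>1 \<kappa>1" using first_piece[OF \<gamma>E t] by blast
      obtain q2 \<gamma>2 \<kappa>2 where p2: "piece (opp \<gamma>) (1 - t) q2 \<gamma>2 \<kappa>2"
        using first_piece[of "opp \<gamma>" "1 - t"] \<gamma>E t t01 by (auto simp: P_opp)
      have "ray \<gamma>1 0 = f (ray \<gamma> t)" using pieceD(13)[OF p1, of t] pieceD(4,11)[OF p1] by auto
      moreover have "ray \<gamma>2 0 = f (ray \<gamma> t)"
        using pieceD(13)[OF p2, of "1 - t"] pieceD(4,11)[OF p2] by (auto simp: ray_opp)
      ultimately obtain n where "(DF ^^ n) \<gamma>1 = (DF ^^ n) \<gamma>2"
        using b invariant_piece[OF S p1 \<gamma>] invariant_piece[OF S p2] \<gamma> unfolding bad_def by auto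
      then show False using turn_distinct[OF p1 p2 t01] by blast
    qed
    then show ?thesis using bad_step[OF \<gamma>] b by simp
  qed
  have start: "p = 0 \<and> bad (ray \<gamma> 0)" if "piece \<gamma> p q \<gamma>' \<kappa>" "fst \<gamma> \<in> S" "bad (ray \<gamma>' 0)" for \<gamma> p q \<gamma>' \<kappa>
  proof -
    note D = pieceD[OF that(1)]
    have "ray \<gamma>' 0 = f (ray \<gamma> p)" using D(13)[of p] D(4,11) by auto
    then show ?thesis using bad_pre[OF that(2) D(6)] D(4,5) that(3) by auto
  qed
  have stop: "q = 1 \<and> bad (ray (opp \<gamma>) 0)"
    if "piece \<gamma> p q \<gamma>' \<kappa>" "fst \<gamma> \<in> S" "bad (ray (opp \<gamma>') 0)" for \<gamma> p q \<gamma>' \<kappa>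
    using start[OF piece_opp[OF that(1)]] that by auto
  define SB where "SB = {e\<in>S. bad (ray (e, False) 0) \<or> bad (ray (e, True) 0)}"
  have SB_iff: "fst \<gamma> \<in> SB \<longleftrightarrow> fst \<gamma> \<in> S \<and> (bad (ray \<gamma> 0) \<or> bad (ray (opp \<gamma>) 0))" for \<gamma>
    by (cases "\<gamma>"; cases "snd \<gamma>") (auto simp: SB_def opp_def)
  have "invariant_edges (S - SB)"
    unfolding invariant_edges_def
  proof (intro conjI allI impI)
    show "S - SB \<subseteq> E" using S by (auto simp: invariant_edges_def)
    fix \<gamma> p q \<gamma>' \<kappa> assume pc: "piece \<gamma> p q \<gamma>' \<kappa>" "fst \<gamma> \<in> S - SB"
    then show "fst \<gamma>' \<in> S - SB"
      using start[OF pc(1)] stop[OF pc(1)] invariant_piece[OF S pc(1)] SB_iff[of \<gamma>] SB_iff[of \<gamma>'] by blast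
  qed
  \<comment> \<open>Intersected with \<open>S\<close>, this complement is \<open>SB\<close>;
    nonwandering, through \<open>invariant_complement\<close>, turns the invariance around.\<close>
  then have "invariant_edges (E - (S - SB))" by (rule invariant_complement)
  then have SB_inv: "invariant_edges SB"
    using S unfolding invariant_edges_def SB_def by blast
  \<comment> \<open>Edges with exactly one bad end. The image of each piece has a bad end, which by
    \<open>start\<close> and \<open>stop\<close> must come from the bad end of the edge itself. So
    every piece reaches that end, the edge is not subdivided, and its image again has just one bad
    end.\<close>
  define S1 where "S1 = {e\<in>S. bad (ray (e, False) 0) \<noteq> bad (ray (e, True) 0)}"
  have S1_iff: "fst \<gamma> \<in> S1 \<longleftrightarrow> fst \<gamma> \<in> S \<and> bad (ray \<gamma> 0) \<noteq> bad (ray (opp \<gamma>) 0)" for \<gamma>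
    by (cases "\<gamma>"; cases "snd \<gamma>") (auto simp: S1_def opp_def)
  have S1_step: "fst \<gamma>' \<in> S1 \<and> (bad (ray \<gamma> 0) \<longrightarrow> p = 0) \<and> (\<not> bad (ray \<gamma> 0) \<longrightarrow> q = 1)"
    if pc: "piece \<gamma> p q \<gamma>' \<kappa>" "fst \<gamma> \<in> S1" for \<gamma> p q \<gamma>' \<kappa>
  proof -
    have "fst \<gamma> \<in> SB" "fst \<gamma> \<in> S" using pc(2) SB_iff S1_iff by blast+
    then have "fst \<gamma>' \<in> SB" using invariant_piece[OF SB_inv pc(1)] by blast
    then show ?thesis
      using start[OF pc(1)] stop[OF pc(1)] \<open>fst \<gamma> \<in> S\<close> pc(2) SB_iff[of \<gamma>'] S1_iff[of \<gamma>] S1_iff[of \<gamma>'] by blast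
  qed
  have S1_inv: "invariant_edges S1"
    using S1_step S unfolding invariant_edges_def S1_def by blast
  have S1: "S1 = {}"
  proof (rule ccontr)
    assume "S1 \<noteq> {}"
    then obtain \<gamma> t q \<gamma>' \<kappa> where pc: "fst \<gamma> \<in> S1" "0 < t" "t < 1" "piece \<gamma> t q \<gamma>' \<kappa>"
      using invariant_subdivided[OF S1_inv] by metis
    have "fst (opp \<gamma>) \<in> E" "1 - t \<in> P (opp \<gamma>)"
      using invariant_subset[OF S1_inv pc(1)] pieceD(6)[OF pc(4)] by (auto simp: P_opp)
    then obtain q2 \<gamma>2 \<kappa>2 where p2: "piece (opp \<gamma>) (1 - t) q2 \<gamma>2 \<kappa>2"
      using first_piece[of "opp \<gamma>" "1 - t"] pc by auto
    show False
      using S1_step[OF pc(4,1)] S1_step[OF p2] pc S1_iff[of \<gamma>] by auto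
  qed
  have "SB = {}"
  proof (rule ccontr)
    assume "SB \<noteq> {}"
    then obtain \<gamma> t q \<gamma>' \<kappa> where pc: "fst \<gamma> \<in> SB" "0 < t" "t < 1" "piece \<gamma> t q \<gamma>' \<kappa>"
      using invariant_subdivided[OF SB_inv] by metis
    have "fst \<gamma>' \<in> SB" by (rule invariant_piece[OF SB_inv pc(4,1)])
    \<comment> \<open>With \<open>S1\<close> empty both ends of the image are bad, so even a piece
      starting at an interior point would start at a bad vertex.\<close>
    then have "bad (ray \<gamma>' 0)" using S1 S1_iff[of \<gamma>'] SB_iff[of \<gamma>'] by blast
    then show False using start[OF pc(4)] pc SB_iff by auto
  qed
  then have "\<not> bad (ray \<gamma>0 0)" using SB_iff \<gamma>0 by blast
  then show ?thesis unfolding bad_def by blast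
qed

text \<open>An isolated vertex mapped into the union of the edges would be wandering, since its
  singleton is open. So the isolated vertices form a closed invariant set, which indecomposability
  makes empty.\<close>

lemma vertex_in_subgraph_E:
  assumes E: "E \<noteq> {}" and v: "v \<in> V"
  shows "v \<in> subgraph E"
proof -
  define I where "I = V - subgraph E"
  have fI: "f x \<in> I" if x: "x \<in> I" for x
  proof (rule ccontr)
    assume "f x \<notin> I"
    then have fx: "f x \<in> subgraph E" using vertices x by (auto simp: I_def)
    have "ray \<gamma> t \<noteq> x" if "fst \<gamma> \<in> E" "t \<in> {0..1}" for \<gamma> t
      using x ray_in_subgraph[OF that] by (auto simp: I_def)
    then have "{t\<in>{0..1}. ray \<gamma> t \<in> {x}} = {}" if "fst \<gamma> \<in> E" for \<gamma> using that by blast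
    then have "openin (top_of_set {0..1}) {t\<in>{0..1}. ray \<gamma> t \<in> {x}}" if "fst \<gamma> \<in> E" for \<gamma>
      using that by (simp only: openin_empty)
    moreover have "{x} \<subseteq> topspace X" using x V_subset by (auto simp: I_def)
    ultimately have "openin X {x}" unfolding openin_iff by blast
    moreover have "x \<in> topspace X" using x V_subset by (auto simp: I_def)
    ultimately obtain n where n: "n \<ge> 1" "(f ^^ n) ` {x} \<inter> {x} \<noteq> {}"
      using nonwandering unfolding nonwandering_def by blast
    obtain m where m: "n = Suc m" using n by (cases n) auto
    have "(f ^^ m) (f x) = x" using n m by (simp add: funpow_swap1)
    then show False using subgraph_invariant_pow[OF invariant_E fx, of m] x by (simp add: I_def)
  qed
  have "closedin X I" by (rule closedin_V) (auto simp: I_def)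
  moreover have "closedin X (subgraph E)" by (rule closedin_subgraph) simp
  moreover have "subgraph E \<noteq> {}" using E by (auto simp: subgraph_def)
  moreover have "I \<union> subgraph E = topspace X"
    using topspace_eq by (auto simp: I_def subgraph_def)
  moreover have "f ` subgraph E \<subseteq> subgraph E" using subgraph_invariant[OF invariant_E] by blast
  ultimately have "I = {}"
    using indecomposable fI unfolding indecomposable_def by (metis I_def Diff_disjoint Int_commute image_subsetI)
  then show ?thesis using v by (auto simp: I_def)
qed

text \<open>Germs with different images under \<open>f ^^ k\<close> give arcs in the flattened
  interval that start at a common point and never meet again, so they lie on opposite sides of it.
  Three of them cannot be pairwise opposite.\<close>

lemma three_germs:
  "\<exists>k. \<forall>\<gamma>1 \<gamma>2 \<gamma>3. fst \<gamma>1 \<in> E \<longrightarrow> fst \<gamma>2 \<in> E \<longrightarrow> fst \<gamma>3 \<in> E \<longrightarrow> ray \<gamma>2 0 = ray \<gamma>1 0 \<longrightarrow> ray \<gamma>3 0 = ray \<gamma>1 0 \<longrightarrow>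
    (DF ^^ k) \<gamma>1 = (DF ^^ k) \<gamma>2 \<or> (DF ^^ k) \<gamma>1 = (DF ^^ k) \<gamma>3 \<or> (DF ^^ k) \<gamma>2 = (DF ^^ k) \<gamma>3"
proof -
  obtain k where flat: "\<And>x. x \<in> topspace X \<Longrightarrow> \<exists>U \<epsilon>. openin X U \<and> x \<in> U \<and> \<epsilon> > 0 \<and>
       subtopology X ((f ^^ k) ` U) homeomorphic_space top_of_set {- \<epsilon> <..< \<epsilon> :: real}"
    using flattening unfolding flattening_def by auto
  have False if \<gamma>: "fst \<gamma>1 \<in> E" "fst \<gamma>2 \<in> E" "fst \<gamma>3 \<in> E" and base: "ray \<gamma>2 0 = ray \<gamma>1 0" "ray \<gamma>3 0 = ray \<gamma>1 0"
    and ne: "(DF ^^ k) \<gamma>1 \<noteq> (DF ^^ k) \<gamma>2" "(DF ^^ k) \<gamma>1 \<noteq> (DF ^^ k) \<gamma>3" "(DF ^^ k) \<gamma>2 \<noteq> (DF ^^ k) \<gamma>3" for \<gamma>1 \<gamma>2 \<gamma>3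
  proof -
    define v where "v = ray \<gamma>1 0"
    have vX: "v \<in> topspace X" using ray_in[OF \<gamma>(1)] by (simp add: v_def)
    obtain U \<epsilon> where U: "openin X U" "v \<in> U"
      and hom: "subtopology X ((f ^^ k) ` U) homeomorphic_space top_of_set {- \<epsilon> <..< \<epsilon> :: real}"
      using flat[OF vX] by blast
    obtain \<theta> where \<theta>: "homeomorphic_map (subtopology X ((f ^^ k) ` U)) (top_of_set {- \<epsilon> <..< \<epsilon> :: real}) \<theta>"
      using hom unfolding homeomorphic_space by blast
    have "(f ^^ k) ` U \<subseteq> topspace X"
      using continuous_map_image_subset_topspace[OF funpow_continuous[of k]] openin_subset[OF U(1)] by blast
    then have \<theta>_inj: "inj_on \<theta> ((f ^^ k) ` U)"
      using homeomorphic_imp_injective_map[OF \<theta>] by (simp add: Int_absorb1)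
    have \<theta>_cont: "continuous_map (subtopology X ((f ^^ k) ` U)) euclideanreal \<theta>"
      using homeomorphic_imp_continuous_map[OF \<theta>] by (simp add: continuous_map_in_subtopology)
    define c where "c = \<theta> ((f ^^ k) v)"
    define y where "y = (\<lambda>\<gamma> t. \<theta> ((f ^^ k) (ray \<gamma> t)))"
    \<comment> \<open>The bound 1/2 keeps each image in the half edge next to its germ, so that even
      the two ends of a single edge have disjoint images.\<close>
    have path: "\<exists>a>0. a \<le> 1 \<and> continuous_on {0..a} (y \<gamma>) \<and>
        (\<forall>t\<in>{0<..a}. ray \<gamma> t \<in> U \<and> (\<exists>s\<in>{0<..<1/2}. (f ^^ k) (ray \<gamma> t) = ray ((DF ^^ k) \<gamma>) s))"
      if \<gamma>: "fst \<gamma> \<in> E" and b: "ray \<gamma> 0 = v" for \<gamma>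
    proof -
      obtain \<epsilon>1 \<kappa> where k: "0 < \<epsilon>1" "\<epsilon>1 \<le> 1" "continuous_on {0..\<epsilon>1} \<kappa>" "strict_mono_on {0..\<epsilon>1} \<kappa>" "\<kappa> 0 = 0"
        and keq: "\<And>t. t \<in> {0..\<epsilon>1} \<Longrightarrow> \<kappa> t \<in> {0..1} \<and> (f ^^ k) (ray \<gamma> t) = ray ((DF ^^ k) \<gamma>) (\<kappa> t)"
        using germ_push[OF \<gamma>, of k] by blast
      have "openin (top_of_set {0..1}) {t\<in>{0..1}. ray \<gamma> t \<in> U}" using openin_iff \<gamma> U(1) by blast
      moreover have "0 \<in> {t\<in>{0..1}. ray \<gamma> t \<in> U}" using U(2) b by simp
      ultimately have "\<exists>\<delta>>0. \<forall>u\<in>{0..1}. dist u 0 < \<delta> \<longrightarrow> u \<in> {t\<in>{0..1}. ray \<gamma> t \<in> U}"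
        unfolding openin_euclidean_subtopology_iff by blast
      then obtain \<delta> where d0: "\<delta> > 0" "\<And>u. u \<in> {0..1} \<Longrightarrow> dist u 0 < \<delta> \<Longrightarrow> u \<in> {t\<in>{0..1}. ray \<gamma> t \<in> U}"
        by blast
      have d: "\<delta> > 0" "\<And>u. u \<in> {0..1} \<Longrightarrow> u < \<delta> \<Longrightarrow> ray \<gamma> u \<in> U"
        using d0(1) d0(2) by (auto simp: dist_real_def)
      define a0 where "a0 = min (\<delta>/2) \<epsilon>1"
      have a0: "0 < a0" "a0 < \<delta>" "a0 \<le> \<epsilon>1" using d k by (auto simp: a0_def)
      have km: "\<kappa> s < \<kappa> t" if "0 \<le> s" "s < t" "t \<le> \<epsilon>1" for s t using k(4) that by (auto simp: strict_mono_on_def)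
      obtain a where a: "0 < a" "a \<le> a0" "\<kappa> a < 1/2"
      proof (cases "\<kappa> a0 < 1/2")
        case True then show thesis using that[of a0] a0 by auto
      next
        case False
        have "continuous_on {0..a0} \<kappa>" using k(3) a0 by (auto elim!: continuous_on_subset)
        then obtain u where "0 < u" "u \<le> a0" "\<kappa> u = 1/4"
          using IVT_strict_mono[of 0 a0 \<kappa> "1/4"] k(5) a0 False by auto
        then show thesis using that[of u] by auto
      qed
      have inU: "ray \<gamma> t \<in> U" if "t \<in> {0..a}" for t using d(2)[of t] that a a0 k(2) by auto
      have "continuous_map (top_of_set {0..a}) (subtopology X ((f ^^ k) ` U)) (\<lambda>t. (f ^^ k) (ray \<gamma> t))"
        unfolding continuous_map_in_subtopology
      proof
        show "continuous_map (top_of_set {0..a}) X (\<lambda>t. (f ^^ k) (ray \<gamma> t))"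
          by (rule continuous_map_from_subtopology_mono[OF iterate_ray_continuous[OF \<gamma>]]) (use a a0 k(2) in auto)
      qed (use inU in auto)
      from continuous_map_compose[OF this \<theta>_cont]
      have "continuous_on {0..a} (y \<gamma>)" by (simp add: y_def o_def)
      moreover have "\<exists>s\<in>{0<..<1/2}. (f ^^ k) (ray \<gamma> t) = ray ((DF ^^ k) \<gamma>) s" if t: "t \<in> {0<..a}" for t
      proof (rule bexI[of _ "\<kappa> t"])
        show "(f ^^ k) (ray \<gamma> t) = ray ((DF ^^ k) \<gamma>) (\<kappa> t)" using keq t a a0 by auto
        have "\<kappa> 0 < \<kappa> t" using km[of 0 t] t a a0 by auto
        moreover have "\<kappa> t \<le> \<kappa> a" using km[of t a] t a a0 by (cases "t = a") auto
        ultimately show "\<kappa> t \<in> {0<..<1/2}" using k(5) a by auto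
      qed
      ultimately show ?thesis using a a0 k(2) inU by (intro exI[of _ a]) auto
    qed
    have disj: False
      if 1: "fst \<gamma>1 \<in> E" "ray \<gamma>1 t1 \<in> U" "s1 \<in> {0<..<1/2}" "(f ^^ k) (ray \<gamma>1 t1) = ray ((DF ^^ k) \<gamma>1) s1"
        and 2: "fst \<gamma>2 \<in> E" "ray \<gamma>2 t2 \<in> U" "s2 \<in> {0<..<1/2}" "(f ^^ k) (ray \<gamma>2 t2) = ray ((DF ^^ k) \<gamma>2) s2"
        and ne: "(DF ^^ k) \<gamma>1 \<noteq> (DF ^^ k) \<gamma>2" and eq: "y \<gamma>1 t1 = y \<gamma>2 t2" for \<gamma>1 \<gamma>2 t1 t2 s1 s2
    proof -
      have "(f ^^ k) (ray \<gamma>1 t1) = (f ^^ k) (ray \<gamma>2 t2)"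
        using \<theta>_inj eq 1(2) 2(2) unfolding y_def by (auto dest: inj_onD)
      then have "ray ((DF ^^ k) \<gamma>1) s1 = ray ((DF ^^ k) \<gamma>2) s2" using 1 2 by simp
      then show False
        using ray_eqD[OF DF_pow_in[OF 1(1), of k] DF_pow_in[OF 2(1), of k], of s1 s2] 1(3) 2(3) ne by auto
    qed
    have notc: False if "fst \<gamma> \<in> E" "ray \<gamma> t \<in> U" "s \<in> {0<..<1/2}" "(f ^^ k) (ray \<gamma> t) = ray ((DF ^^ k) \<gamma>) s" "y \<gamma> t = c" for \<gamma> t s
    proof -
      have "(f ^^ k) (ray \<gamma> t) = (f ^^ k) v"
        by (rule inj_onD[OF \<theta>_inj]) (use that(2,5) U(2) in \<open>auto simp: y_def c_def\<close>)
      moreover have "(f ^^ k) v = ray ((DF ^^ k) \<gamma>1) 0" using DF_pow_base[OF \<gamma>(1)] by (simp add: v_def)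
      ultimately show False
        using that(3,4) ray_V[OF DF_pow_in[OF that(1), of k], of s] ray_V[OF DF_pow_in[OF \<gamma>(1), of k], of 0] by auto
    qed
    have y0: "y \<gamma> 0 = c" if "ray \<gamma> 0 = v" for \<gamma> using that by (simp add: y_def c_def)
    have pair: "(c < y \<gamma> a \<longrightarrow> y \<gamma>' a' < c) \<and> (y \<gamma> a < c \<longrightarrow> c < y \<gamma>' a')"
      if g: "fst \<gamma> \<in> E" "ray \<gamma> 0 = v" "fst \<gamma>' \<in> E" "ray \<gamma>' 0 = v" "(DF ^^ k) \<gamma> \<noteq> (DF ^^ k) \<gamma>'"
        and a: "a > 0" "continuous_on {0..a} (y \<gamma>)"
          "\<forall>t\<in>{0<..a}. ray \<gamma> t \<in> U \<and> (\<exists>s\<in>{0<..<1/2}. (f ^^ k) (ray \<gamma> t) = ray ((DF ^^ k) \<gamma>) s)"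
        and a': "a' > 0" "continuous_on {0..a'} (y \<gamma>')"
          "\<forall>t\<in>{0<..a'}. ray \<gamma>' t \<in> U \<and> (\<exists>s\<in>{0<..<1/2}. (f ^^ k) (ray \<gamma>' t) = ray ((DF ^^ k) \<gamma>') s)"
      for \<gamma> \<gamma>' a a'
    proof -
      have "\<not> ((c < y \<gamma> a \<and> c < y \<gamma>' a') \<or> (y \<gamma> a < c \<and> y \<gamma>' a' < c))"
      proof
        assume "(c < y \<gamma> a \<and> c < y \<gamma>' a') \<or> (y \<gamma> a < c \<and> y \<gamma>' a' < c)"
        then obtain t t' where t: "t \<in> {0<..a}" "t' \<in> {0<..a'}" "y \<gamma> t = y \<gamma>' t'"
          using two_arcs_on_one_side_meet[of a "y \<gamma>" c a' "y \<gamma>'"] a(1,2) a'(1,2) y0 g by auto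
        then show False using disj[OF g(1) _ _ _ g(3) _ _ _ g(5)] a(3) a'(3) by metis
      qed
      moreover have "y \<gamma>' a' \<noteq> c" using notc[OF g(3)] a'(1,3) by fastforce
      ultimately show ?thesis by linarith
    qed
    obtain a1 where a1: "a1>0" "continuous_on {0..a1} (y \<gamma>1)"
        "\<forall>t\<in>{0<..a1}. ray \<gamma>1 t \<in> U \<and> (\<exists>s\<in>{0<..<1/2}. (f ^^ k) (ray \<gamma>1 t) = ray ((DF ^^ k) \<gamma>1) s)"
      using path[OF \<gamma>(1)] by (auto simp: v_def)
    obtain a2 where a2: "a2>0" "continuous_on {0..a2} (y \<gamma>2)"
        "\<forall>t\<in>{0<..a2}. ray \<gamma>2 t \<in> U \<and> (\<exists>s\<in>{0<..<1/2}. (f ^^ k) (ray \<gamma>2 t) = ray ((DF ^^ k) \<gamma>2) s)"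
      using path[OF \<gamma>(2)] base by (auto simp: v_def)
    obtain a3 where a3: "a3>0" "continuous_on {0..a3} (y \<gamma>3)"
        "\<forall>t\<in>{0<..a3}. ray \<gamma>3 t \<in> U \<and> (\<exists>s\<in>{0<..<1/2}. (f ^^ k) (ray \<gamma>3 t) = ray ((DF ^^ k) \<gamma>3) s)"
      using path[OF \<gamma>(3)] base by (auto simp: v_def)
    have v: "ray \<gamma>1 0 = v" "ray \<gamma>2 0 = v" "ray \<gamma>3 0 = v" using base by (auto simp: v_def)
    have "y \<gamma>1 a1 \<noteq> c" using notc[OF \<gamma>(1)] a1(1,3) by fastforce
    then show False
      using pair[OF \<gamma>(1) v(1) \<gamma>(2) v(2) ne(1) a1 a2] pair[OF \<gamma>(1) v(1) \<gamma>(3) v(3) ne(2) a1 a3]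
        pair[OF \<gamma>(2) v(2) \<gamma>(3) v(3) ne(3) a2 a3] by linarith
  qed
  then show ?thesis by metis
qed

text \<open>Otherwise the invariant subgraphs spanned by \<open>S\<close> and by its complement meet in a vertex. There
  each of them has two germs that no iterate of \<open>f\<close> identifies, against flattening.\<close>
lemma invariant_edges_trivial:
  assumes S: "invariant_edges S" and ne: "S \<noteq> {}"
  shows "S = E"
proof (rule ccontr)
  assume "S \<noteq> E"
  have SE: "S \<subseteq> E" using S by (simp add: invariant_edges_def)
  have S': "invariant_edges (E - S)" and ne': "E - S \<noteq> {}"
    using invariant_complement[OF S] SE \<open>S \<noteq> E\<close> by auto
  have "subgraph S \<union> subgraph (E - S) = topspace X"
    using vertex_in_subgraph_E ne SE topspace_eq by (fastforce simp: subgraph_def)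
  moreover have "closedin X (subgraph S)" "closedin X (subgraph (E - S))"
    using closedin_subgraph SE by auto
  moreover have "subgraph S \<noteq> {}" "subgraph (E - S) \<noteq> {}"
    using ne ne' by (auto simp: subgraph_def)
  moreover have "f ` subgraph S \<subseteq> subgraph S" "f ` subgraph (E - S) \<subseteq> subgraph (E - S)"
    using subgraph_invariant[OF S] subgraph_invariant[OF S'] by blast+
  ultimately have "subgraph S \<inter> subgraph (E - S) \<noteq> {}"
    using indecomposable unfolding indecomposable_def by metis
  then obtain x where x: "x \<in> subgraph S" "x \<in> subgraph (E - S)" by blast
  obtain \<gamma> t where t: "fst \<gamma> \<in> S" "0 \<le> t" "t < 1" "x = ray \<gamma> t" using subgraph_cases[OF x(1)] by metis
  obtain \<gamma>' t' where t': "fst \<gamma>' \<in> E - S" "0 \<le> t'" "t' < 1" "x = ray \<gamma>' t'" using subgraph_cases[OF x(2)] by metis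
  \<comment> \<open>Different edges share no interior point, so \<open>x\<close> is a vertex and
    both parameters vanish.\<close>
  have no: "\<gamma>' \<noteq> \<gamma>" "\<gamma>' \<noteq> opp \<gamma>" using t t' by auto
  have \<gamma>E: "fst \<gamma> \<in> E" "fst \<gamma>' \<in> E" using t t' SE by auto
  have "t = 0" using ray_eqD[OF \<gamma>E, of t t'] t t' no by (cases "t = 0") auto
  then have "x \<in> V" using ray_V[OF \<gamma>E(1), of 0] t by auto
  then have "t' = 0" using ray_V[OF \<gamma>E(2), of t'] t' by auto
  obtain k where k: "\<And>\<gamma>1 \<gamma>2 \<gamma>3. fst \<gamma>1 \<in> E \<Longrightarrow> fst \<gamma>2 \<in> E \<Longrightarrow> fst \<gamma>3 \<in> E \<Longrightarrow> ray \<gamma>2 0 = ray \<gamma>1 0 \<Longrightarrow>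
      ray \<gamma>3 0 = ray \<gamma>1 0 \<Longrightarrow>
    (DF ^^ k) \<gamma>1 = (DF ^^ k) \<gamma>2 \<or> (DF ^^ k) \<gamma>1 = (DF ^^ k) \<gamma>3 \<or> (DF ^^ k) \<gamma>2 = (DF ^^ k) \<gamma>3"
    using three_germs by blast
  obtain \<gamma>1 \<gamma>2 where g: "fst \<gamma>1 \<in> S" "fst \<gamma>2 \<in> S" "ray \<gamma>1 0 = x" "ray \<gamma>2 0 = x" "(DF ^^ k) \<gamma>1 \<noteq> (DF ^^ k) \<gamma>2"
    using two_germs[OF S t(1), of k] t \<open>t = 0\<close> by auto
  have "fst ((DF ^^ k) \<gamma>1) \<in> S" "fst ((DF ^^ k) \<gamma>2) \<in> S" "fst ((DF ^^ k) \<gamma>') \<in> E - S"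
    using invariant_DF_pow[OF S] invariant_DF_pow[OF S' t'(1)] g by auto
  then have "(DF ^^ k) \<gamma>1 \<noteq> (DF ^^ k) \<gamma>'" "(DF ^^ k) \<gamma>2 \<noteq> (DF ^^ k) \<gamma>'" by auto
  moreover have "(DF ^^ k) \<gamma>1 = (DF ^^ k) \<gamma>2 \<or> (DF ^^ k) \<gamma>1 = (DF ^^ k) \<gamma>' \<or> (DF ^^ k) \<gamma>2 = (DF ^^ k) \<gamma>'"
    by (rule k) (use g \<gamma>E SE t' \<open>t' = 0\<close> in auto)
  ultimately show False using g(5) by blast
qed

text \<open>\<open>sg\<close> distinguishes the two sides of the vertices: smooth arcs pass from one side to the other.\<close>
lemma sides:
  shows "\<exists>sg :: 'e \<times> bool \<Rightarrow> real.
    (\<forall>\<gamma>. sg \<gamma> = 1 \<or> sg \<gamma> = - 1) \<and>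
    (\<forall>\<gamma>. fst \<gamma> \<in> E \<longrightarrow> (\<exists>\<gamma>'. fst \<gamma>' \<in> E \<and> ray \<gamma>' 0 = ray \<gamma> 0 \<and> sg \<gamma>' = - sg \<gamma>)) \<and>
    (\<forall>\<gamma> \<gamma>'. fst \<gamma> \<in> E \<longrightarrow> fst \<gamma>' \<in> E \<longrightarrow> ray \<gamma>' 0 = ray \<gamma> 0 \<longrightarrow> sg (DF \<gamma>) * sg (DF \<gamma>') = sg \<gamma> * sg \<gamma>') \<and>
    (\<forall>\<gamma> t q1 \<gamma>1 \<kappa>1 q2 \<gamma>2 \<kappa>2. piece \<gamma> t q1 \<gamma>1 \<kappa>1 \<longrightarrow> piece (opp \<gamma>) (1 - t) q2 \<gamma>2 \<kappa>2 \<longrightarrow> t \<in> {0<..<1} \<longrightarrow>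
      sg \<gamma>2 = - sg \<gamma>1)"
proof -
  obtain k where k: "\<And>\<gamma>1 \<gamma>2 \<gamma>3. fst \<gamma>1 \<in> E \<Longrightarrow> fst \<gamma>2 \<in> E \<Longrightarrow> fst \<gamma>3 \<in> E \<Longrightarrow> ray \<gamma>2 0 = ray \<gamma>1 0 \<Longrightarrow>
      ray \<gamma>3 0 = ray \<gamma>1 0 \<Longrightarrow>
    (DF ^^ k) \<gamma>1 = (DF ^^ k) \<gamma>2 \<or> (DF ^^ k) \<gamma>1 = (DF ^^ k) \<gamma>3 \<or> (DF ^^ k) \<gamma>2 = (DF ^^ k) \<gamma>3"
    using three_germs by blast
  define rep where "rep = (\<lambda>v. SOME \<gamma>. fst \<gamma> \<in> E \<and> ray \<gamma> 0 = v)"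
  \<comment> \<open>The side of the chosen germ \<open>rep\<close> is the positive one. Two germs
    that both differ from it after \<open>k\<close> steps agree with each other by
    \<open>three_germs\<close>, so there is only one other class.\<close>
  define sg :: "'e \<times> bool \<Rightarrow> real"
    where "sg = (\<lambda>\<gamma>. if (DF ^^ k) \<gamma> = (DF ^^ k) (rep (ray \<gamma> 0)) then 1 else - 1)"
  have rep: "fst (rep (ray \<gamma> 0)) \<in> E \<and> ray (rep (ray \<gamma> 0)) 0 = ray \<gamma> 0" if "fst \<gamma> \<in> E" for \<gamma>
    unfolding rep_def by (rule someI[of _ \<gamma>]) (use that in simp)
  have pm: "sg \<gamma> = 1 \<or> sg \<gamma> = - 1" for \<gamma> by (simp add: sg_def)
  have same: "sg \<gamma> = sg \<gamma>' \<longleftrightarrow> (DF ^^ k) \<gamma> = (DF ^^ k) \<gamma>'"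
    if "fst \<gamma> \<in> E" "fst \<gamma>' \<in> E" "ray \<gamma>' 0 = ray \<gamma> 0" for \<gamma> \<gamma>'
    
    using k[OF that(1,2) conjunct1[OF rep[OF that(1)]] that(3) conjunct2[OF rep[OF that(1)]]] that(3)
    by (simp add: sg_def) metis
  have opposite: "sg \<gamma>' = - sg \<gamma> \<longleftrightarrow> (DF ^^ k) \<gamma> \<noteq> (DF ^^ k) \<gamma>'"
    if "fst \<gamma> \<in> E" "fst \<gamma>' \<in> E" "ray \<gamma>' 0 = ray \<gamma> 0" for \<gamma> \<gamma>'
    unfolding same[OF that, symmetric] using pm[of \<gamma>] pm[of \<gamma>'] by (elim disjE) simp_all
  have DFS: "(DF ^^ k) (DF \<gamma>) = DF ((DF ^^ k) \<gamma>)" for \<gamma> by (simp add: funpow_swap1)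
  have two: "\<exists>\<gamma>'. fst \<gamma>' \<in> E \<and> ray \<gamma>' 0 = ray \<gamma> 0 \<and> (DF ^^ n) \<gamma>' \<noteq> (DF ^^ n) \<gamma>" if \<gamma>: "fst \<gamma> \<in> E" for \<gamma> n
    using two_germs[OF invariant_E \<gamma>, of n] by metis
  \<comment> \<open>A germ \<open>\<gamma>2\<close> that stays apart from \<open>\<gamma>\<close>
    for \<open>k + 1\<close> steps lies in the class of \<open>\<gamma>'\<close>. Hence
    \<open>\<gamma>'\<close> stays apart from \<open>\<gamma>\<close> for one more step as
    well.\<close>
  have dist: "sg (DF \<gamma>') = - sg (DF \<gamma>)"
    if \<gamma>: "fst \<gamma> \<in> E" "fst \<gamma>' \<in> E" "ray \<gamma>' 0 = ray \<gamma> 0" and d: "(DF ^^ k) \<gamma> \<noteq> (DF ^^ k) \<gamma>'" for \<gamma> \<gamma>'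
  proof -
    obtain \<gamma>2 where g2: "fst \<gamma>2 \<in> E" "ray \<gamma>2 0 = ray \<gamma> 0" "(DF ^^ Suc k) \<gamma>2 \<noteq> (DF ^^ Suc k) \<gamma>"
      using two[OF \<gamma>(1)] by blast
    then have "(DF ^^ k) \<gamma>2 \<noteq> (DF ^^ k) \<gamma>" by auto
    then have "(DF ^^ k) \<gamma>2 = (DF ^^ k) \<gamma>'" using k[OF \<gamma>(1,2) g2(1) \<gamma>(3) g2(2)] d by metis
    then have "(DF ^^ k) (DF \<gamma>) \<noteq> (DF ^^ k) (DF \<gamma>')" using g2(3) by (simp add: DFS)
    then show ?thesis using opposite[of "DF \<gamma>" "DF \<gamma>'"] \<gamma> by (simp add: DF_in DF_base)
  qed
  have "sg (DF \<gamma>) * sg (DF \<gamma>') = sg \<gamma> * sg \<gamma>'"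
    if \<gamma>: "fst \<gamma> \<in> E" "fst \<gamma>' \<in> E" "ray \<gamma>' 0 = ray \<gamma> 0" for \<gamma> \<gamma>'
  proof (cases "(DF ^^ k) \<gamma> = (DF ^^ k) \<gamma>'")
    case True
    then have "sg (DF \<gamma>) = sg (DF \<gamma>')" using same[of "DF \<gamma>" "DF \<gamma>'"] \<gamma> by (simp add: DF_in DF_base DFS)
    then show ?thesis using same[OF \<gamma>] True pm[of \<gamma>] pm[of "DF \<gamma>"] by auto
  next
    case False
    then show ?thesis using dist[OF \<gamma>] opposite[OF \<gamma>] pm[of \<gamma>] pm[of "DF \<gamma>"] by auto
  qed
  moreover have "sg \<gamma>2 = - sg \<gamma>1"
    if p1: "piece \<gamma> t q1 \<gamma>1 \<kappa>1" and p2: "piece (opp \<gamma>) (1 - t) q2 \<gamma>2 \<kappa>2" and t: "t \<in> {0<..<1}"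
    for \<gamma> t q1 \<gamma>1 \<kappa>1 q2 \<gamma>2 \<kappa>2
  proof -
    have "ray \<gamma>1 0 = f (ray \<gamma> t)" using pieceD(13)[OF p1, of t] pieceD(4,11)[OF p1] by auto
    moreover have "ray \<gamma>2 0 = f (ray \<gamma> t)"
      using pieceD(13)[OF p2, of "1 - t"] pieceD(4,11)[OF p2] by (auto simp: ray_opp)
    ultimately show ?thesis
      using opposite[of \<gamma>1 \<gamma>2] turn_distinct[OF p1 p2 t, of k] pieceD(2)[OF p1] pieceD(2)[OF p2] by simp
  qed
  moreover have "\<exists>\<gamma>'. fst \<gamma>' \<in> E \<and> ray \<gamma>' 0 = ray \<gamma> 0 \<and> sg \<gamma>' = - sg \<gamma>" if "fst \<gamma> \<in> E" for \<gamma>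
    using two[OF that, of k] opposite[OF that] by metis
  ultimately show ?thesis using pm by (intro exI[of _ sg]) blast
qed

end

subsection \<open>Length coordinates\<close>

context graph_map
begin

lemma piece_unique_lift:
  assumes 1: "piece \<gamma> p q \<gamma>' \<kappa>1" and 2: "piece \<gamma> p q \<gamma>' \<kappa>2" and u: "p \<le> u" "u \<le> q"
  shows "\<kappa>2 u = \<kappa>1 u"
proof (cases "u = p \<or> u = q")
  case True
  then show ?thesis using pieceD(11,12)[OF 1] pieceD(11,12)[OF 2] by auto
next
  case False
  then have "ray \<gamma>' (\<kappa>1 u) = ray \<gamma>' (\<kappa>2 u)"
    using pieceD(13)[OF 1 u] pieceD(13)[OF 2 u] by simp
  then show ?thesis
    using ray_inj[OF pieceD(2)[OF 1]] piece_range(2)[OF 1, of u] piece_range(1)[OF 2 u] u False by auto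
qed

text \<open>Pieces are indexed by their starting points, the elements of
  \<open>P \<gamma> - {1}\<close>. By uniqueness, target, end and lift become functions of that
  point.\<close>

definition tgt :: "'e \<times> bool \<Rightarrow> real \<Rightarrow> 'e \<times> bool"
  where "tgt \<gamma> p = (SOME \<gamma>'. \<exists>q \<kappa>. piece \<gamma> p q \<gamma>' \<kappa>)"

definition nxt :: "'e \<times> bool \<Rightarrow> real \<Rightarrow> real"
  where "nxt \<gamma> p = (SOME q. \<exists>\<kappa>. piece \<gamma> p q (tgt \<gamma> p) \<kappa>)"

definition lft :: "'e \<times> bool \<Rightarrow> real \<Rightarrow> real \<Rightarrow> real"
  where "lft \<gamma> p = (SOME \<kappa>. piece \<gamma> p (nxt \<gamma> p) (tgt \<gamma> p) \<kappa>)"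

lemma chosen_piece:
  assumes "fst \<gamma> \<in> E" "p \<in> P \<gamma> - {1}"
  shows "piece \<gamma> p (nxt \<gamma> p) (tgt \<gamma> p) (lft \<gamma> p)"
proof -
  have "p < 1" using assms(2) P_ends(3)[of \<gamma>] by (auto simp: less_le)
  then have "\<exists>\<gamma>' q \<kappa>. piece \<gamma> p q \<gamma>' \<kappa>" using first_piece[of \<gamma> p] assms by auto
  then have "\<exists>q \<kappa>. piece \<gamma> p q (tgt \<gamma> p) \<kappa>" unfolding tgt_def by (rule someI_ex)
  then have "\<exists>\<kappa>. piece \<gamma> p (nxt \<gamma> p) (tgt \<gamma> p) \<kappa>" unfolding nxt_def by (rule someI_ex)
  then show ?thesis unfolding lft_def by (rule someI_ex)
qed

lemma piece_start: "piece \<gamma> p q \<gamma>' \<kappa> \<Longrightarrow> fst \<gamma> \<in> E \<and> p \<in> P \<gamma> - {1}"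
  using pieceD(1,4,5,6)[of \<gamma> p q \<gamma>' \<kappa>] by auto

lemma chosen_piece_eq:
  assumes pc: "piece \<gamma> p q \<gamma>' \<kappa>"
  shows "nxt \<gamma> p = q" "tgt \<gamma> p = \<gamma>'" "\<And>u. p \<le> u \<Longrightarrow> u \<le> q \<Longrightarrow> lft \<gamma> p u = \<kappa> u"
proof -
  have 2: "piece \<gamma> p (nxt \<gamma> p) (tgt \<gamma> p) (lft \<gamma> p)" using chosen_piece piece_start[OF pc] by blast
  show 3: "nxt \<gamma> p = q" "tgt \<gamma> p = \<gamma>'" using piece_unique[OF pc 2] by auto
  show "lft \<gamma> p u = \<kappa> u" if "p \<le> u" "u \<le> q" for u
    using piece_unique_lift[OF pc] 2 3 that by auto
qed

end

context solenoid
begin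

text \<open>Reversing a piece changes neither of its two edges, so pieces traversed from the tail
  suffice.\<close>

lemma invariant_edgesI:
  assumes Z: "Z \<subseteq> E" and step: "\<And>e p. e \<in> Z \<Longrightarrow> p \<in> P (e, False) - {1} \<Longrightarrow> fst (tgt (e, False) p) \<in> Z"
  shows "invariant_edges Z"
  unfolding invariant_edges_def
proof (intro conjI allI impI)
  have F: "fst \<gamma>' \<in> Z" if pc: "piece (e, False) p q \<gamma>' \<kappa>" "e \<in> Z" for e p q \<gamma>' \<kappa>
    using step[OF pc(2), of p] piece_start[OF pc(1)] chosen_piece_eq(2)[OF pc(1)] by auto
  fix \<gamma> p q \<gamma>' \<kappa> assume pc: "piece \<gamma> p q \<gamma>' \<kappa>" "fst \<gamma> \<in> Z"
  show "fst \<gamma>' \<in> Z"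
  proof (cases "snd \<gamma>")
    case True
    then have "opp \<gamma> = (fst \<gamma>, False)" by (simp add: opp_def)
    then show ?thesis using F piece_opp[OF pc(1)] pc(2) by (metis fst_opp)
  next
    case False
    then have "\<gamma> = (fst \<gamma>, False)" by (simp add: prod_eq_iff)
    then show ?thesis using F pc by metis
  qed
qed (rule Z)

lemma edge_lengths:
  assumes E: "E \<noteq> {}"
  shows "\<exists>(\<mu>::real) l. \<mu> > 1 \<and> (\<forall>e\<in>E. l e > 0) \<and> (\<forall>e\<in>E. (\<Sum>p\<in>P (e, False) - {1}. l (fst (tgt (e, False) p))) = \<mu> * l e)"
proof -
  define D where "D = (\<lambda>e. P (e, False) - {1})"
  define T where "T = (\<lambda>e p. fst (tgt (e, False) p))"
  \<comment> \<open>The transition matrix: the number of pieces of \<open>e\<close> that are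
    stretched over \<open>e'\<close>.\<close>
  define M where "M = (\<lambda>e e'. real (card {p\<in>D e. T e p = e'}))"
  have fD: "finite (D e)" if "e \<in> E" for e using finite_P[of "(e, False)"] that by (simp add: D_def)
  have D0: "0 \<in> D e" if "e \<in> E" for e using P_ends(1)[of "(e, False)"] that by (simp add: D_def)
  have TE: "T e ` D e \<subseteq> E" if "e \<in> E" for e
    using chosen_piece[of "(e, False)"] pieceD(2) that by (fastforce simp: D_def T_def)
  have Msum: "(\<Sum>e'\<in>E. M e e' * x e') = (\<Sum>p\<in>D e. x (T e p))" if e: "e \<in> E" for e and x :: "'e \<Rightarrow> real"
  proof -
    have "(\<Sum>p\<in>D e. x (T e p)) = (\<Sum>e'\<in>E. \<Sum>p | p \<in> D e \<and> T e p = e'. x (T e p))"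
      using sum.group[OF fD[OF e] finite_E TE[OF e], of "\<lambda>p. x (T e p)"] by simp
    also have "\<dots> = (\<Sum>e'\<in>E. M e e' * x e')"
      by (rule sum.cong) (auto simp: M_def)
    finally show ?thesis by simp
  qed
  have irr: "Z = E" if Z: "Z \<subseteq> E" "Z \<noteq> {}" "\<And>e e'. e \<in> Z \<Longrightarrow> e' \<in> E \<Longrightarrow> M e e' > 0 \<Longrightarrow> e' \<in> Z" for Z
  proof (rule invariant_edges_trivial[OF invariant_edgesI Z(2)])
    fix e p assume ep: "e \<in> Z" "p \<in> P (e, False) - {1}"
    have eE: "e \<in> E" using ep Z by auto
    have "p \<in> {p'\<in>D e. T e p' = T e p}" using ep by (simp add: D_def)
    then have "M e (T e p) > 0"
      unfolding M_def using fD[OF eE] by (metis (no_types, lifting) card_gt_0_iff empty_iff finite_Collect_conjI finite_subset mem_Collect_eq of_nat_0_less_iff subsetI)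
    then have "T e p \<in> Z" using Z(3)[OF ep(1)] TE[OF eE] ep(2) by (auto simp: D_def)
    then show "fst (tgt (e, False) p) \<in> Z" by (simp add: T_def)
  qed (rule Z(1))
  have "\<exists>\<mu> x. (\<forall>e\<in>E. x e > 0) \<and> (\<forall>e\<in>E. (\<Sum>e'\<in>E. M e e' * x e') = \<mu> * x e)"
    by (rule irreducible_nonneg_matrix_eigenvector[OF finite_E E _ irr]) (simp add: M_def)
  then obtain \<mu> l where "\<forall>e\<in>E. l e > 0" "\<forall>e\<in>E. (\<Sum>e'\<in>E. M e e' * l e') = \<mu> * l e"
    by (elim exE conjE)
  then have l: "\<And>e. e \<in> E \<Longrightarrow> l e > 0" "\<And>e. e \<in> E \<Longrightarrow> (\<Sum>e'\<in>E. M e e' * l e') = \<mu> * l e"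
    by simp_all
  have sum: "(\<Sum>p\<in>D e. l (T e p)) = \<mu> * l e" if "e \<in> E" for e using Msum l(2) that by metis
  \<comment> \<open>Otherwise the image of an edge of minimal length \<open>m\<close> has total
    length at most \<open>m\<close>, while each of its pieces covers an edge of length at least
    \<open>m\<close>. So there is just one piece, again over a minimal edge, and the minimal edges
    form an invariant set without subdivision.\<close>
  have "\<mu> > 1"
  proof (rule ccontr)
    assume "\<not> \<mu> > 1"
    then have mu: "\<mu> \<le> 1" by simp
    define m where "m = Min (l ` E)"
    have m: "m \<in> l ` E" "\<And>e. e \<in> E \<Longrightarrow> m \<le> l e" using finite_E E by (auto simp: m_def)
    have mpos: "m > 0" using m(1) l(1) by auto
    define Z where "Z = {e\<in>E. l e = m}"
    have "Z \<noteq> {}" using m(1) by (auto simp: Z_def)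
    have Z: "D e = {0} \<and> T e 0 \<in> Z" if e: "e \<in> Z" for e
    proof -
      have eE: "e \<in> E" using e by (simp add: Z_def)
      have mT: "m \<le> l (T e p)" if "p \<in> D e" for p using m(2) TE[OF eE] that by blast
      have "real (card (D e)) * m \<le> (\<Sum>p\<in>D e. l (T e p))" using sum_bounded_below[of "D e" m] mT by auto
      also have "\<dots> \<le> m" using sum[OF eE] e mu mpos by (simp add: Z_def)
      finally have "card (D e) \<le> 1" using mpos by simp
      then have De: "D e = {0}"
        using D0[OF eE] fD[OF eE] card_le_Suc0_iff_eq[of "D e"] by auto
      then have "l (T e 0) = \<mu> * m" using sum[OF eE] e by (simp add: Z_def)
      then have "l (T e 0) \<le> m" using mu mpos by (simp add: mult_left_le_one_le mult_le_cancel_right1)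
      then have "l (T e 0) = m" using mT[of 0] De by auto
      then show ?thesis using De TE[OF eE] by (auto simp: Z_def)
    qed
    have "invariant_edges Z"
    proof (rule invariant_edgesI)
      fix e p assume ep: "e \<in> Z" "p \<in> P (e, False) - {1}"
      then have "p = 0" using Z[OF ep(1)] unfolding D_def by blast
      then show "fst (tgt (e, False) p) \<in> Z" using Z[OF ep(1)] by (simp add: T_def)
    qed (auto simp: Z_def)
    then obtain \<gamma> t q \<gamma>' \<kappa> where t: "fst \<gamma> \<in> Z" "0 < t" "t < 1" "piece \<gamma> t q \<gamma>' \<kappa>"
      using invariant_subdivided[OF _ \<open>Z \<noteq> {}\<close>] by metis
    have tP: "t \<in> P \<gamma>" using pieceD(6)[OF t(4)] .
    have "t \<in> D (fst \<gamma>) \<or> 1 - t \<in> D (fst \<gamma>)"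
    proof (cases "snd \<gamma>")
      case True
      then have "\<gamma> = opp (fst \<gamma>, False)" by (simp add: opp_def prod_eq_iff)
      then have "1 - t \<in> P (fst \<gamma>, False)" using tP P_opp by metis
      then show ?thesis using t by (auto simp: D_def)
    next
      case False
      then have "\<gamma> = (fst \<gamma>, False)" by (simp add: prod_eq_iff)
      then have "t \<in> P (fst \<gamma>, False)" using tP by metis
      then show ?thesis using t by (auto simp: D_def)
    qed
    then show False using Z[OF t(1)] t(2,3) by auto
  qed
  then show ?thesis using l(1) sum by (intro exI[of _ \<mu>] exI[of _ l]) (auto simp: D_def T_def)
qed

end

section \<open>Construction of the length coordinate\<close>

locale weighted_solenoid = solenoid X G \<phi> f
  for X :: "'a topology" and G :: "('a, 'e) pre_digraph"
    and \<phi> :: "'e \<Rightarrow> real \<Rightarrow> 'a" and f :: "'a \<Rightarrow> 'a" +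
  fixes \<mu> :: real and l :: "'e \<Rightarrow> real"
  assumes nonempty: "E \<noteq> {}" and \<mu>: "\<mu> > 1" and l_pos: "\<And>e. e \<in> E \<Longrightarrow> l e > 0"
    and l_sum: "\<And>e. e \<in> E \<Longrightarrow> (\<Sum>p\<in>P (e, False) - {1}. l (fst (tgt (e, False) p))) = \<mu> * l e"
begin

text \<open>A coordinate is stored once per edge and grows from the tail; seen from the head it is
  subtracted from the total length.\<close>

definition from_end :: "('e \<Rightarrow> real \<Rightarrow> real) \<Rightarrow> 'e \<times> bool \<Rightarrow> real \<Rightarrow> real"
  where "from_end h \<gamma> t = (if snd \<gamma> then l (fst \<gamma>) - h (fst \<gamma>) (1 - t) else h (fst \<gamma>) t)"

text \<open>The lift of one piece, continued by constants. A piece already passed then contributes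
  its full length and one not yet reached contributes nothing, so a single sum over all pieces works
  for every \<open>t\<close>.\<close>

definition clamped :: "'e \<Rightarrow> real \<Rightarrow> real \<Rightarrow> real"
  where "clamped e p t = (if t \<le> p then 0 else if t \<ge> nxt (e, False) p then 1 else lft (e, False) p t)"

text \<open>A fixed point of \<open>pull_back\<close> is a coordinate on the edges in which \<open>f\<close> has slope \<open>\<mu>\<close>;
  \<open>pull_back\<close> contracts distances by \<open>1/\<mu>\<close>.\<close>
definition pull_back :: "('e \<Rightarrow> real \<Rightarrow> real) \<Rightarrow> 'e \<Rightarrow> real \<Rightarrow> real"
  where "pull_back h e t = (\<Sum>p\<in>P (e, False) - {1}. from_end h (tgt (e, False) p) (clamped e p t)) / \<mu>"

text \<open>Monotonicity is weak because the class has to be closed under uniform limits; strictness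
  is recovered in \<open>H_less\<close>.\<close>

definition length_coordinate :: "('e \<Rightarrow> real \<Rightarrow> real) \<Rightarrow> bool"
  where "length_coordinate h \<longleftrightarrow> (\<forall>e\<in>E. h e 0 = 0 \<and> h e 1 = l e \<and>
    continuous_on {0..1} (h e) \<and> mono_on {0..1} (h e))"

context
  fixes e assumes e: "e \<in> E"
begin

private abbreviation "D \<equiv> P (e, False) - {1}"

lemma chosen: "p \<in> D \<Longrightarrow> piece (e, False) p (nxt (e, False) p) (tgt (e, False) p) (lft (e, False) p)"
  using chosen_piece[of "(e, False)" p] e by auto

lemma finite_D: "finite D"
  using finite_P[of "(e, False)"] e by simp

lemma tgt_E: "p \<in> D \<Longrightarrow> fst (tgt (e, False) p) \<in> E"
  using chosen pieceD(2) by blast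

lemma active_exists:
  assumes t: "t \<in> {0..1}"
  obtains p where "p \<in> D" "p \<le> t" "t \<le> nxt (e, False) p"
proof (cases "t = 1")
  case False
  then obtain p q \<gamma>' \<kappa> where pc: "piece (e, False) p q \<gamma>' \<kappa>" "p \<le> t" "t < q"
    using next_point[of "(e, False)" t] t e by auto
  then show thesis using that[of p] piece_start[OF pc(1)] chosen_piece_eq(1)[OF pc(1)] by auto
next
  case True
  \<comment> \<open>No piece starts at 1; the one containing it is the first piece seen from the
    head, reversed.\<close>
  have "piece (e, False) (1 - nxt (e, True) 0) 1 (opp (tgt (e, True) 0)) (\<lambda>u. 1 - lft (e, True) 0 (1 - u))"
    using piece_opp[OF chosen_piece[of "(e, True)" 0]] e P_ends[of "(e, True)"] by (simp add: opp_def)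
  from piece_start[OF this] chosen_piece_eq(1)[OF this] pieceD(4)[OF this]
  show thesis using that[of "1 - nxt (e, True) 0"] True by auto
qed

text \<open>Pieces do not overlap, so each of the others lies entirely before or entirely after the
  one containing \<open>t\<close>.\<close>

lemma inactive:
  assumes p: "p \<in> D" "p \<le> t" "t \<le> nxt (e, False) p" and p': "p' \<in> D" "p' \<noteq> p"
  shows "clamped e p' t = clamped e p' p" "clamped e p' t \<in> {0, 1}"
proof -
  note D = pieceD[OF chosen[OF p(1)]] and D' = pieceD[OF chosen[OF p'(1)]]
  have "clamped e p' t = clamped e p' p \<and> clamped e p' t \<in> {0, 1}"
  proof (cases "p' < p")
    case True
    then have "nxt (e, False) p' \<le> p" using D'(8)[of p] D(6) by (cases "p < nxt (e, False) p'") auto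
    then show ?thesis using True p(2) D'(4) by (auto simp: clamped_def)
  next
    case False
    then have "p < p'" using p' by auto
    then have "nxt (e, False) p \<le> p'" using D(8)[of p'] D'(6) by (cases "p' < nxt (e, False) p") auto
    then show ?thesis using p D by (auto simp: clamped_def)
  qed
  then show "clamped e p' t = clamped e p' p" "clamped e p' t \<in> {0, 1}" by auto
qed

lemma clamped_continuous: "p \<in> D \<Longrightarrow> continuous_on {0..1} (clamped e p)"
proof -
  assume p: "p \<in> D"
  note D = pieceD[OF chosen[OF p]]
  have "continuous_on {0..1} (\<lambda>t. lft (e, False) p (max p (min (nxt (e, False) p) t)))"
    by (rule continuous_on_compose2[OF D(9)]) (use D(4) in \<open>auto intro!: continuous_intros\<close>)
  then show ?thesis
    by (rule continuous_on_eq) (use D(4,11,12) in \<open>auto simp: clamped_def max_def min_def\<close>)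
qed

lemma clamped_mono: "p \<in> D \<Longrightarrow> s \<le> t \<Longrightarrow> clamped e p s \<le> clamped e p t"
proof -
  assume p: "p \<in> D" and st: "s \<le> t"
  note D = pieceD[OF chosen[OF p]] and R = piece_range[OF chosen[OF p]]
  show ?thesis
    using st R(1)[of s] R(1)[of t] D(14)[of s t] by (cases "s = t") (auto simp: clamped_def)
qed

lemma clamped_range: "p \<in> D \<Longrightarrow> clamped e p t \<in> {0..1}"
  using piece_range(1)[OF chosen, of p t] by (auto simp: clamped_def)

lemma clamped_ends: "p \<in> D \<Longrightarrow> clamped e p 0 = 0" "p \<in> D \<Longrightarrow> clamped e p 1 = 1"
  using pieceD(3,4,5)[OF chosen, of p] by (auto simp: clamped_def)

end

lemma from_end_ends:
  assumes h: "length_coordinate h" and \<gamma>: "fst \<gamma> \<in> E"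
  shows "from_end h \<gamma> 0 = 0" "from_end h \<gamma> 1 = l (fst \<gamma>)"
  using assms by (auto simp: from_end_def length_coordinate_def)

lemma from_end_continuous:
  assumes h: "length_coordinate h" and \<gamma>: "fst \<gamma> \<in> E"
  shows "continuous_on {0..1} (from_end h \<gamma>)"
proof -
  have c: "continuous_on {0..1} (h (fst \<gamma>))" using assms by (auto simp: length_coordinate_def)
  have "continuous_on {0..1} (\<lambda>t. h (fst \<gamma>) (1 - t))"
    by (rule continuous_on_compose2[OF c]) (auto intro!: continuous_intros)
  then show ?thesis using c unfolding from_end_def by (cases "snd \<gamma>") (auto intro!: continuous_intros)
qed

lemma from_end_mono:
  assumes h: "length_coordinate h" and \<gamma>: "fst \<gamma> \<in> E" and st: "0 \<le> s" "s \<le> t" "t \<le> 1"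
  shows "from_end h \<gamma> s \<le> from_end h \<gamma> t"
proof -
  have "mono_on {0..1} (h (fst \<gamma>))" using assms by (auto simp: length_coordinate_def)
  then show ?thesis using st by (auto simp: from_end_def intro: mono_onD)
qed

text \<open>The eigenvector equation \<open>l_sum\<close> is what makes the new coordinate end at
  \<open>l e\<close> again.\<close>

lemma pull_back_length_coordinate:
  assumes h: "length_coordinate h"
  shows "length_coordinate (pull_back h)"
  unfolding length_coordinate_def
proof (intro ballI conjI)
  fix e assume e: "e \<in> E"
  note T = tgt_E[OF e]
  show "pull_back h e 0 = 0"
    using from_end_ends(1)[OF h T] clamped_ends(1)[OF e] by (simp add: pull_back_def)
  have "pull_back h e 1 = (\<Sum>p\<in>P (e, False) - {1}. l (fst (tgt (e, False) p))) / \<mu>"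
    unfolding pull_back_def using from_end_ends(2)[OF h T] clamped_ends(2)[OF e]
    by (intro arg_cong2[where f = "(/)"] sum.cong) auto
  then show "pull_back h e 1 = l e" using l_sum[OF e] \<mu> by simp
  show "continuous_on {0..1} (pull_back h e)"
    unfolding pull_back_def
  proof (intro continuous_intros)
    fix p assume p: "p \<in> P (e, False) - {1}"
    show "continuous_on {0..1} (\<lambda>t. from_end h (tgt (e, False) p) (clamped e p t))"
      by (rule continuous_on_compose2[OF from_end_continuous[OF h T[OF p]] clamped_continuous[OF e p]])
        (use clamped_range[OF e p] in auto)
  qed (use \<mu> in auto)
  show "mono_on {0..1} (pull_back h e)"
    unfolding pull_back_def
  proof (rule mono_onI, intro divide_right_mono sum_mono)
    fix s t p :: real assume st: "s \<in> {0..1}" "t \<in> {0..1}" "s \<le> t" and p: "p \<in> P (e, False) - {1}"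
    show "from_end h (tgt (e, False) p) (clamped e p s) \<le> from_end h (tgt (e, False) p) (clamped e p t)"
      by (rule from_end_mono[OF h T[OF p]]) (use clamped_range[OF e p] clamped_mono[OF e p st(3)] in auto)
  qed (use \<mu> in auto)
qed

text \<open>Only the piece containing \<open>t\<close> matters: the others sit at 0 or 1, where all
  length coordinates agree, and do not move between \<open>p\<close> and \<open>t\<close>.\<close>

lemma pull_back_increment:
  assumes e: "e \<in> E" and p: "p \<in> P (e, False) - {1}" "p \<le> t" "t \<le> nxt (e, False) p"
    and h: "length_coordinate h" and h': "length_coordinate h'"
  shows "pull_back h e t - pull_back h' e t =
    (from_end h (tgt (e, False) p) (clamped e p t) - from_end h' (tgt (e, False) p) (clamped e p t)) / \<mu>"
    and "pull_back h e t - pull_back h e p = from_end h (tgt (e, False) p) (clamped e p t) / \<mu>"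
proof -
  note T = tgt_E[OF e] and I = inactive[OF e p] and fin = finite_D[OF e]
  have "(\<Sum>p\<in>P (e, False) - {1}. from_end h (tgt (e, False) p) (clamped e p t) - from_end h' (tgt (e, False) p) (clamped e p t))
      = from_end h (tgt (e, False) p) (clamped e p t) - from_end h' (tgt (e, False) p) (clamped e p t)"
    unfolding sum.remove[OF fin p(1)]
  proof -
    have "(\<Sum>p\<in>P (e, False) - {1} - {p}. from_end h (tgt (e, False) p) (clamped e p t) - from_end h' (tgt (e, False) p) (clamped e p t)) = 0"
    proof (rule sum.neutral, rule ballI)
      fix p' assume p': "p' \<in> P (e, False) - {1} - {p}"
      then show "from_end h (tgt (e, False) p') (clamped e p' t) - from_end h' (tgt (e, False) p') (clamped e p' t) = 0"
        using I(2)[of p'] from_end_ends[OF h T[of p']] from_end_ends[OF h' T[of p']] by auto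
    qed
    then show "from_end h (tgt (e, False) p) (clamped e p t) - from_end h' (tgt (e, False) p) (clamped e p t) +
      (\<Sum>p\<in>P (e, False) - {1} - {p}. from_end h (tgt (e, False) p) (clamped e p t) - from_end h' (tgt (e, False) p) (clamped e p t))
      = from_end h (tgt (e, False) p) (clamped e p t) - from_end h' (tgt (e, False) p) (clamped e p t)" by simp
  qed
  then show "pull_back h e t - pull_back h' e t =
    (from_end h (tgt (e, False) p) (clamped e p t) - from_end h' (tgt (e, False) p) (clamped e p t)) / \<mu>"
    by (simp only: pull_back_def sum_subtractf diff_divide_distrib[symmetric])
  have "(\<Sum>p\<in>P (e, False) - {1}. from_end h (tgt (e, False) p) (clamped e p t)) -
      (\<Sum>p'\<in>P (e, False) - {1}. from_end h (tgt (e, False) p') (clamped e p' p))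
      = from_end h (tgt (e, False) p) (clamped e p t)"
  proof -
    have "(\<Sum>p'\<in>P (e, False) - {1} - {p}. from_end h (tgt (e, False) p') (clamped e p' t))
        = (\<Sum>p'\<in>P (e, False) - {1} - {p}. from_end h (tgt (e, False) p') (clamped e p' p))"
      by (rule sum.cong) (use I(1) in auto)
    moreover have "clamped e p p = 0" by (simp add: clamped_def)
    ultimately show ?thesis
      using sum.remove[OF fin p(1), of "\<lambda>p'. from_end h (tgt (e, False) p') (clamped e p' t)"]
        sum.remove[OF fin p(1), of "\<lambda>p'. from_end h (tgt (e, False) p') (clamped e p' p)"]
        from_end_ends(1)[OF h T[OF p(1)]] by simp
  qed
  then show "pull_back h e t - pull_back h e p = from_end h (tgt (e, False) p) (clamped e p t) / \<mu>"
    by (simp add: pull_back_def diff_divide_distrib[symmetric])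
qed

lemma pull_back_contraction:
  assumes h: "length_coordinate h" and h': "length_coordinate h'"
    and B: "\<And>e t. e \<in> E \<Longrightarrow> t \<in> {0..1} \<Longrightarrow> \<bar>h e t - h' e t\<bar> \<le> B" and e: "e \<in> E" and t: "t \<in> {0..1}"
  shows "\<bar>pull_back h e t - pull_back h' e t\<bar> \<le> B / \<mu>"
proof -
  obtain p where p: "p \<in> P (e, False) - {1}" "p \<le> t" "t \<le> nxt (e, False) p" using active_exists[OF e t] .
  have "\<bar>from_end h \<gamma> s - from_end h' \<gamma> s\<bar> \<le> B" if "fst \<gamma> \<in> E" "s \<in> {0..1}" for \<gamma> s
    using B[OF that(1), of s] B[OF that(1), of "1 - s"] that(2) by (auto simp: from_end_def abs_minus_commute)
  from this[OF tgt_E[OF e p(1)] clamped_range[OF e p(1)]]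
  show ?thesis
    unfolding pull_back_increment(1)[OF e p h h'] using \<mu> by (simp add: abs_divide divide_right_mono)
qed

text \<open>Banach iteration from the linear coordinate, written as a telescoping series dominated
  by a geometric one; uniform convergence keeps the limit continuous.\<close>

lemma pull_back_fixed_point:
  "\<exists>h. length_coordinate h \<and> (\<forall>e\<in>E. \<forall>t\<in>{0..1}. pull_back h e t = h e t)"
proof -
  define hs where "hs = (\<lambda>n. (pull_back ^^ n) (\<lambda>e t. l e * t))"
  have hs: "length_coordinate (hs n)" for n
  proof (induction n)
    case 0
    show ?case using l_pos
      by (auto simp: hs_def length_coordinate_def mono_on_def less_imp_le intro!: continuous_intros mult_left_mono)
  next
    case (Suc n)
    then show ?case using pull_back_length_coordinate by (simp add: hs_def)
  qed
  define L where "L = Max (l ` E)"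
  have L: "l e \<le> L" if "e \<in> E" for e using finite_E that by (simp add: L_def)
  have dec: "\<bar>hs (Suc n) e t - hs n e t\<bar> \<le> L * (1 / \<mu>) ^ n" if "e \<in> E" "t \<in> {0..1}" for n e t
    using that
  proof (induction n arbitrary: e t)
    case 0
    \<comment> \<open>Both values lie in an interval of length at most \<open>L\<close>, which gives
      the initial constant.\<close>
    have "hs n e t \<in> {0..l e}" for n
    proof -
      have *: "hs n e 0 = 0" "hs n e 1 = l e" "mono_on {0..1} (hs n e)"
        using hs[of n] 0 by (auto simp: length_coordinate_def)
      show ?thesis using mono_onD[OF *(3), of 0 t] mono_onD[OF *(3), of t 1] * 0 by auto
    qed
    from this[of 1] this[of 0] show ?case using L[OF 0(1)] by auto
  next
    case (Suc n)
    have "\<bar>pull_back (hs (Suc n)) e t - pull_back (hs n) e t\<bar> \<le> (L * (1 / \<mu>) ^ n) / \<mu>"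
      by (rule pull_back_contraction[OF hs hs Suc.IH Suc.prems])
    then show ?case by (simp add: hs_def)
  qed
  define h where "h = (\<lambda>e t. hs 0 e t + (\<Sum>i. hs (Suc i) e t - hs i e t))"
  have unif: "uniform_limit {0..1} (\<lambda>n. hs n e) (h e) sequentially" if e: "e \<in> E" for e
  proof -
    have "uniform_limit {0..1} (\<lambda>n t. \<Sum>i<n. hs (Suc i) e t - hs i e t) (\<lambda>t. \<Sum>i. hs (Suc i) e t - hs i e t) sequentially"
    proof (rule Weierstrass_m_test)
      show "norm (hs (Suc n) e t - hs n e t) \<le> L * (1 / \<mu>) ^ n" if "t \<in> {0..1}" for n t
        using dec[OF e that] by simp
      show "summable (\<lambda>n. L * (1 / \<mu>) ^ n)" using \<mu> by (intro summable_mult summable_geometric) auto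
    qed
    then have "uniform_limit {0..1} (\<lambda>n t. hs 0 e t + (\<Sum>i<n. hs (Suc i) e t - hs i e t))
        (\<lambda>t. hs 0 e t + (\<Sum>i. hs (Suc i) e t - hs i e t)) sequentially"
      by (intro uniform_limit_intros)
    moreover have "hs 0 e t + (\<Sum>i<n. hs (Suc i) e t - hs i e t) = hs n e t" for n t
      by (induction n) auto
    ultimately show ?thesis by (simp add: h_def[abs_def])
  qed
  have lim: "(\<lambda>n. hs n e t) \<longlonglongrightarrow> h e t" if "e \<in> E" "t \<in> {0..1}" for e t
    using tendsto_uniform_limitI[OF unif[OF that(1)] that(2)] .
  have h: "length_coordinate h"
    unfolding length_coordinate_def
  proof (intro ballI conjI)
    fix e assume e: "e \<in> E"
    have *: "hs n e 0 = 0" "hs n e 1 = l e" "mono_on {0..1} (hs n e)" "continuous_on {0..1} (hs n e)" for n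
      using hs[of n] e by (auto simp: length_coordinate_def)
    have "(\<lambda>n. hs n e 0) \<longlonglongrightarrow> 0" "(\<lambda>n. hs n e 1) \<longlonglongrightarrow> l e" by (simp_all add: *)
    then show "h e 0 = 0" "h e 1 = l e"
      using LIMSEQ_unique[OF lim[OF e, of 0]] LIMSEQ_unique[OF lim[OF e, of 1]] by simp_all
    show "continuous_on {0..1} (h e)"
      by (rule uniform_limit_theorem[OF _ unif[OF e]]) (use * in auto)
    show "mono_on {0..1} (h e)"
    proof (rule mono_onI)
      fix s t :: real assume st: "s \<in> {0..1}" "t \<in> {0..1}" "s \<le> t"
      show "h e s \<le> h e t"
        by (rule LIMSEQ_le[OF lim[OF e st(1)] lim[OF e st(2)]]) (use mono_onD[OF *(3) st] in auto)
    qed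
  qed
  have "pull_back h e t = h e t" if e: "e \<in> E" and t: "t \<in> {0..1}" for e t
  proof -
    have fe: "(\<lambda>n. from_end (hs n) \<gamma> s) \<longlonglongrightarrow> from_end h \<gamma> s" if "fst \<gamma> \<in> E" "s \<in> {0..1}" for \<gamma> s
      unfolding from_end_def using that by (cases "snd \<gamma>") (auto intro!: tendsto_intros lim)
    have "(\<lambda>n. pull_back (hs n) e t) \<longlonglongrightarrow> pull_back h e t"
      unfolding pull_back_def
      by (intro tendsto_intros fe tgt_E[OF e] clamped_range[OF e]) (use \<mu> in auto)
    moreover have "(\<lambda>n. pull_back (hs n) e t) \<longlonglongrightarrow> h e t"
      using LIMSEQ_Suc[OF lim[OF e t]] by (simp add: hs_def)
    ultimately show ?thesis by (rule LIMSEQ_unique)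
  qed
  then show ?thesis using h by blast
qed

definition coordinate :: "'e \<Rightarrow> real \<Rightarrow> real"
  where "coordinate = (SOME h. length_coordinate h \<and> (\<forall>e\<in>E. \<forall>t\<in>{0..1}. pull_back h e t = h e t))"

text \<open>The distance of \<open>ray \<gamma> t\<close> from the end \<open>\<gamma>\<close>, measured along the edge.\<close>
definition H :: "'e \<times> bool \<Rightarrow> real \<Rightarrow> real"
  where "H = from_end coordinate"

lemma coordinate: "length_coordinate coordinate"
  "e \<in> E \<Longrightarrow> t \<in> {0..1} \<Longrightarrow> pull_back coordinate e t = coordinate e t"
  using someI_ex[OF pull_back_fixed_point] unfolding coordinate_def by blast+

lemma H_opp: "H (opp \<gamma>) t = l (fst \<gamma>) - H \<gamma> (1 - t)"
  by (simp add: H_def from_end_def opp_def)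

lemma H_0: "fst \<gamma> \<in> E \<Longrightarrow> H \<gamma> 0 = 0" and H_1: "fst \<gamma> \<in> E \<Longrightarrow> H \<gamma> 1 = l (fst \<gamma>)"
  and H_continuous: "fst \<gamma> \<in> E \<Longrightarrow> continuous_on {0..1} (H \<gamma>)"
  and H_mono: "fst \<gamma> \<in> E \<Longrightarrow> 0 \<le> s \<Longrightarrow> s \<le> t \<Longrightarrow> t \<le> 1 \<Longrightarrow> H \<gamma> s \<le> H \<gamma> t"
  using coordinate(1) from_end_ends from_end_continuous from_end_mono by (auto simp: H_def)

text \<open>For tail germs this is the fixed-point equation with only the active piece left. For
  head germs it is applied to the reversed piece, at the point and at \<open>p\<close>, and the two
  equations are subtracted.\<close>

lemma H_piece:
  assumes pc: "piece \<gamma> p q \<gamma>' \<kappa>" and u: "p \<le> u" "u \<le> q"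
  shows "H \<gamma>' (\<kappa> u) = \<mu> * (H \<gamma> u - H \<gamma> p)"
proof -
  have F: "H \<gamma>' (\<kappa> u) = \<mu> * (H (e, False) u - H (e, False) p)"
    if pc: "piece (e, False) p q \<gamma>' \<kappa>" and u: "p \<le> u" "u \<le> q" for e p q \<gamma>' \<kappa> u
  proof -
    note D = pieceD[OF pc] and S = piece_start[OF pc] and C = chosen_piece_eq[OF pc]
    have e: "e \<in> E" using S by simp
    have "pull_back coordinate e u - pull_back coordinate e p = from_end coordinate \<gamma>' (clamped e p u) / \<mu>"
      using pull_back_increment(2)[OF e _ _ _ coordinate(1) coordinate(1), of p u] S u C by auto
    moreover have "clamped e p u = \<kappa> u"
      using C u D(4,11,12) by (auto simp: clamped_def)
    moreover have "u \<in> {0..1}" "p \<in> {0..1}" using u D(3,4,5) by auto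
    ultimately have "coordinate e u - coordinate e p = H \<gamma>' (\<kappa> u) / \<mu>"
      using coordinate(2)[OF e] by (simp add: H_def)
    then show ?thesis using \<mu> by (simp add: H_def from_end_def field_simps)
  qed
  show ?thesis
  proof (cases "snd \<gamma>")
    case True
    then have opp: "opp \<gamma> = (fst \<gamma>, False)" by (simp add: opp_def)
    note D = pieceD[OF pc]
    have *: "l (fst \<gamma>') - H \<gamma>' (\<kappa> w) = \<mu> * (H \<gamma> q - H \<gamma> w)" if "p \<le> w" "w \<le> q" for w
      using F[of "fst \<gamma>" "1 - q" "1 - p" "opp \<gamma>'" "\<lambda>u. 1 - \<kappa> (1 - u)" "1 - w"] piece_opp[OF pc] that
      by (simp add: opp[symmetric] H_opp)
    from *[OF u] *[of p] show ?thesis using D(4,11) H_0[OF D(2)] by (simp add: algebra_simps)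
  next
    case False
    then have "\<gamma> = (fst \<gamma>, False)" by (simp add: prod_eq_iff)
    then show ?thesis using F pc u by metis
  qed
qed

text \<open>Induction on the number of steps after which both points are vertices. With no step left
  they are the two ends of an edge, whose length is positive; each earlier step divides the
  difference by \<open>\<mu>\<close>.\<close>

lemma H_less_aux:
  assumes "fst \<gamma> \<in> E" "0 \<le> s" "s < t" "t \<le> 1" "(f ^^ n) (ray \<gamma> s) \<in> V" "(f ^^ n) (ray \<gamma> t) \<in> V"
  shows "H \<gamma> s < H \<gamma> t"
  using assms
proof (induction n arbitrary: \<gamma> s t)
  case 0
  then have "s = 0" "t = 1" using ray_V[of \<gamma> s] ray_V[of \<gamma> t] by auto
  then show ?case using H_0 H_1 l_pos 0 by simp
next
  case (Suc n)
  obtain p q \<gamma>' \<kappa> where pc: "piece \<gamma> p q \<gamma>' \<kappa>" "p \<le> s" "s < q"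
    using next_point[of \<gamma> s] Suc.prems by auto
  note D = pieceD[OF pc(1)]
  \<comment> \<open>If \<open>t\<close> lies beyond the first piece, \<open>q\<close> replaces it:
    its image is a vertex already and remains one.\<close>
  define w where "w = min q t"
  have w: "s < w" "w \<le> q" "w \<le> t" using pc Suc.prems by (auto simp: w_def)
  have "(f ^^ n) (ray \<gamma>' (\<kappa> s)) \<in> V"
    using Suc.prems(5) D(13)[of s] pc by (simp add: funpow_swap1)
  moreover have "(f ^^ n) (ray \<gamma>' (\<kappa> w)) \<in> V"
  proof (cases "w = t")
    case True
    then show ?thesis using Suc.prems(6) D(13)[of t] w pc by (simp add: funpow_swap1)
  next
    case False
    then have "w = q" using w by (auto simp: w_def min_def split: if_splits)
    then have "ray \<gamma>' (\<kappa> w) \<in> V" using D(12) ray_V[OF D(2), of 1] by simp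
    moreover have "(f ^^ n) x \<in> V" if "x \<in> V" for x
      by (induction n) (use that vertices in auto)
    ultimately show ?thesis by blast
  qed
  moreover have "\<kappa> s < \<kappa> w" "0 \<le> \<kappa> s" "\<kappa> w \<le> 1"
    using D(14)[of s w] piece_range(1)[OF pc(1), of s] piece_range(1)[OF pc(1), of w] pc w by auto
  ultimately have "H \<gamma>' (\<kappa> s) < H \<gamma>' (\<kappa> w)" by (intro Suc.IH[OF D(2)])
  then have "\<mu> * H \<gamma> s < \<mu> * H \<gamma> w"
    using H_piece[OF pc(1), of s] H_piece[OF pc(1), of w] pc w by (simp add: algebra_simps)
  then have "H \<gamma> s < H \<gamma> w" using \<mu> by simp
  also have "\<dots> \<le> H \<gamma> t" using H_mono[OF D(1), of w t] w Suc.prems by auto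
  finally show ?case .
qed

text \<open>By \<open>hits_vertex\<close> two points strictly between \<open>s\<close> and
  \<open>t\<close> reach vertices, after \<open>n\<close> and \<open>m\<close> steps; both are at
  vertices after \<open>m + n\<close>.\<close>

lemma H_less:
  assumes \<gamma>: "fst \<gamma> \<in> E" and st: "0 \<le> s" "s < t" "t \<le> 1"
  shows "H \<gamma> s < H \<gamma> t"
proof -
  obtain n u where u: "s < u" "u < t" "(f ^^ n) (ray \<gamma> u) \<in> V"
    using hits_vertex[OF \<gamma> st] by auto
  obtain m w where w: "u < w" "w < t" "(f ^^ m) (ray \<gamma> w) \<in> V"
    using hits_vertex[OF \<gamma>, of u t] st u by auto
  have "(f ^^ k) x \<in> V" if "x \<in> V" for x k by (induction k) (use that vertices in auto)
  from this[OF u(3), of m] this[OF w(3), of n]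
  have "(f ^^ (m + n)) (ray \<gamma> u) \<in> V" "(f ^^ (m + n)) (ray \<gamma> w) \<in> V"
    by (simp_all add: funpow_add) (metis add.commute comp_apply funpow_add)
  then have "H \<gamma> u < H \<gamma> w" using H_less_aux[OF \<gamma>, of u w "m + n"] u w st by auto
  then show ?thesis using H_mono[OF \<gamma>, of s u] H_mono[OF \<gamma>, of w t] u w st by auto
qed

lemma H_le_iff:
  assumes "fst \<gamma> \<in> E" "s \<in> {0..1}" "t \<in> {0..1}"
  shows "H \<gamma> s < H \<gamma> t \<longleftrightarrow> s < t" "H \<gamma> s \<le> H \<gamma> t \<longleftrightarrow> s \<le> t" "H \<gamma> s = H \<gamma> t \<longleftrightarrow> s = t"
  using H_less[OF assms(1), of s t] H_less[OF assms(1), of t s] assms(2,3)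
  by (metis atLeastAtMost_iff less_irrefl linorder_cases linorder_not_less order_less_imp_le)+

end

subsection \<open>Atlases in which a map has constant slope\<close>

lemma funpow_deriv_affine: "\<exists>c d. (deriv ^^ n) (\<lambda>y::real. a * y + b) = (\<lambda>y. c * y + d)"
proof (induction n arbitrary: a b)
  case (Suc n)
  have "deriv (\<lambda>y. a * y + b) = (\<lambda>y. 0 * y + a)"
  proof
    fix y
    have "((\<lambda>y. a * y + b) has_field_derivative a) (at y)" by (auto intro!: derivative_eq_intros)
    then show "deriv (\<lambda>y. a * y + b) y = 0 * y + a" by (simp add: DERIV_imp_deriv)
  qed
  then show ?case using Suc[of 0 a] unfolding funpow_Suc_right o_apply by simp
qed auto

lemma smooth_on_affine: "smooth_on S (\<lambda>y. a * y + b)"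
  unfolding smooth_on_def
proof
  fix n
  obtain c d where "(deriv ^^ n) (\<lambda>y. a * y + b) = (\<lambda>y. c * y + d)" using funpow_deriv_affine by blast
  then show "(deriv ^^ n) (\<lambda>y. a * y + b) differentiable_on S"
    by (auto intro!: derivative_intros)
qed

text \<open>A derivative at a point depends on the germ of the function there, and an equality near
  \<open>t\<close> also holds near every point close to \<open>t\<close>.\<close>

lemma eventually_funpow_deriv_eq:
  fixes u g :: "real \<Rightarrow> real"
  assumes "\<forall>\<^sub>F s in nhds t. u s = g s"
  shows "\<forall>\<^sub>F s in nhds t. (deriv ^^ n) u s = (deriv ^^ n) g s"
proof (induction n)
  case (Suc n)
  then have "\<forall>\<^sub>F s in nhds t. \<forall>\<^sub>F s' in nhds s. (deriv ^^ n) u s' = (deriv ^^ n) g s'"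
    by (simp add: eventually_eventually)
  then show ?case by (rule eventually_mono) (simp add: deriv_cong_ev)
qed (use assms in simp)

definition locally_affine_on :: "real set \<Rightarrow> real \<Rightarrow> (real \<Rightarrow> real) \<Rightarrow> bool"
  where "locally_affine_on J r u \<longleftrightarrow>
    (\<forall>t\<in>J. \<exists>a b. \<bar>a\<bar> = r \<and> (\<forall>\<^sub>F s in nhds t. u s = a * s + b))"

lemma locally_affine_imp_smooth:
  assumes "locally_affine_on J r u"
  shows "smooth_on J u"
  unfolding smooth_on_def differentiable_on_def
proof (intro allI ballI)
  fix n t assume "t \<in> J"
  then obtain a b where "\<forall>\<^sub>F s in nhds t. u s = a * s + b" using assms by (auto simp: locally_affine_on_def)
  then have "\<forall>\<^sub>F s in nhds t. (deriv ^^ n) u s = (deriv ^^ n) (\<lambda>s. a * s + b) s"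
    by (rule eventually_funpow_deriv_eq)
  then obtain S where S: "open S" "t \<in> S" "\<And>s. s \<in> S \<Longrightarrow> (deriv ^^ n) (\<lambda>s. a * s + b) s = (deriv ^^ n) u s"
    unfolding eventually_nhds by metis
  have "(deriv ^^ n) (\<lambda>s. a * s + b) differentiable_on UNIV"
    using smooth_on_affine[of UNIV a b] by (simp add: smooth_on_def)
  then have "(deriv ^^ n) (\<lambda>s. a * s + b) differentiable at t"
    by (simp add: differentiable_on_def)
  then obtain D where "((deriv ^^ n) (\<lambda>s. a * s + b) has_derivative D) (at t)"
    by (auto simp: differentiable_def)
  then have "((deriv ^^ n) u has_derivative D) (at t)"
    by (rule has_derivative_transform_within_open[OF _ S]) auto
  then show "(deriv ^^ n) u differentiable at t within J"
    using differentiable_at_withinI differentiable_def by blast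
qed

lemma locally_affine_deriv:
  assumes "locally_affine_on J r u" "t \<in> J"
  shows "\<bar>deriv u t\<bar> = r"
proof -
  obtain a b where a: "\<bar>a\<bar> = r" "\<forall>\<^sub>F s in nhds t. u s = a * s + b"
    using assms by (auto simp: locally_affine_on_def)
  have "deriv u t = deriv (\<lambda>s. a * s + b) t" by (rule deriv_cong_ev[OF a(2)]) simp
  also have "\<dots> = a" by (rule DERIV_imp_deriv) (auto intro!: derivative_eq_intros)
  finally show ?thesis using a by simp
qed

lemma affine_imp_smoothly_compatible:
  assumes a: "a \<noteq> 0" and eq: "\<And>x. x \<in> chart_dom c \<inter> chart_dom c' \<Longrightarrow> chart_map c' x = a * chart_map c x + b"
  shows "smoothly_compatible c c'"
  unfolding smoothly_compatible_def
proof (intro exI conjI ballI)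
  show "smooth_on (chart_map c ` (chart_dom c \<inter> chart_dom c')) (\<lambda>y. a * y + b)"
    "smooth_on (chart_map c' ` (chart_dom c \<inter> chart_dom c')) (\<lambda>y. (1/a) * y + (- b/a))"
    by (rule smooth_on_affine)+
  fix x assume "x \<in> chart_dom c \<inter> chart_dom c'"
  from eq[OF this] show "chart_map c' x = a * chart_map c x + b"
    "chart_map c x = (1/a) * chart_map c' x + (- b/a)"
    using a by (auto simp: field_simps)
qed

text \<open>Stated on full neighbourhoods, with one slope across all branches at \<open>x\<close>,
  rather than along smooth arcs: in this form the property passes to compositions and
  iterates.\<close>

definition scales :: "'a topology \<Rightarrow> 'a chart set \<Rightarrow> ('a \<Rightarrow> 'a) \<Rightarrow> real \<Rightarrow> bool"
  where "scales X A h r \<longleftrightarrow> (\<forall>x\<in>topspace X. \<forall>c\<in>A. \<forall>c'\<in>A. x \<in> chart_dom c \<longrightarrow> h x \<in> chart_dom c' \<longrightarrow>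
    (\<exists>W a. openin X W \<and> x \<in> W \<and> \<bar>a\<bar> = r \<and> (\<forall>y\<in>W \<inter> chart_dom c. h y \<in> chart_dom c' \<and>
      chart_map c' (h y) = chart_map c' (h x) + a * (chart_map c y - chart_map c x))))"

lemma scalesE:
  assumes "scales X A h r" "x \<in> topspace X" "c \<in> A" "c' \<in> A" "x \<in> chart_dom c" "h x \<in> chart_dom c'"
  obtains W a where "openin X W" "x \<in> W" "\<bar>a\<bar> = r" "\<And>y. y \<in> W \<inter> chart_dom c \<Longrightarrow> h y \<in> chart_dom c' \<and>
      chart_map c' (h y) = chart_map c' (h x) + a * (chart_map c y - chart_map c x)"
proof -
  have "\<exists>W a. openin X W \<and> x \<in> W \<and> \<bar>a\<bar> = r \<and> (\<forall>y\<in>W \<inter> chart_dom c. h y \<in> chart_dom c' \<and>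
      chart_map c' (h y) = chart_map c' (h x) + a * (chart_map c y - chart_map c x))"
    using assms by (simp add: scales_def)
  then show thesis by (elim exE conjE) (rule that, assumption+, erule bspec)
qed

lemma scales_compose:
  assumes cover: "topspace X \<subseteq> (\<Union>c\<in>A. chart_dom c)" and cont: "continuous_map X X h"
    and h: "scales X A h r" and h': "scales X A h' r'"
  shows "scales X A (h' \<circ> h) (r' * r)"
  unfolding scales_def
proof (intro ballI impI)
  fix x c c' assume x: "x \<in> topspace X" "c \<in> A" "c' \<in> A" "x \<in> chart_dom c" "(h' \<circ> h) x \<in> chart_dom c'"
  have hx: "h x \<in> topspace X" using continuous_map_image_subset_topspace[OF cont] x by blast
  then obtain d where d: "d \<in> A" "h x \<in> chart_dom d" using cover by blast
  obtain W a where W: "openin X W" "x \<in> W" "\<bar>a\<bar> = r" "\<And>y. y\<in>W \<inter> chart_dom c \<Longrightarrow> h y \<in> chart_dom d \<and>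
      chart_map d (h y) = chart_map d (h x) + a * (chart_map c y - chart_map c x)"
    using scalesE[OF h x(1,2) d(1) x(4) d(2)] by metis
  obtain W' a' where W': "openin X W'" "h x \<in> W'" "\<bar>a'\<bar> = r'" "\<And>y. y\<in>W' \<inter> chart_dom d \<Longrightarrow> h' y \<in> chart_dom c' \<and>
      chart_map c' (h' y) = chart_map c' (h' (h x)) + a' * (chart_map d y - chart_map d (h x))"
    using scalesE[OF h' hx d(1) x(3) d(2) x(5)[unfolded o_apply]] by metis
  show "\<exists>W a. openin X W \<and> x \<in> W \<and> \<bar>a\<bar> = r' * r \<and> (\<forall>y\<in>W \<inter> chart_dom c. (h' \<circ> h) y \<in> chart_dom c' \<and>
      chart_map c' ((h' \<circ> h) y) = chart_map c' ((h' \<circ> h) x) + a * (chart_map c y - chart_map c x))"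
  proof (intro exI conjI ballI)
    show "openin X (W \<inter> {y\<in>topspace X. h y \<in> W'})" using W W' openin_continuous_map_preimage[OF cont] by blast
    show "x \<in> W \<inter> {y\<in>topspace X. h y \<in> W'}" using W W' x by blast
    show "\<bar>a' * a\<bar> = r' * r" using W W' by (simp add: abs_mult)
    fix y assume y: "y \<in> W \<inter> {y\<in>topspace X. h y \<in> W'} \<inter> chart_dom c"
    then have 1: "h y \<in> chart_dom d \<and> chart_map d (h y) = chart_map d (h x) + a * (chart_map c y - chart_map c x)"
      using W(4)[of y] by blast
    then have 2: "h' (h y) \<in> chart_dom c' \<and>
      chart_map c' (h' (h y)) = chart_map c' (h' (h x)) + a' * (chart_map d (h y) - chart_map d (h x))"
      using W'(4)[of "h y"] y by blast
    show "(h' \<circ> h) y \<in> chart_dom c'" using 2 by simp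
    show "chart_map c' ((h' \<circ> h) y) = chart_map c' ((h' \<circ> h) x) + (a' * a) * (chart_map c y - chart_map c x)"
    proof -
      have "chart_map d (h y) - chart_map d (h x) = a * (chart_map c y - chart_map c x)" using 1 by simp
      then show ?thesis using 2 by simp
    qed
  qed
qed

lemma scales_id:
  assumes "\<And>c. c \<in> A \<Longrightarrow> openin X (chart_dom c)"
    and tr: "\<And>c c'. c \<in> A \<Longrightarrow> c' \<in> A \<Longrightarrow> \<exists>a b. \<bar>a\<bar> = 1 \<and>
      (\<forall>x\<in>chart_dom c \<inter> chart_dom c'. chart_map c' x = a * chart_map c x + b)"
  shows "scales X A id 1"
  unfolding scales_def
proof (intro ballI impI)
  fix x c c' assume x: "x \<in> topspace X" "c \<in> A" "c' \<in> A" "x \<in> chart_dom c" "id x \<in> chart_dom c'"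
  obtain a b where ab: "\<bar>a\<bar> = 1" "\<And>x. x\<in>chart_dom c \<inter> chart_dom c' \<Longrightarrow> chart_map c' x = a * chart_map c x + b"
    using tr[OF x(2,3)] by blast
  show "\<exists>W a. openin X W \<and> x \<in> W \<and> \<bar>a\<bar> = 1 \<and> (\<forall>y\<in>W \<inter> chart_dom c. id y \<in> chart_dom c' \<and>
      chart_map c' (id y) = chart_map c' (id x) + a * (chart_map c y - chart_map c x))"
    by (intro exI[of _ "chart_dom c'"] exI[of _ a])
      (use assms(1)[OF x(3)] x ab in \<open>auto simp: algebra_simps\<close>)
qed

text \<open>Transition maps are isometries, so one pair of charts at each point determines the slope
  up to sign in all others.\<close>

lemma scalesI:
  assumes opn: "\<And>c. c \<in> A \<Longrightarrow> openin X (chart_dom c)"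
    and tr: "\<And>c c'. c \<in> A \<Longrightarrow> c' \<in> A \<Longrightarrow> \<exists>a b. \<bar>a\<bar> = 1 \<and>
      (\<forall>x\<in>chart_dom c \<inter> chart_dom c'. chart_map c' x = a * chart_map c x + b)"
    and cont: "continuous_map X X h"
    and loc: "\<And>x. x \<in> topspace X \<Longrightarrow> \<exists>c\<in>A. \<exists>c'\<in>A. \<exists>W a. x \<in> chart_dom c \<and> h x \<in> chart_dom c' \<and> openin X W \<and> x \<in> W \<and>
      \<bar>a\<bar> = r \<and> (\<forall>y\<in>W. y \<in> chart_dom c \<longrightarrow> h y \<in> chart_dom c' \<longrightarrow>
        chart_map c' (h y) = chart_map c' (h x) + a * (chart_map c y - chart_map c x))"
  shows "scales X A h r"
  unfolding scales_def
proof (intro ballI impI)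
  fix x d d' assume x: "x \<in> topspace X" "d \<in> A" "d' \<in> A" "x \<in> chart_dom d" "h x \<in> chart_dom d'"
  obtain c c' W a where c: "c \<in> A" "c' \<in> A" "x \<in> chart_dom c" "h x \<in> chart_dom c'" "openin X W" "x \<in> W" "\<bar>a\<bar> = r"
    and aff: "\<And>y. y \<in> W \<Longrightarrow> y \<in> chart_dom c \<Longrightarrow> h y \<in> chart_dom c' \<Longrightarrow>
        chart_map c' (h y) = chart_map c' (h x) + a * (chart_map c y - chart_map c x)"
    using loc[OF x(1)] by blast
  obtain a1 b1 where 1: "\<bar>a1\<bar> = 1" "\<And>x. x\<in>chart_dom d \<inter> chart_dom c \<Longrightarrow> chart_map c x = a1 * chart_map d x + b1"
    using tr[OF x(2) c(1)] by blast
  obtain a2 b2 where 2: "\<bar>a2\<bar> = 1" "\<And>x. x\<in>chart_dom c' \<inter> chart_dom d' \<Longrightarrow> chart_map d' x = a2 * chart_map c' x + b2"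
    using tr[OF c(2) x(3)] by blast
  define W' where "W' = W \<inter> chart_dom c \<inter> {y\<in>topspace X. h y \<in> chart_dom c' \<inter> chart_dom d'}"
  have "openin X {y\<in>topspace X. h y \<in> chart_dom c' \<inter> chart_dom d'}"
    by (rule openin_continuous_map_preimage[OF cont openin_Int[OF opn[OF c(2)] opn[OF x(3)]]])
  then have "openin X W'" unfolding W'_def using c(5) opn[OF c(1)] by blast
  moreover have "x \<in> W'" using c x by (auto simp: W'_def)
  moreover have "\<bar>a2 * a * a1\<bar> = r" using 1(1) 2(1) c(7) by (simp add: abs_mult)
  moreover have "h y \<in> chart_dom d' \<and> chart_map d' (h y) = chart_map d' (h x) + (a2 * a * a1) * (chart_map d y - chart_map d x)"
    if y: "y \<in> W' \<inter> chart_dom d" for y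
  proof -
    have in_dom: "y \<in> W" "y \<in> chart_dom c" "y \<in> chart_dom d" "h y \<in> chart_dom c'" "h y \<in> chart_dom d'"
      using y by (auto simp: W'_def)
    have "chart_map d' (h y) - chart_map d' (h x) = a2 * (chart_map c' (h y) - chart_map c' (h x))"
      using 2(2)[of "h y"] 2(2)[of "h x"] in_dom c x by (simp add: algebra_simps)
    also have "\<dots> = a2 * (a * (chart_map c y - chart_map c x))" using aff in_dom by simp
    also have "\<dots> = a2 * (a * (a1 * (chart_map d y - chart_map d x)))"
      using 1(2)[of y] 1(2)[of x] in_dom c x by (simp add: algebra_simps)
    finally show ?thesis using in_dom by (simp add: algebra_simps)
  qed
  ultimately show "\<exists>W a. openin X W \<and> x \<in> W \<and> \<bar>a\<bar> = r \<and> (\<forall>y\<in>W \<inter> chart_dom d. h y \<in> chart_dom d' \<and>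
      chart_map d' (h y) = chart_map d' (h x) + a * (chart_map d y - chart_map d x))" by blast
qed

lemma scales_pow:
  assumes cover: "topspace X \<subseteq> (\<Union>c\<in>A. chart_dom c)" and cont: "continuous_map X X h"
    and id: "scales X A id 1" and h: "scales X A h r"
  shows "scales X A (h ^^ n) (r ^ n)"
proof (induction n)
  case (Suc n)
  have "continuous_map X X (h ^^ n)"
  proof (induction n)
    case (Suc n)
    show ?case unfolding funpow.simps by (rule continuous_map_compose[OF Suc cont])
  qed (simp add: id_def)
  from scales_compose[OF cover this Suc h] show ?case by (simp only: funpow.simps power_Suc)
qed (use id in \<open>simp add: id_def\<close>)

text \<open>Along \<open>\<sigma>\<close> the chart coordinate is the parameter itself, so the
  scaling formula becomes an affine function of the parameter.\<close>

lemma scales_smooth_arc: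
  assumes h: "scales X A h r" and c: "c \<in> A" "c' \<in> A" and arc: "smooth_arc X c c' h J \<sigma>"
  shows "locally_affine_on J r (chart_map c' \<circ> h \<circ> \<sigma>)"
  unfolding locally_affine_on_def
proof
  fix t assume t: "t \<in> J"
  have J: "open J" "continuous_map (top_of_set J) X \<sigma>" "\<sigma> ` J \<subseteq> chart_dom c" "h ` \<sigma> ` J \<subseteq> chart_dom c'"
    and \<sigma>: "\<And>t. t \<in> J \<Longrightarrow> chart_map c (\<sigma> t) = t"
    using arc by (auto simp: smooth_arc_def)
  have "\<sigma> t \<in> topspace X" using continuous_map_image_subset_topspace[OF J(2)] t by auto
  moreover have "\<sigma> t \<in> chart_dom c" "h (\<sigma> t) \<in> chart_dom c'" using J t by auto
  ultimately obtain W a where W: "openin X W" "\<sigma> t \<in> W" "\<bar>a\<bar> = r" "\<And>y. y\<in>W \<inter> chart_dom c \<Longrightarrow> 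
      chart_map c' (h y) = chart_map c' (h (\<sigma> t)) + a * (chart_map c y - chart_map c (\<sigma> t))"
    using scalesE[OF h _ c] by metis
  have "openin (top_of_set J) {s\<in>J. \<sigma> s \<in> W}"
    using openin_continuous_map_preimage[OF J(2) W(1)] by simp
  then have "open {s\<in>J. \<sigma> s \<in> W}" using J(1) openin_open_eq by blast
  then have "\<forall>\<^sub>F s in nhds t. s \<in> {s\<in>J. \<sigma> s \<in> W}" using W(2) t by (intro eventually_nhds_in_open) auto
  then have "\<forall>\<^sub>F s in nhds t. (chart_map c' \<circ> h \<circ> \<sigma>) s = a * s + (chart_map c' (h (\<sigma> t)) - a * t)"
  proof (rule eventually_mono)
    fix s assume s: "s \<in> {s\<in>J. \<sigma> s \<in> W}"
    then have "\<sigma> s \<in> W \<inter> chart_dom c" using J(3) by auto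
    from W(4)[OF this] show "(chart_map c' \<circ> h \<circ> \<sigma>) s = a * s + (chart_map c' (h (\<sigma> t)) - a * t)"
      using \<sigma>[of s] \<sigma>[OF t] s by (simp add: algebra_simps)
  qed
  then show "\<exists>a b. \<bar>a\<bar> = r \<and> (\<forall>\<^sub>F s in nhds t. (chart_map c' \<circ> h \<circ> \<sigma>) s = a * s + b)"
    using W(3) by blast
qed

text \<open>Reduces the theorem to finding an atlas with isometric transitions in which
  \<open>f\<close> has slope \<open>\<mu>\<close> up to sign; the three dynamical axioms do not
  mention charts and carry over.\<close>

lemma williams_if_scales:
  assumes X: "compact_space X" "Hausdorff_space X" and fin: "finite A" and chart: "\<And>c. c \<in> A \<Longrightarrow> branched_chart X c"
    and cover: "(\<Union>c\<in>A. chart_dom c) = topspace X"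
    and tr: "\<And>c c'. c \<in> A \<Longrightarrow> c' \<in> A \<Longrightarrow> \<exists>a b. \<bar>a\<bar> = 1 \<and>
      (\<forall>x\<in>chart_dom c \<inter> chart_dom c'. chart_map c' x = a * chart_map c x + b)"
    and cont: "continuous_map X X f" and f: "scales X A f \<mu>" and \<mu>: "\<mu> > 1"
    and dyn: "indecomposable X f" "nonwandering X f" "flattening X f"
  shows "branched_manifold X A \<and> immersion X A f \<and> williams_solenoid_presentation X A f"
proof -
  have opn: "\<And>c. c \<in> A \<Longrightarrow> openin X (chart_dom c)" using chart by (simp add: branched_chart_def)
  have id: "scales X A id 1" by (rule scales_id[OF opn tr])
  have "smoothly_compatible c c'" if c: "c \<in> A" "c' \<in> A" for c c'
  proof -
    obtain a b where "\<bar>a\<bar> = 1" "\<forall>x\<in>chart_dom c \<inter> chart_dom c'. chart_map c' x = a * chart_map c x + b"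
      using tr[OF c] by blast
    then show ?thesis by (intro affine_imp_smoothly_compatible[of a _ _ b]) auto
  qed
  then have bm: "branched_manifold X A" using X fin chart cover by (simp add: branched_manifold_def)
  have la: "locally_affine_on J \<mu> (chart_map c' \<circ> f \<circ> \<sigma>)"
    if "c \<in> A" "c' \<in> A" "smooth_arc X c c' f J \<sigma>" for c c' J \<sigma>
    by (rule scales_smooth_arc[OF f that])
  have im: "immersion X A f"
    unfolding immersion_def smooth_map_def
  proof (intro conjI ballI allI impI)
    fix c c' J \<sigma> t assume *: "c \<in> A" "c' \<in> A" "smooth_arc X c c' f J \<sigma>" and t: "t \<in> J"
    show "deriv (chart_map c' \<circ> f \<circ> \<sigma>) t \<noteq> 0"
      using locally_affine_deriv[OF la[OF *] t] \<mu> by auto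
  qed (use cont la locally_affine_imp_smooth in blast)+
  have we: "williams_expansion X A f"
    unfolding williams_expansion_def
  proof (rule exI[of _ "\<lambda>_ _. 1"], rule exI[of _ 1], rule exI[of _ \<mu>], intro conjI allI impI ballI)
    show "riemannian_metric X A (\<lambda>_ _. 1)"
      unfolding riemannian_metric_def
    proof (intro conjI ballI allI impI)
      show "smooth_on (chart_map c ` chart_dom c) (\<lambda>_. 1)" for c :: "'a chart"
        using smooth_on_affine[of _ 0 1] by simp
      fix c c' J \<sigma> t assume *: "c \<in> A" "c' \<in> A" "smooth_arc X c c' id J \<sigma>" and t: "t \<in> J"
      show "1 = 1 * \<bar>deriv (chart_map c' \<circ> \<sigma>) t\<bar>"
        using locally_affine_deriv[OF scales_smooth_arc[OF id *] t] by simp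
    qed simp
    fix n c c' J \<sigma> t assume *: "c \<in> A" "c' \<in> A" "smooth_arc X c c' (f ^^ n) J \<sigma>" and t: "t \<in> J"
    have "scales X A (f ^^ n) (\<mu> ^ n)" by (rule scales_pow[OF _ cont id f]) (simp add: cover)
    from locally_affine_deriv[OF scales_smooth_arc[OF this *] t]
    show "1 * \<mu> ^ n * 1 \<le> 1 * \<bar>deriv (chart_map c' \<circ> f ^^ n \<circ> \<sigma>) t\<bar>" by simp
  qed (use \<mu> in auto)
  show ?thesis using bm im we dyn by (simp add: williams_solenoid_presentation_def)
qed

subsection \<open>The charts\<close>

lemma transition_sym:
  assumes "\<exists>a b. \<bar>a\<bar> = (1::real) \<and> (\<forall>x\<in>S \<inter> T. u x = a * w x + b)"
  shows "\<exists>a b. \<bar>a\<bar> = (1::real) \<and> (\<forall>x\<in>T \<inter> S. w x = a * u x + b)"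
proof -
  obtain a b where a: "\<bar>a\<bar> = 1" "\<And>x. x \<in> S \<inter> T \<Longrightarrow> u x = a * w x + b" using assms by blast
  then have aa: "a * a = 1" by (metis abs_mult_self_eq mult_1)
  have "w x = a * u x + (- a * b)" if "x \<in> T \<inter> S" for x
  proof -
    have "a * u x = (a * a) * w x + a * b" using a(2)[of x] that by (simp add: algebra_simps)
    then show ?thesis using aa by simp
  qed
  then show ?thesis using a(1) by blast
qed

locale sided_solenoid = weighted_solenoid X G \<phi> f \<mu> l
  for X :: "'a topology" and G :: "('a, 'e) pre_digraph"
    and \<phi> :: "'e \<Rightarrow> real \<Rightarrow> 'a" and f :: "'a \<Rightarrow> 'a" and \<mu> l +
  fixes sg :: "'e \<times> bool \<Rightarrow> real"
  assumes sg_pm: "sg \<gamma> = 1 \<or> sg \<gamma> = - 1"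
    and sg_other: "fst \<gamma> \<in> E \<Longrightarrow> \<exists>\<gamma>'. fst \<gamma>' \<in> E \<and> ray \<gamma>' 0 = ray \<gamma> 0 \<and> sg \<gamma>' = - sg \<gamma>"
    and sg_DF: "fst \<gamma> \<in> E \<Longrightarrow> fst \<gamma>' \<in> E \<Longrightarrow> ray \<gamma>' 0 = ray \<gamma> 0 \<Longrightarrow> sg (DF \<gamma>) * sg (DF \<gamma>') = sg \<gamma> * sg \<gamma>'"
    and sg_turn: "piece \<gamma> t q1 \<gamma>1 \<kappa>1 \<Longrightarrow> piece (opp \<gamma>) (1 - t) q2 \<gamma>2 \<kappa>2 \<Longrightarrow> t \<in> {0<..<1} \<Longrightarrow> sg \<gamma>2 = - sg \<gamma>1"
begin

text \<open>A third of the shortest edge, matching the factor 2/3 in \<open>segment\<close>: a point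
  closer than \<open>\<epsilon>\<close> to one end is farther than 2/3 of the edge from the
  other.\<close>

definition \<epsilon> :: real
  where "\<epsilon> = Min (l ` E) / 3"

lemma \<epsilon>_pos: "\<epsilon> > 0" and \<epsilon>_le: "e \<in> E \<Longrightarrow> 3 * \<epsilon> \<le> l e"
  using finite_E nonempty l_pos by (auto simp: \<epsilon>_def)

lemma sg_sq: "sg \<gamma> * sg \<gamma> = 1"
  using sg_pm[of \<gamma>] by auto

lemma H_range: "fst \<gamma> \<in> E \<Longrightarrow> t \<in> {0..1} \<Longrightarrow> H \<gamma> t \<in> {0..l (fst \<gamma>)}"
  using H_mono[of \<gamma> 0 t] H_mono[of \<gamma> t 1] H_0[of \<gamma>] H_1[of \<gamma>] by auto

text \<open>Off the vertices the two descriptions could otherwise only come from opposite ends of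
  one edge, but then the two distances would add up to its full length.\<close>

lemma germs_close_unique:
  assumes \<gamma>: "fst \<gamma> \<in> E" "fst \<gamma>' \<in> E" and t: "t \<in> {0..1}" "t' \<in> {0..1}"
    and H: "H \<gamma> t < \<epsilon>" "H \<gamma>' t' < 2/3 * l (fst \<gamma>')" and eq: "ray \<gamma> t = ray \<gamma>' t'"
  shows "(t = 0 \<and> t' = 0) \<or> (\<gamma>' = \<gamma> \<and> t' = t)"
proof -
  have t1: "t \<noteq> 1" using H(1) H_1[OF \<gamma>(1)] \<epsilon>_le[OF \<gamma>(1)] \<epsilon>_pos by auto
  have t'1: "t' \<noteq> 1" using H(2) H_1[OF \<gamma>(2)] l_pos[OF \<gamma>(2)] by auto
  show ?thesis
  proof (cases "t = 0")
    case True
    then have "ray \<gamma>' t' \<in> V" using eq ray_V[OF \<gamma>(1), of 0] by auto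
    then show ?thesis using True t'1 ray_V[OF \<gamma>(2) t(2)] by auto
  next
    case False
    then have "(\<gamma>' = \<gamma> \<and> t' = t) \<or> (\<gamma>' = opp \<gamma> \<and> t' = 1 - t)"
      using ray_eqD[OF \<gamma> _ t(2) eq] t t1 by auto
    moreover have "\<not> (\<gamma>' = opp \<gamma> \<and> t' = 1 - t)"
      using H \<epsilon>_le[OF \<gamma>(1)] by (auto simp: H_opp)
    ultimately show ?thesis by blast
  qed
qed

text \<open>Signed distance to the nearby vertex. One function serves all vertices, so transitions
  between vertex charts are the identity.\<close>

definition vertex_coord :: "'a \<Rightarrow> real"
  where "vertex_coord x = (THE y. \<exists>\<gamma> t. fst \<gamma> \<in> E \<and> t \<in> {0..1} \<and> H \<gamma> t < \<epsilon> \<and> x = ray \<gamma> t \<and> y = sg \<gamma> * H \<gamma> t)"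

lemma vertex_coord:
  assumes "fst \<gamma> \<in> E" "t \<in> {0..1}" "H \<gamma> t < \<epsilon>"
  shows "vertex_coord (ray \<gamma> t) = sg \<gamma> * H \<gamma> t"
  unfolding vertex_coord_def
proof (rule the_equality)
  show "\<exists>\<gamma>' t'. fst \<gamma>' \<in> E \<and> t' \<in> {0..1} \<and> H \<gamma>' t' < \<epsilon> \<and> ray \<gamma> t = ray \<gamma>' t' \<and> sg \<gamma> * H \<gamma> t = sg \<gamma>' * H \<gamma>' t'"
    using assms by blast
  fix y assume "\<exists>\<gamma>' t'. fst \<gamma>' \<in> E \<and> t' \<in> {0..1} \<and> H \<gamma>' t' < \<epsilon> \<and> ray \<gamma> t = ray \<gamma>' t' \<and> y = sg \<gamma>' * H \<gamma>' t'"
  then obtain \<gamma>' t' where *: "fst \<gamma>' \<in> E" "t' \<in> {0..1}" "H \<gamma>' t' < \<epsilon>" "ray \<gamma> t = ray \<gamma>' t'" "y = sg \<gamma>' * H \<gamma>' t'"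
    by blast
  have "H \<gamma>' t' < 2/3 * l (fst \<gamma>')" using *(3) \<epsilon>_le[OF *(1)] \<epsilon>_pos by auto
  from germs_close_unique[OF assms(1) *(1) assms(2) *(2) assms(3) this *(4)]
  show "y = sg \<gamma> * H \<gamma> t" using *(5) H_0[OF assms(1)] H_0[OF *(1)] by auto
qed

definition star :: "'a \<Rightarrow> real \<Rightarrow> 'a set"
  where "star v d = {ray \<gamma> t | \<gamma> t. fst \<gamma> \<in> E \<and> ray \<gamma> 0 = v \<and> t \<in> {0..1} \<and> H \<gamma> t < d}"

lemma star_cases:
  assumes "x \<in> star v d"
  obtains \<gamma> t where "fst \<gamma> \<in> E" "ray \<gamma> 0 = v" "t \<in> {0..1}" "H \<gamma> t < d" "x = ray \<gamma> t"
  using assms unfolding star_def by blast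

lemma starI: "fst \<gamma> \<in> E \<Longrightarrow> ray \<gamma> 0 = v \<Longrightarrow> t \<in> {0..1} \<Longrightarrow> H \<gamma> t < d \<Longrightarrow> ray \<gamma> t \<in> star v d"
  unfolding star_def by blast

lemma openin_H: "fst \<gamma> \<in> E \<Longrightarrow> open S \<Longrightarrow> openin (top_of_set {0..1}) {t\<in>{0..1}. H \<gamma> t \<in> S}"
  using continuous_openin_preimage_gen[OF H_continuous, of \<gamma> S] by (simp add: vimage_def Int_def)

lemma open_H: "fst \<gamma> \<in> E \<Longrightarrow> open S \<Longrightarrow> open {t\<in>{0<..<1}. H \<gamma> t \<in> S}"
proof -
  assume *: "fst \<gamma> \<in> E" "open S"
  have "continuous_on {0<..<1} (H \<gamma>)" using H_continuous[OF *(1)] by (rule continuous_on_subset) auto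
  from continuous_open_preimage[OF this _ *(2)] show ?thesis by (simp add: vimage_def Int_def)
qed

text \<open>The coordinate \<open>0\<close> belongs to the vertex, which is common to all germs: hence the hypothesis on it.\<close>
lemma openin_star_part:
  assumes Q_open: "\<And>\<gamma>. open (Q \<gamma>)"
    and Q_zero: "\<And>\<gamma> \<gamma>'. (0 \<in> Q \<gamma>) = (0 \<in> Q \<gamma>')"
  shows "openin X {ray \<gamma> t | \<gamma> t. fst \<gamma> \<in> E \<and> ray \<gamma> 0 = v \<and> t \<in> {0..1} \<and> H \<gamma> t < \<epsilon> \<and> H \<gamma> t \<in> Q \<gamma>}"
    (is "openin X ?T")
  unfolding openin_iff
proof (intro conjI allI impI)
  show "?T \<subseteq> topspace X" using ray_in by blast
  fix \<gamma>' :: "'e \<times> bool" assume \<gamma>': "fst \<gamma>' \<in> E"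
  \<comment> \<open>The edge can meet the star from its start, giving \<open>A\<close>, and from its
    end, giving \<open>B\<close>; a loop does both.\<close>
  define A where "A = {t\<in>{0..1}. H \<gamma>' t \<in> (if ray \<gamma>' 0 = v then {..<\<epsilon>} \<inter> Q \<gamma>' else {})}"
  define B where "B = {t\<in>{0..1}. H \<gamma>' t \<in> (if ray (opp \<gamma>') 0 = v then (\<lambda>h. l (fst \<gamma>') - h) -` ({..<\<epsilon>} \<inter> Q (opp \<gamma>')) else {})}"
  have "open ((\<lambda>h. l (fst \<gamma>') - h) -` ({..<\<epsilon>} \<inter> Q (opp \<gamma>')))"
    by (intro open_vimage open_Int Q_open continuous_intros)
  then have "openin (top_of_set {0..1}) A" "openin (top_of_set {0..1}) B"
    unfolding A_def B_def by (intro openin_H[OF \<gamma>']; simp add: Q_open open_Int)+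
  moreover have "{t\<in>{0..1}. ray \<gamma>' t \<in> ?T} = A \<union> B"
  proof (intro equalityI subsetI)
    fix t assume "t \<in> {t\<in>{0..1}. ray \<gamma>' t \<in> ?T}"
    then have t: "t \<in> {0..1}" and "ray \<gamma>' t \<in> ?T" by blast+
    then obtain \<gamma> s where s: "fst \<gamma> \<in> E" "ray \<gamma> 0 = v" "s \<in> {0..1}" "H \<gamma> s < \<epsilon>" "H \<gamma> s \<in> Q \<gamma>" "ray \<gamma>' t = ray \<gamma> s"
      by blast
    have s1: "s \<noteq> 1" using s(4) H_1[OF s(1)] \<epsilon>_le[OF s(1)] \<epsilon>_pos by auto
    show "t \<in> A \<union> B"
    proof (cases "s = 0")
      case True
      then have "t = 0 \<or> t = 1" using s ray_V[OF s(1), of 0] ray_V[OF \<gamma>' t] by auto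
      moreover have "0 \<in> Q \<gamma>" using s(5) True H_0[OF s(1)] by simp
      then have "0 \<in> Q \<gamma>'" "0 \<in> Q (opp \<gamma>')" using Q_zero[of \<gamma>] by simp_all
      ultimately show ?thesis
        using s(2,6) True H_0[OF \<gamma>'] H_1[OF \<gamma>'] \<epsilon>_pos by (auto simp: A_def B_def ray_opp)
    next
      case False
      then consider "\<gamma>' = \<gamma>" "t = s" | "\<gamma>' = opp \<gamma>" "t = 1 - s"
        using ray_eqD[OF s(1) \<gamma>' _ t s(6)[symmetric]] s(3) s1 by auto
      then show ?thesis
        using s by cases (auto simp: A_def B_def H_opp)
    qed
  next
    fix t assume "t \<in> A \<union> B"
    then show "t \<in> {t\<in>{0..1}. ray \<gamma>' t \<in> ?T}"
    proof
      assume "t \<in> A"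
      then show ?thesis using \<gamma>' by (auto simp: A_def split: if_splits)
    next
      assume t: "t \<in> B"
      then have "fst (opp \<gamma>') \<in> E" "ray (opp \<gamma>') 0 = v" "1 - t \<in> {0..1}" "H (opp \<gamma>') (1 - t) < \<epsilon>"
        "H (opp \<gamma>') (1 - t) \<in> Q (opp \<gamma>')"
        using \<gamma>' by (auto simp: B_def H_opp split: if_splits)
      then have "ray (opp \<gamma>') (1 - t) \<in> ?T" by blast
      then show ?thesis using t by (auto simp: ray_opp B_def)
    qed
  qed
  ultimately show "openin (top_of_set {0..1}) {t\<in>{0..1}. ray \<gamma>' t \<in> ?T}" by auto
qed

lemma openin_star: "0 < d \<Longrightarrow> d \<le> \<epsilon> \<Longrightarrow> openin X (star v d)"
proof -
  assume d: "0 < d" "d \<le> \<epsilon>"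
  have "star v d = {ray \<gamma> t | \<gamma> t. fst \<gamma> \<in> E \<and> ray \<gamma> 0 = v \<and> t \<in> {0..1} \<and> H \<gamma> t < \<epsilon> \<and> H \<gamma> t \<in> {..<d}}"
    unfolding star_def using d by (intro Collect_cong ex_cong1) auto
  then show ?thesis using openin_star_part[of "\<lambda>_. {..<d}" v] by simp
qed

text \<open>Two overlapping charts per edge instead of one. A whole loop would meet the star of its
  vertex near both of its ends; if these lie on the same side, points with different edge
  coordinates share a vertex coordinate and there is no transition map.\<close>

definition segment :: "'e \<times> bool \<Rightarrow> 'a set"
  where "segment \<gamma> = ray \<gamma> ` {t\<in>{0<..<1}. H \<gamma> t \<in> {..<2/3 * l (fst \<gamma>)}}"

definition edge_coord :: "'e \<times> bool \<Rightarrow> 'a \<Rightarrow> real"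
  where "edge_coord \<gamma> x = H \<gamma> (THE t. t \<in> {0<..<1} \<and> ray \<gamma> t = x)"

lemma edge_coord:
  assumes "fst \<gamma> \<in> E" "t \<in> {0<..<1}"
  shows "edge_coord \<gamma> (ray \<gamma> t) = H \<gamma> t"
proof -
  have "(THE t'. t' \<in> {0<..<1} \<and> ray \<gamma> t' = ray \<gamma> t) = t"
    by (rule the_equality) (use assms ray_inj[OF assms(1)] in auto)
  then show ?thesis by (simp add: edge_coord_def)
qed

lemma edge_coord_opp:
  assumes "fst \<gamma> \<in> E" "t \<in> {0<..<1}"
  shows "edge_coord (opp \<gamma>) (ray \<gamma> t) = l (fst \<gamma>) - H \<gamma> t"
  using edge_coord[of "opp \<gamma>" "1 - t"] assms by (simp add: ray_opp H_opp)

definition vertex_chart :: "'a \<Rightarrow> 'a chart"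
  where "vertex_chart v = \<lparr>chart_dom = star v \<epsilon>, chart_map = vertex_coord\<rparr>"

definition edge_chart :: "'e \<times> bool \<Rightarrow> 'a chart"
  where "edge_chart \<gamma> = \<lparr>chart_dom = segment \<gamma>, chart_map = edge_coord \<gamma>\<rparr>"

definition atlas :: "'a chart set"
  where "atlas = vertex_chart ` V \<union> edge_chart ` (E \<times> UNIV)"

lemma chart_simps [simp]:
  "chart_dom (vertex_chart v) = star v \<epsilon>" "chart_map (vertex_chart v) = vertex_coord"
  "chart_dom (edge_chart \<gamma>) = segment \<gamma>" "chart_map (edge_chart \<gamma>) = edge_coord \<gamma>"
  by (simp_all add: vertex_chart_def edge_chart_def)

lemma vertex_germ:
  assumes "v \<in> V"
  obtains \<gamma> where "fst \<gamma> \<in> E" "ray \<gamma> 0 = v"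
proof -
  obtain \<gamma> t where t: "fst \<gamma> \<in> E" "0 \<le> t" "t < 1" "v = ray \<gamma> t"
    using subgraph_cases[OF vertex_in_subgraph_E[OF nonempty assms]] by metis
  then have "t = 0" using assms ray_V[OF t(1), of t] by auto
  then show thesis using that t by simp
qed

lemma segment_or_opp:
  assumes \<gamma>: "fst \<gamma> \<in> E" and t: "t \<in> {0<..<1}"
  shows "ray \<gamma> t \<in> segment \<gamma> \<or> ray \<gamma> t \<in> segment (opp \<gamma>)"
proof (cases "H \<gamma> t < 2/3 * l (fst \<gamma>)")
  case True
  then show ?thesis using t by (auto simp: segment_def)
next
  case False
  then have "H (opp \<gamma>) (1 - t) < 2/3 * l (fst \<gamma>)" using l_pos[OF \<gamma>] by (simp add: H_opp)
  then have "ray (opp \<gamma>) (1 - t) \<in> segment (opp \<gamma>)" using t by (auto simp: segment_def)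
  then show ?thesis by (simp add: ray_opp)
qed

lemma edge_chart_in_atlas: "fst \<gamma> \<in> E \<Longrightarrow> edge_chart \<gamma> \<in> atlas"
  unfolding atlas_def by (cases \<gamma>) auto

text \<open>Spares the distinction which of the two charts of the edge contains the point: in either
  one the coordinate is an isometric affine function of \<open>H \<gamma>\<close> on the whole open
  edge.\<close>

lemma edge_chart_at:
  assumes \<gamma>: "fst \<gamma> \<in> E" and t: "t \<in> {0<..<1}"
  shows "\<exists>c\<in>atlas. \<exists>a b. ray \<gamma> t \<in> chart_dom c \<and> \<bar>a\<bar> = 1 \<and>
    (\<forall>s\<in>{0<..<1}. chart_map c (ray \<gamma> s) = a * H \<gamma> s + b)"
  using segment_or_opp[OF \<gamma> t]
proof
  assume "ray \<gamma> t \<in> segment \<gamma>"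
  then show ?thesis
    using edge_chart_in_atlas[OF \<gamma>] edge_coord[OF \<gamma>]
    by (intro bexI[of _ "edge_chart \<gamma>"] exI[of _ 1] exI[of _ 0]) auto
next
  assume "ray \<gamma> t \<in> segment (opp \<gamma>)"
  then show ?thesis
    using edge_chart_in_atlas[of "opp \<gamma>"] edge_coord_opp[OF \<gamma>] \<gamma>
    by (intro bexI[of _ "edge_chart (opp \<gamma>)"] exI[of _ "- 1"] exI[of _ "l (fst \<gamma>)"]) auto
qed

lemma atlas_cases:
  assumes "c \<in> atlas"
  obtains v where "v \<in> V" "c = vertex_chart v" | \<gamma> where "fst \<gamma> \<in> E" "c = edge_chart \<gamma>"
  using assms unfolding atlas_def by auto

lemma openin_segment: "fst \<gamma> \<in> E \<Longrightarrow> openin X (segment \<gamma>)"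
  unfolding segment_def by (intro openin_ray_image open_H) auto

lemma atlas_open: "c \<in> atlas \<Longrightarrow> openin X (chart_dom c)"
  by (erule atlas_cases) (use openin_star[of \<epsilon>] \<epsilon>_pos openin_segment in auto)

lemma atlas_cover: "(\<Union>c\<in>atlas. chart_dom c) = topspace X"
proof (intro equalityI subsetI)
  fix x assume "x \<in> (\<Union>c\<in>atlas. chart_dom c)"
  then show "x \<in> topspace X" using atlas_open openin_subset by blast
next
  fix x assume "x \<in> topspace X"
  then show "x \<in> (\<Union>c\<in>atlas. chart_dom c)"
  proof (cases rule: point_cases)
    case 1
    obtain \<gamma> where \<gamma>: "fst \<gamma> \<in> E" "ray \<gamma> 0 = x" using vertex_germ[OF 1] .
    then have "x \<in> star x \<epsilon>" using starI[of \<gamma> x 0 \<epsilon>] H_0[OF \<gamma>(1)] \<epsilon>_pos by simp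
    then have "x \<in> chart_dom (vertex_chart x)" by simp
    moreover have "vertex_chart x \<in> atlas" using 1 by (simp add: atlas_def)
    ultimately show ?thesis by blast
  next
    case (2 \<gamma> t)
    then show ?thesis using edge_chart_at[OF 2(1,2)] by blast
  qed
qed

lemma segment_cases:
  assumes "x \<in> segment \<gamma>"
  obtains t where "t \<in> {0<..<1}" "H \<gamma> t < 2/3 * l (fst \<gamma>)" "x = ray \<gamma> t"
  using assms by (auto simp: segment_def)

text \<open>A segment meets a star only along its own germ, where the coordinates differ by the sign
  of the side. The two segments of one edge differ by a reflection, and segments of different edges
  are disjoint.\<close>

lemma atlas_transition:
  assumes c: "c \<in> atlas" "c' \<in> atlas"
  shows "\<exists>a b. \<bar>a\<bar> = 1 \<and> (\<forall>x\<in>chart_dom c \<inter> chart_dom c'. chart_map c' x = a * chart_map c x + b)"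
proof -
  have ve: "\<exists>a b. \<bar>a\<bar> = 1 \<and> (\<forall>x\<in>segment \<gamma> \<inter> star v \<epsilon>. vertex_coord x = a * edge_coord \<gamma> x + b)"
    if \<gamma>: "fst \<gamma> \<in> E" for \<gamma> v
  proof (rule exI[of _ "sg \<gamma>"], rule exI[of _ 0], intro conjI ballI)
    show "\<bar>sg \<gamma>\<bar> = 1" using sg_pm[of \<gamma>] by auto
    fix x assume x: "x \<in> segment \<gamma> \<inter> star v \<epsilon>"
    obtain t where t: "t \<in> {0<..<1}" "H \<gamma> t < 2/3 * l (fst \<gamma>)" "x = ray \<gamma> t" using x segment_cases by blast
    obtain \<gamma>' t' where t': "fst \<gamma>' \<in> E" "ray \<gamma>' 0 = v" "t' \<in> {0..1}" "H \<gamma>' t' < \<epsilon>" "x = ray \<gamma>' t'"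
      using x star_cases by blast
    have "\<gamma> = \<gamma>' \<and> t = t'" using germs_close_unique[OF t'(1) \<gamma> t'(3) _ t'(4) t(2)] t t' by auto
    then show "vertex_coord x = sg \<gamma> * edge_coord \<gamma> x + 0"
      using vertex_coord[OF t'(1,3,4)] edge_coord[OF \<gamma> t(1)] t(3) by simp
  qed
  have vv: "\<exists>a b. \<bar>a\<bar> = (1::real) \<and> (\<forall>x\<in>star v \<epsilon> \<inter> star w \<epsilon>. vertex_coord x = a * vertex_coord x + b)" for v w
    by (rule exI[of _ 1], rule exI[of _ 0]) simp
  have ee: "\<exists>a b. \<bar>a\<bar> = 1 \<and> (\<forall>x\<in>segment \<gamma> \<inter> segment \<gamma>'. edge_coord \<gamma>' x = a * edge_coord \<gamma> x + b)"
    if \<gamma>: "fst \<gamma> \<in> E" "fst \<gamma>' \<in> E" for \<gamma> \<gamma>'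
  proof -
    consider "\<gamma>' = \<gamma>" | "\<gamma>' = opp \<gamma>" | "fst \<gamma>' \<noteq> fst \<gamma>" using opp_cases[of \<gamma> \<gamma>'] by metis
    then show ?thesis
    proof cases
      case 1
      then show ?thesis by (intro exI[of _ 1] exI[of _ 0]) simp
    next
      case 2
      have "edge_coord \<gamma>' x = - 1 * edge_coord \<gamma> x + l (fst \<gamma>)" if "x \<in> segment \<gamma>" for x
        using that edge_coord[OF \<gamma>(1)] edge_coord_opp[OF \<gamma>(1)] 2 by (auto elim!: segment_cases)
      then show ?thesis by (intro exI[of _ "- 1"] exI[of _ "l (fst \<gamma>)"]) auto
    next
      case 3
      have "segment \<gamma> \<inter> segment \<gamma>' = {}"
      proof (rule ccontr)
        assume "segment \<gamma> \<inter> segment \<gamma>' \<noteq> {}"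
        then obtain t t' where "t \<in> {0<..<1}" "t' \<in> {0<..<1}" "ray \<gamma> t = ray \<gamma>' t'"
          by (auto simp: segment_def)
        then show False using ray_eqD[OF \<gamma>, of t t'] 3 by auto
      qed
      then show ?thesis by (intro exI[of _ 1]) auto
    qed
  qed
  show ?thesis
    using c(1)
  proof (cases rule: atlas_cases)
    case v: (1 v)
    show ?thesis using c(2)
    proof (cases rule: atlas_cases)
      case (1 w) then show ?thesis using vv v by simp
    next
      case (2 \<gamma>) then show ?thesis using transition_sym[OF ve] v by simp
    qed
  next
    case e: (2 \<gamma>)
    show ?thesis using c(2)
    proof (cases rule: atlas_cases)
      case (1 w) then show ?thesis using ve e by simp
    next
      case (2 \<gamma>) then show ?thesis using ee e by simp
    qed
  qed
qed

section \<open>Slope of the map in the charts\<close>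

lemma piece_H_range:
  assumes pc: "piece \<gamma> p q \<gamma>' \<kappa>"
  shows "H \<gamma> q - H \<gamma> p = l (fst \<gamma>') / \<mu>"
  using H_piece[OF pc, of q] pieceD(2,4,12)[OF pc] H_1 \<mu> by (simp add: field_simps)

text \<open>The bound \<open>\<epsilon> / \<mu>\<close> keeps \<open>t\<close> inside the piece and
  its image within distance \<open>\<epsilon>\<close> of the vertex.\<close>

lemma vertex_coord_piece:
  assumes pc: "piece \<gamma> p q \<gamma>' \<kappa>" and t: "p \<le> t" "t \<le> 1" and H: "H \<gamma> t - H \<gamma> p < \<epsilon> / \<mu>"
  shows "vertex_coord (f (ray \<gamma> t)) = sg \<gamma>' * (\<mu> * (H \<gamma> t - H \<gamma> p))"
proof -
  note D = pieceD[OF pc]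
  have "\<epsilon> / \<mu> \<le> l (fst \<gamma>') / \<mu>" using \<epsilon>_le[OF D(2)] \<epsilon>_pos \<mu> by (intro divide_right_mono) auto
  then have "H \<gamma> t \<le> H \<gamma> q" using H piece_H_range[OF pc] by linarith
  then have tq: "t \<le> q" using H_le_iff(2)[OF D(1), of t q] t D(3,4,5) by auto
  have ft: "f (ray \<gamma> t) = ray \<gamma>' (\<kappa> t)" using D(13) t tq by auto
  have Hk: "H \<gamma>' (\<kappa> t) = \<mu> * (H \<gamma> t - H \<gamma> p)" by (rule H_piece[OF pc t(1) tq])
  have lt: "H \<gamma>' (\<kappa> t) < \<epsilon>" using Hk H \<mu> by (simp add: pos_less_divide_eq mult.commute)
  have k: "\<kappa> t \<in> {0..1}" by (rule piece_range(1)[OF pc t(1) tq])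
  show "vertex_coord (f (ray \<gamma> t)) = sg \<gamma>' * (\<mu> * (H \<gamma> t - H \<gamma> p))"
    using vertex_coord[OF D(2) k lt] ft Hk by simp
qed

lemma vertex_coord_V: "v \<in> V \<Longrightarrow> vertex_coord v = 0"
proof -
  assume "v \<in> V"
  then obtain \<gamma> where \<gamma>: "fst \<gamma> \<in> E" "ray \<gamma> 0 = v" using vertex_germ by blast
  then show ?thesis using vertex_coord[OF \<gamma>(1), of 0] H_0[OF \<gamma>(1)] \<epsilon>_pos by auto
qed

lemma star_V: "v \<in> V \<Longrightarrow> d > 0 \<Longrightarrow> v \<in> star v d"
proof -
  assume v: "v \<in> V" "d > 0"
  then obtain \<gamma> where \<gamma>: "fst \<gamma> \<in> E" "ray \<gamma> 0 = v" using vertex_germ by blast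
  then show ?thesis using starI[OF \<gamma>, of 0 d] H_0[OF \<gamma>(1)] v by auto
qed

text \<open>The slope has to be the same along all branches at \<open>x\<close>. At a vertex this is
  \<open>sg_DF\<close>, at an interior point mapped to a vertex it is \<open>sg_turn\<close>, and at
  all other points only one piece is involved.\<close>

lemma atlas_scales: "scales X atlas f \<mu>"
proof (rule scalesI[OF atlas_open atlas_transition continuous_f])
  fix x assume "x \<in> topspace X"
  then show "\<exists>c\<in>atlas. \<exists>c'\<in>atlas. \<exists>W a. x \<in> chart_dom c \<and> f x \<in> chart_dom c' \<and> openin X W \<and> x \<in> W \<and>
      \<bar>a\<bar> = \<mu> \<and> (\<forall>y\<in>W. y \<in> chart_dom c \<longrightarrow> f y \<in> chart_dom c' \<longrightarrow>
        chart_map c' (f y) = chart_map c' (f x) + a * (chart_map c y - chart_map c x))"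
  proof (cases rule: point_cases)
    case v: 1
    have fv: "f x \<in> V" using vertices v by blast
    obtain \<gamma>0 where \<gamma>0: "fst \<gamma>0 \<in> E" "ray \<gamma>0 0 = x" using vertex_germ[OF v] .
    \<comment> \<open>\<open>f\<close> either keeps or exchanges the sides at \<open>x\<close>; by
      \<open>sg_DF\<close> the sign is the same for all germs there.\<close>
    define \<eta> where "\<eta> = sg \<gamma>0 * sg (DF \<gamma>0)"
    have \<eta>: "sg (DF \<gamma>) = \<eta> * sg \<gamma>" if "fst \<gamma> \<in> E" "ray \<gamma> 0 = x" for \<gamma>
    proof -
      have "sg (DF \<gamma>) = sg (DF \<gamma>) * sg (DF \<gamma>0) * sg (DF \<gamma>0)" using sg_sq[of "DF \<gamma>0"] by (simp add: mult.assoc)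
      also have "\<dots> = sg \<gamma> * sg \<gamma>0 * sg (DF \<gamma>0)" using sg_DF[OF that(1) \<gamma>0(1)] that \<gamma>0 by simp
      finally show ?thesis by (simp add: \<eta>_def)
    qed
    have "\<epsilon> / \<mu> \<le> \<epsilon>" "0 < \<epsilon> / \<mu>" using \<mu> \<epsilon>_pos by (auto simp: field_simps)
    note W = openin_star[OF this(2,1), of x] star_V[OF v this(2)]
    show ?thesis
    proof (rule bexI[of _ "vertex_chart x"], rule bexI[of _ "vertex_chart (f x)"],
        rule exI[of _ "star x (\<epsilon> / \<mu>)"], rule exI[of _ "\<eta> * \<mu>"], intro conjI ballI impI)
      show "x \<in> chart_dom (vertex_chart x)" "f x \<in> chart_dom (vertex_chart (f x))"
        using star_V[OF v \<epsilon>_pos] star_V[OF fv \<epsilon>_pos] by simp_all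
      show "\<bar>\<eta> * \<mu>\<bar> = \<mu>" using sg_pm[of \<gamma>0] sg_pm[of "DF \<gamma>0"] \<mu> by (auto simp: \<eta>_def)
      fix y assume "y \<in> star x (\<epsilon> / \<mu>)"
      then obtain \<gamma> t where t: "fst \<gamma> \<in> E" "ray \<gamma> 0 = x" "t \<in> {0..1}" "H \<gamma> t < \<epsilon> / \<mu>" "y = ray \<gamma> t"
        by (rule star_cases)
      obtain q \<kappa> where pc: "piece \<gamma> 0 q (DF \<gamma>) \<kappa>" using DF_piece[OF t(1)] by blast
      have "vertex_coord (f y) = sg (DF \<gamma>) * (\<mu> * H \<gamma> t)"
        using vertex_coord_piece[OF pc, of t] t H_0[OF t(1)] by auto
      moreover have "vertex_coord y = sg \<gamma> * H \<gamma> t"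
        using vertex_coord[OF t(1,3)] t(4,5) \<open>\<epsilon> / \<mu> \<le> \<epsilon>\<close> by auto
      ultimately show "chart_map (vertex_chart (f x)) (f y) = chart_map (vertex_chart (f x)) (f x) +
          \<eta> * \<mu> * (chart_map (vertex_chart x) y - chart_map (vertex_chart x) x)"
        using vertex_coord_V[OF v] vertex_coord_V[OF fv] \<eta>[OF t(1,2)] by simp
    qed (use W v fv in \<open>auto simp: atlas_def\<close>)
  next
    case u: (2 \<gamma> u)
    obtain c a1 b1 where c: "c \<in> atlas" "x \<in> chart_dom c" "\<bar>a1\<bar> = 1"
      "\<And>s. s \<in> {0<..<1} \<Longrightarrow> chart_map c (ray \<gamma> s) = a1 * H \<gamma> s + b1"
      using edge_chart_at[OF u(1,2)] u(3) by blast
    have aa: "a1 * a1 = 1" using c(3) by (metis abs_mult_self_eq mult_1)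
    show ?thesis
    proof (cases "u \<in> P \<gamma>")
      case True
      then have fx: "f x \<in> V" using u by (simp add: P_def)
      obtain q1 \<gamma>1 \<kappa>1 where p1: "piece \<gamma> u q1 \<gamma>1 \<kappa>1" using first_piece[OF u(1) True] u(2) by auto
      obtain q2 \<gamma>2 \<kappa>2 where p2: "piece (opp \<gamma>) (1 - u) q2 \<gamma>2 \<kappa>2"
        using first_piece[of "opp \<gamma>" "1 - u"] u True by (auto simp: P_opp)
      have sg2: "sg \<gamma>2 = - sg \<gamma>1" by (rule sg_turn[OF p1 p2 u(2)])
      define W where "W = ray \<gamma> ` {t\<in>{0<..<1}. H \<gamma> t \<in> {H \<gamma> u - \<epsilon> / \<mu><..<H \<gamma> u + \<epsilon> / \<mu>}}"
      have W: "openin X W" unfolding W_def by (intro openin_ray_image open_H u) auto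
      have e: "\<epsilon> / \<mu> > 0" using \<epsilon>_pos \<mu> by simp
      show ?thesis
      proof (rule bexI[of _ c], rule bexI[of _ "vertex_chart (f x)"],
          rule exI[of _ W], rule exI[of _ "sg \<gamma>1 * \<mu> * a1"], intro conjI ballI impI)
        show "f x \<in> chart_dom (vertex_chart (f x))" using star_V[OF fx \<epsilon>_pos] by simp
        show "x \<in> W" using u e by (auto simp: W_def)
        show "\<bar>sg \<gamma>1 * \<mu> * a1\<bar> = \<mu>" using sg_pm[of \<gamma>1] \<mu> c(3) by (auto simp: abs_mult)
        fix y assume "y \<in> W"
        then obtain t where t: "t \<in> {0<..<1}" "H \<gamma> u - \<epsilon> / \<mu> < H \<gamma> t" "H \<gamma> t < H \<gamma> u + \<epsilon> / \<mu>" "y = ray \<gamma> t"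
          by (auto simp: W_def)
        have "vertex_coord (f y) = sg \<gamma>1 * (\<mu> * (H \<gamma> t - H \<gamma> u))"
        proof (cases "u \<le> t")
          case True
          then show ?thesis using vertex_coord_piece[OF p1 True] t by auto
        next
          case False
          \<comment> \<open>Before \<open>u\<close> distances are counted backwards; this reversal
            and \<open>sg \<gamma>2 = - sg \<gamma>1\<close> cancel, leaving the slope found after
            \<open>u\<close>.\<close>
          then have "vertex_coord (f (ray (opp \<gamma>) (1 - t))) = sg \<gamma>2 * (\<mu> * (H (opp \<gamma>) (1 - t) - H (opp \<gamma>) (1 - u)))"
            using t by (intro vertex_coord_piece[OF p2]) (auto simp: H_opp)
          then show ?thesis using t(4) sg2 by (simp add: ray_opp H_opp algebra_simps)
        qed
        moreover have "a1 * (chart_map c y - chart_map c x) = (a1 * a1) * (H \<gamma> t - H \<gamma> u)"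
          using c(4)[OF t(1)] c(4)[OF u(2)] t(4) u(3) by (simp add: algebra_simps)
        ultimately show "chart_map (vertex_chart (f x)) (f y) = chart_map (vertex_chart (f x)) (f x) +
          sg \<gamma>1 * \<mu> * a1 * (chart_map c y - chart_map c x)"
          using vertex_coord_V[OF fx] aa by (simp add: mult.assoc)
      qed (use c W fx in \<open>auto simp: atlas_def\<close>)
    next
      case False
      obtain p q \<gamma>' \<kappa> where pc: "piece \<gamma> p q \<gamma>' \<kappa>" "p \<le> u" "u < q" using next_point[of \<gamma> u] u by auto
      note D = pieceD[OF pc(1)]
      have pu: "p < u" using D(6) False pc(2) by (cases "p = u") auto
      have fu: "f (ray \<gamma> t) = ray \<gamma>' (\<kappa> t)" if "t \<in> {p<..<q}" for t using D(13) that by auto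
      have k01: "\<kappa> t \<in> {0<..<1}" if "t \<in> {p<..<q}" for t using piece_range(2)[OF pc(1)] that by auto
      have upq: "u \<in> {p<..<q}" using pu pc by simp
      obtain c' a2 b2 where c': "c' \<in> atlas" "ray \<gamma>' (\<kappa> u) \<in> chart_dom c'" "\<bar>a2\<bar> = 1"
        "\<And>s. s \<in> {0<..<1} \<Longrightarrow> chart_map c' (ray \<gamma>' s) = a2 * H \<gamma>' s + b2"
        using edge_chart_at[OF D(2) k01[OF upq]] by blast
      define W where "W = ray \<gamma> ` {p<..<q}"
      have W: "openin X W" unfolding W_def by (intro openin_ray_image u) (use D in auto)
      show ?thesis
      proof (rule bexI[of _ c], rule bexI[of _ c'],
          rule exI[of _ W], rule exI[of _ "a2 * \<mu> * a1"], intro conjI ballI impI)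
        show "x \<in> W" using upq u(3) by (auto simp: W_def)
        show "f x \<in> chart_dom c'" using c' fu[OF upq] u(3) by simp
        show "\<bar>a2 * \<mu> * a1\<bar> = \<mu>" using \<mu> c(3) c'(3) by (auto simp: abs_mult)
        fix y assume "y \<in> W"
        then obtain t where t: "t \<in> {p<..<q}" "y = ray \<gamma> t" by (auto simp: W_def)
        have t01: "t \<in> {0<..<1}" using t D by auto
        have "chart_map c' (f y) - chart_map c' (f x) = a2 * (H \<gamma>' (\<kappa> t) - H \<gamma>' (\<kappa> u))"
          using c'(4)[OF k01[OF t(1)]] c'(4)[OF k01[OF upq]] fu[OF t(1)] fu[OF upq] t u(3)
          by (simp add: algebra_simps)
        also have "H \<gamma>' (\<kappa> t) - H \<gamma>' (\<kappa> u) = \<mu> * (H \<gamma> t - H \<gamma> u)"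
          using H_piece[OF pc(1), of t] H_piece[OF pc(1), of u] t upq by (simp add: algebra_simps)
        also have "H \<gamma> t - H \<gamma> u = a1 * (chart_map c y - chart_map c x)"
        proof -
          have "a1 * (chart_map c y - chart_map c x) = (a1 * a1) * (H \<gamma> t - H \<gamma> u)"
            using c(4)[OF t01] c(4)[OF u(2)] t u(3) by (simp add: algebra_simps)
          then show ?thesis using aa by simp
        qed
        finally show "chart_map c' (f y) = chart_map c' (f x) + a2 * \<mu> * a1 * (chart_map c y - chart_map c x)"
          by (simp add: mult.assoc)
      qed (use c c' W in auto)
    qed
  qed
qed

section \<open>Verification of the chart axioms\<close>

text \<open>Composed with \<open>ray \<gamma>\<close> this is the parametrization of the edge by its
  length coordinate.\<close>

definition pos :: "'e \<times> bool \<Rightarrow> real \<Rightarrow> real"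
  where "pos \<gamma> = inv_into {0..1} (H \<gamma>)"

lemma H_image: "fst \<gamma> \<in> E \<Longrightarrow> H \<gamma> ` {0..1} = {0..l (fst \<gamma>)}"
proof (intro equalityI subsetI)
  fix y assume \<gamma>: "fst \<gamma> \<in> E" and y: "y \<in> {0..l (fst \<gamma>)}"
  have "\<exists>t\<ge>0. t \<le> 1 \<and> H \<gamma> t = y"
    by (rule IVT') (use y H_0[OF \<gamma>] H_1[OF \<gamma>] H_continuous[OF \<gamma>] in auto)
  then show "y \<in> H \<gamma> ` {0..1}" by auto
qed (use H_range[of \<gamma>] in auto)

lemma pos_H: "fst \<gamma> \<in> E \<Longrightarrow> t \<in> {0..1} \<Longrightarrow> pos \<gamma> (H \<gamma> t) = t"
  unfolding pos_def by (rule inv_into_f_f) (auto simp: inj_on_def H_le_iff(3))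

lemma H_pos:
  assumes "fst \<gamma> \<in> E" "y \<in> {0..l (fst \<gamma>)}"
  shows "H \<gamma> (pos \<gamma> y) = y" "pos \<gamma> y \<in> {0..1}"
proof -
  have "y \<in> H \<gamma> ` {0..1}" using assms H_image by simp
  then show "H \<gamma> (pos \<gamma> y) = y" "pos \<gamma> y \<in> {0..1}"
    unfolding pos_def by (rule f_inv_into_f, rule inv_into_into)
qed

lemma pos_0: "fst \<gamma> \<in> E \<Longrightarrow> pos \<gamma> 0 = 0"
  using pos_H[of \<gamma> 0] H_0[of \<gamma>] by simp

lemma unit_speed_continuous:
  assumes \<gamma>: "fst \<gamma> \<in> E"
  shows "continuous_map (top_of_set {0..l (fst \<gamma>)}) X (\<lambda>y. ray \<gamma> (pos \<gamma> y))"
proof -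
  have "continuous_on (H \<gamma> ` {0..1}) (pos \<gamma>)"
    by (rule continuous_on_inv[OF H_continuous[OF \<gamma>]]) (use pos_H[OF \<gamma>] in auto)
  then have "continuous_map (top_of_set {0..l (fst \<gamma>)}) (top_of_set {0..1}) (pos \<gamma>)"
    using H_image[OF \<gamma>] H_pos(2)[OF \<gamma>] by auto
  from continuous_map_compose[OF this ray_continuous[OF \<gamma>]] show ?thesis by (simp add: o_def)
qed

lemma edge_coord_continuous:
  assumes \<gamma>: "fst \<gamma> \<in> E"
  shows "continuous_map (subtopology X (segment \<gamma>)) euclideanreal (edge_coord \<gamma>)"
  unfolding continuous_map_def
proof (intro conjI allI impI)
  fix U :: "real set" assume "openin euclidean U"
  then have U: "open U" by simp
  have eq: "{x \<in> topspace (subtopology X (segment \<gamma>)). edge_coord \<gamma> x \<in> U}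
      = ray \<gamma> ` {t\<in>{0<..<1}. H \<gamma> t \<in> {..<2/3 * l (fst \<gamma>)} \<inter> U}"
    using openin_subset[OF openin_segment[OF \<gamma>]] edge_coord[OF \<gamma>] by (auto simp: segment_def)
  have "openin X (ray \<gamma> ` {t\<in>{0<..<1}. H \<gamma> t \<in> {..<2/3 * l (fst \<gamma>)} \<inter> U})"
    using U by (intro openin_ray_image open_H \<gamma>) auto
  moreover have "ray \<gamma> ` {t\<in>{0<..<1}. H \<gamma> t \<in> {..<2/3 * l (fst \<gamma>)} \<inter> U} \<subseteq> segment \<gamma>"
    by (auto simp: segment_def)
  ultimately show "openin (subtopology X (segment \<gamma>)) {x \<in> topspace (subtopology X (segment \<gamma>)). edge_coord \<gamma> x \<in> U}"
    unfolding eq openin_open_subtopology[OF openin_segment[OF \<gamma>]] by blast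
qed auto

text \<open>The preimage is described germ by germ. The conditions depend on the side, but all of
  them treat the vertex alike because its coordinate is 0 on either side.\<close>

lemma vertex_coord_continuous: "continuous_map (subtopology X (star v \<epsilon>)) euclideanreal vertex_coord"
  unfolding continuous_map_def
proof (intro conjI allI impI)
  fix U :: "real set" assume "openin euclidean U"
  then have U: "open U" by simp
  note st = openin_star[OF \<epsilon>_pos order_refl, of v]
  have "{x \<in> topspace (subtopology X (star v \<epsilon>)). vertex_coord x \<in> U}
      = {ray \<gamma> t | \<gamma> t. fst \<gamma> \<in> E \<and> ray \<gamma> 0 = v \<and> t \<in> {0..1} \<and> H \<gamma> t < \<epsilon> \<and> H \<gamma> t \<in> (\<lambda>h. sg \<gamma> * h) -` U}"
    (is "?L = ?R")
  proof (intro equalityI subsetI)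
    fix x assume "x \<in> ?L"
    then have x: "x \<in> star v \<epsilon>" "vertex_coord x \<in> U" by auto
    from x(1) obtain \<gamma> t where t: "fst \<gamma> \<in> E" "ray \<gamma> 0 = v" "t \<in> {0..1}" "H \<gamma> t < \<epsilon>" "x = ray \<gamma> t"
      by (rule star_cases)
    then have "H \<gamma> t \<in> (\<lambda>h. sg \<gamma> * h) -` U" using vertex_coord[OF t(1,3,4)] x(2) by simp
    then show "x \<in> ?R" using t by blast
  next
    fix x assume "x \<in> ?R"
    then obtain \<gamma> t where t: "fst \<gamma> \<in> E" "ray \<gamma> 0 = v" "t \<in> {0..1}" "H \<gamma> t < \<epsilon>" "x = ray \<gamma> t" "sg \<gamma> * H \<gamma> t \<in> U"
      by blast
    then have "x \<in> star v \<epsilon>" "vertex_coord x \<in> U" using starI vertex_coord by auto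
    then show "x \<in> ?L" using openin_subset[OF st] by auto
  qed
  moreover have "openin X ?R"
  proof (rule openin_star_part)
    show "open ((\<lambda>h. sg \<gamma> * h) -` U)" for \<gamma> by (intro open_vimage U continuous_intros)
  qed simp
  moreover have "?R \<subseteq> star v \<epsilon>" unfolding star_def by blast
  ultimately show "openin (subtopology X (star v \<epsilon>)) {x \<in> topspace (subtopology X (star v \<epsilon>)). vertex_coord x \<in> U}"
    using st by (simp add: openin_open_subtopology)
qed auto

text \<open>A single arc suffices, so the condition on pairs of arcs is vacuous and any point of it,
  here the one with coordinate \<open>b/2\<close>, can serve as the common point.\<close>

lemma branched_edge_chart:
  assumes \<gamma>: "fst \<gamma> \<in> E"
  shows "branched_chart X (edge_chart \<gamma>)"
proof -
  define b where "b = 2/3 * l (fst \<gamma>)"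
  have b: "0 < b" "b \<le> l (fst \<gamma>)" using l_pos[OF \<gamma>] by (auto simp: b_def)
  have seg: "x \<in> segment \<gamma> \<longleftrightarrow> (\<exists>y\<in>{0<..<b}. x = ray \<gamma> (pos \<gamma> y))" for x
  proof
    assume "x \<in> segment \<gamma>"
    then obtain t where t: "t \<in> {0<..<1}" "H \<gamma> t < b" "x = ray \<gamma> t" unfolding b_def by (rule segment_cases)
    have "0 < H \<gamma> t" using H_less[OF \<gamma>, of 0 t] H_0[OF \<gamma>] t by auto
    then show "\<exists>y\<in>{0<..<b}. x = ray \<gamma> (pos \<gamma> y)" using t pos_H[OF \<gamma>, of t] by (intro bexI[of _ "H \<gamma> t"]) auto
  next
    assume "\<exists>y\<in>{0<..<b}. x = ray \<gamma> (pos \<gamma> y)"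
    then obtain y where y: "y \<in> {0<..<b}" "x = ray \<gamma> (pos \<gamma> y)" by blast
    have *: "H \<gamma> (pos \<gamma> y) = y" "pos \<gamma> y \<in> {0..1}" using H_pos[OF \<gamma>, of y] y b by auto
    have "pos \<gamma> y \<noteq> 0" using * H_0[OF \<gamma>] y by auto
    moreover have "pos \<gamma> y \<noteq> 1" using * H_1[OF \<gamma>] y b by auto
    ultimately show "x \<in> segment \<gamma>" using y * by (auto simp: segment_def b_def)
  qed
  have coord: "edge_coord \<gamma> (ray \<gamma> (pos \<gamma> y)) = y" if "y \<in> {0<..<b}" for y
  proof -
    have *: "H \<gamma> (pos \<gamma> y) = y" "pos \<gamma> y \<in> {0..1}" using H_pos[OF \<gamma>, of y] that b by auto
    have "pos \<gamma> y \<noteq> 0" using * H_0[OF \<gamma>] that by auto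
    moreover have "pos \<gamma> y \<noteq> 1" using * H_1[OF \<gamma>] that b by auto
    ultimately show ?thesis using edge_coord[OF \<gamma>, of "pos \<gamma> y"] * by auto
  qed
  have top: "topspace (subtopology X (segment \<gamma>)) = segment \<gamma>"
    using openin_subset[OF openin_segment[OF \<gamma>]] by auto
  have cm: "continuous_map (subtopology X (segment \<gamma>)) (top_of_set {0<..<b}) (edge_coord \<gamma>)"
    using edge_coord_continuous[OF \<gamma>] coord seg
    by (fastforce simp: continuous_map_in_subtopology top)
  have "homeomorphic_maps (subtopology X (segment \<gamma>)) (top_of_set {0<..<b}) (edge_coord \<gamma>) (\<lambda>y. ray \<gamma> (pos \<gamma> y))"
    unfolding homeomorphic_maps_def
  proof (intro conjI ballI)
    have "continuous_map (top_of_set {0<..<b}) X (\<lambda>y. ray \<gamma> (pos \<gamma> y))"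
      by (rule continuous_map_from_subtopology_mono[OF unit_speed_continuous[OF \<gamma>]]) (use b in auto)
    then show "continuous_map (top_of_set {0<..<b}) (subtopology X (segment \<gamma>)) (\<lambda>y. ray \<gamma> (pos \<gamma> y))"
      using seg by (auto simp: continuous_map_in_subtopology)
    show "ray \<gamma> (pos \<gamma> (edge_coord \<gamma> x)) = x" if "x \<in> topspace (subtopology X (segment \<gamma>))" for x
      using that coord seg unfolding top by auto
  qed (use cm coord in auto)
  then have hom: "homeomorphic_map (subtopology X (segment \<gamma>)) (top_of_set {0<..<b}) (edge_coord \<gamma>)"
    using homeomorphic_map_maps by blast
  have ex: "ray \<gamma> (pos \<gamma> (b/2)) \<in> segment \<gamma>" using seg b by auto
  show ?thesis
    unfolding branched_chart_def
  proof (intro conjI)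
    show "openin X (chart_dom (edge_chart \<gamma>))" using openin_segment[OF \<gamma>] by simp
    show "\<exists>a b S. a < b \<and> finite S \<and> S \<noteq> {} \<and> \<Union>S = chart_dom (edge_chart \<gamma>) \<and>
       continuous_map (subtopology X (chart_dom (edge_chart \<gamma>))) (top_of_set {a<..<b}) (chart_map (edge_chart \<gamma>)) \<and>
       (\<forall>s\<in>S. homeomorphic_map (subtopology X s) (top_of_set {a<..<b}) (chart_map (edge_chart \<gamma>))) \<and>
       (\<exists>v\<in>\<Inter>S. \<forall>s\<in>S. \<forall>t\<in>S. s \<noteq> t \<longrightarrow>
          chart_map (edge_chart \<gamma>) ` (s \<inter> t)
            \<in> {{chart_map (edge_chart \<gamma>) v}, {a <.. chart_map (edge_chart \<gamma>) v}, {chart_map (edge_chart \<gamma>) v ..< b}})"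
      by (rule exI[of _ 0], rule exI[of _ b], rule exI[of _ "{segment \<gamma>}"]) (use b cm hom ex in auto)
  qed
qed

text \<open>The smooth arc through the vertex from the germ \<open>\<gamma>2\<close> to the germ \<open>\<gamma>1\<close>.\<close>
definition through :: "'e \<times> bool \<Rightarrow> 'e \<times> bool \<Rightarrow> real \<Rightarrow> 'a"
  where "through \<gamma>1 \<gamma>2 y = (if 0 \<le> y then ray \<gamma>1 (pos \<gamma>1 y) else ray \<gamma>2 (pos \<gamma>2 (- y)))"

lemma through_point:
  assumes \<gamma>: "fst \<gamma> \<in> E" and y: "0 \<le> y" "y < \<epsilon>"
  shows "ray \<gamma> (pos \<gamma> y) \<in> star (ray \<gamma> 0) \<epsilon>" "vertex_coord (ray \<gamma> (pos \<gamma> y)) = sg \<gamma> * y"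
proof -
  have *: "H \<gamma> (pos \<gamma> y) = y" "pos \<gamma> y \<in> {0..1}"
    using H_pos[OF \<gamma>, of y] \<epsilon>_le[OF \<gamma>] y by auto
  show "ray \<gamma> (pos \<gamma> y) \<in> star (ray \<gamma> 0) \<epsilon>" using starI[OF \<gamma> refl *(2)] * y by simp
  show "vertex_coord (ray \<gamma> (pos \<gamma> y)) = sg \<gamma> * y" using vertex_coord[OF \<gamma> *(2)] * y by simp
qed

lemma same_germ_if_point_eq:
  assumes \<gamma>: "fst \<gamma> \<in> E" "fst \<gamma>' \<in> E" and y: "0 < y" "y < \<epsilon>" and eq: "ray \<gamma> (pos \<gamma> y) = ray \<gamma>' (pos \<gamma>' y)"
  shows "\<gamma>' = \<gamma>"
proof -
  have 1: "H \<gamma> (pos \<gamma> y) = y" "pos \<gamma> y \<in> {0..1}" using H_pos[OF \<gamma>(1), of y] \<epsilon>_le[OF \<gamma>(1)] y by auto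
  have 2: "H \<gamma>' (pos \<gamma>' y) = y" "pos \<gamma>' y \<in> {0..1}" using H_pos[OF \<gamma>(2), of y] \<epsilon>_le[OF \<gamma>(2)] y by auto
  have "pos \<gamma> y \<noteq> 0" using 1 H_0[OF \<gamma>(1)] y by auto
  then show ?thesis
    using germs_close_unique[OF \<gamma> 1(2) 2(2) _ _ eq] 1 2 y \<epsilon>_le[OF \<gamma>(2)] by auto
qed

text \<open>The arcs are indexed by pairs of germs, one from each side. They cover the star because,
  by \<open>sg_other\<close>, every germ has a partner on the other side.\<close>

lemma branched_vertex_chart:
  assumes v: "v \<in> V"
  shows "branched_chart X (vertex_chart v)"
proof -
  define I where "I = {(\<gamma>1, \<gamma>2). fst \<gamma>1 \<in> E \<and> fst \<gamma>2 \<in> E \<and> ray \<gamma>1 0 = v \<and> ray \<gamma>2 0 = v \<and> sg \<gamma>1 = 1 \<and> sg \<gamma>2 = - 1}"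
  define arc where "arc = (\<lambda>(\<gamma>1, \<gamma>2). through \<gamma>1 \<gamma>2 ` {- \<epsilon><..<\<epsilon>})"
  define S where "S = arc ` I"
  note st = openin_star[OF \<epsilon>_pos order_refl, of v]
  have stX: "star v \<epsilon> \<subseteq> topspace X" using openin_subset[OF st] .
  have "I \<subseteq> (E \<times> UNIV) \<times> (E \<times> UNIV)" by (auto simp: I_def)
  moreover have "finite ((E \<times> (UNIV :: bool set)) \<times> (E \<times> (UNIV :: bool set)))" using finite_E by simp
  ultimately have "finite I" by (rule finite_subset)
  then have finS: "finite S" by (simp add: S_def)
  have ID: "fst \<gamma>1 \<in> E" "fst \<gamma>2 \<in> E" "ray \<gamma>1 0 = v" "ray \<gamma>2 0 = v" "sg \<gamma>1 = 1" "sg \<gamma>2 = - 1" if "(\<gamma>1, \<gamma>2) \<in> I" for \<gamma>1 \<gamma>2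
    using that by (auto simp: I_def)
  have coord: "vertex_coord (through \<gamma>1 \<gamma>2 y) = y" and in_star: "through \<gamma>1 \<gamma>2 y \<in> star v \<epsilon>"
    if i: "(\<gamma>1, \<gamma>2) \<in> I" and y: "y \<in> {- \<epsilon><..<\<epsilon>}" for \<gamma>1 \<gamma>2 y
    using through_point[OF ID(1)[OF i], of y] through_point[OF ID(2)[OF i], of "- y"] ID(3-6)[OF i] y
    by (auto simp: through_def)
  have arc_sub: "s \<subseteq> star v \<epsilon>" if "s \<in> S" for s
    using that in_star by (auto simp: S_def arc_def)
  have S_cases: "\<exists>\<gamma>1 \<gamma>2. (\<gamma>1, \<gamma>2) \<in> I \<and> s = through \<gamma>1 \<gamma>2 ` {- \<epsilon><..<\<epsilon>}" if "s \<in> S" for s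
    using that by (auto simp: S_def arc_def)
  have partner: "\<exists>\<gamma>'. fst \<gamma>' \<in> E \<and> ray \<gamma>' 0 = v \<and> sg \<gamma>' = - sg \<gamma>" if "fst \<gamma> \<in> E" "ray \<gamma> 0 = v" for \<gamma>
    using sg_other[OF that(1)] that(2) by simp
  have "\<Union>S = star v \<epsilon>"
  proof (intro equalityI subsetI)
    fix x assume "x \<in> star v \<epsilon>"
    then obtain \<gamma> t where t: "fst \<gamma> \<in> E" "ray \<gamma> 0 = v" "t \<in> {0..1}" "H \<gamma> t < \<epsilon>" "x = ray \<gamma> t"
      by (rule star_cases)
    have x: "x = ray \<gamma> (pos \<gamma> (H \<gamma> t))" using pos_H[OF t(1,3)] t(5) by simp
    have h: "0 \<le> H \<gamma> t" using H_range[OF t(1,3)] by auto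
    obtain \<gamma>' where \<gamma>': "fst \<gamma>' \<in> E" "ray \<gamma>' 0 = v" "sg \<gamma>' = - sg \<gamma>" using partner[OF t(1,2)] by blast
    show "x \<in> \<Union>S"
    proof (cases "sg \<gamma> = 1")
      case True
      then have "(\<gamma>, \<gamma>') \<in> I" using t \<gamma>' by (simp add: I_def)
      moreover have "x = through \<gamma> \<gamma>' (H \<gamma> t)" using h x by (simp add: through_def)
      moreover have "through \<gamma> \<gamma>' (H \<gamma> t) \<in> arc (\<gamma>, \<gamma>')" using h t(4) \<epsilon>_pos by (simp add: arc_def)
      ultimately show ?thesis unfolding S_def by blast
    next
      case False
      then have "sg \<gamma> = - 1" using sg_pm[of \<gamma>] by auto
      then have "(\<gamma>', \<gamma>) \<in> I" using t \<gamma>' by (simp add: I_def)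
      \<comment> \<open>At coordinate 0 \<open>through\<close> follows its first germ, so the vertex
        itself is treated separately.\<close>
      moreover have "x = through \<gamma>' \<gamma> (- H \<gamma> t)"
      proof (cases "H \<gamma> t = 0")
        case True
        then have "x = v" using x pos_0[OF t(1)] t(2) by simp
        then show ?thesis using True pos_0[OF \<gamma>'(1)] \<gamma>'(2) by (simp add: through_def)
      next
        case False
        then show ?thesis using h x by (simp add: through_def)
      qed
      moreover have "through \<gamma>' \<gamma> (- H \<gamma> t) \<in> arc (\<gamma>', \<gamma>)" using h t(4) \<epsilon>_pos by (simp add: arc_def)
      ultimately show ?thesis unfolding S_def by blast
    qed
  qed (use arc_sub in blast)
  moreover have "S \<noteq> {}"
    using \<open>\<Union>S = star v \<epsilon>\<close> star_V[OF v \<epsilon>_pos] by auto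
  moreover have cm: "continuous_map (subtopology X (star v \<epsilon>)) (top_of_set {- \<epsilon><..<\<epsilon>}) vertex_coord"
  proof -
    have "vertex_coord x \<in> {- \<epsilon><..<\<epsilon>}" if "x \<in> star v \<epsilon>" for x
      using that \<open>\<Union>S = star v \<epsilon>\<close>[symmetric] coord by (auto simp: S_def arc_def)
    then show ?thesis
      using vertex_coord_continuous by (auto simp: continuous_map_in_subtopology)
  qed
  moreover have "homeomorphic_map (subtopology X s) (top_of_set {- \<epsilon><..<\<epsilon>}) vertex_coord" if s: "s \<in> S" for s
  proof -
    obtain \<gamma>1 \<gamma>2 where i: "(\<gamma>1, \<gamma>2) \<in> I" "s = through \<gamma>1 \<gamma>2 ` {- \<epsilon><..<\<epsilon>}"
      using S_cases[OF s] by blast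
    note ii = ID[OF i(1)]
    have top: "topspace (subtopology X s) = s" using arc_sub[OF s] stX by auto
    have "homeomorphic_maps (subtopology X s) (top_of_set {- \<epsilon><..<\<epsilon>}) vertex_coord (through \<gamma>1 \<gamma>2)"
      unfolding homeomorphic_maps_def
    proof (intro conjI ballI)
      show "continuous_map (subtopology X s) (top_of_set {- \<epsilon><..<\<epsilon>}) vertex_coord"
        by (rule continuous_map_from_subtopology_mono[OF cm arc_sub[OF s]])
      have le: "\<epsilon> \<le> l (fst \<gamma>1)" "\<epsilon> \<le> l (fst \<gamma>2)" using \<epsilon>_le ii(1,2) \<epsilon>_pos by force+
      have "continuous_map (top_of_set {- \<epsilon><..<\<epsilon>}) X (\<lambda>y. if 0 \<le> y then ray \<gamma>1 (pos \<gamma>1 y) else ray \<gamma>2 (pos \<gamma>2 (- y)))"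
      proof (rule continuous_map_cases_le)
        have "continuous_map (top_of_set ({- \<epsilon><..<\<epsilon>} \<inter> {x. 0 \<le> x})) X (\<lambda>y. ray \<gamma>1 (pos \<gamma>1 y))"
          by (rule continuous_map_from_subtopology_mono[OF unit_speed_continuous[OF ii(1)]]) (use le in auto)
        then show "continuous_map (subtopology (top_of_set {- \<epsilon><..<\<epsilon>}) {x \<in> topspace (top_of_set {- \<epsilon><..<\<epsilon>}). 0 \<le> x}) X
            (\<lambda>y. ray \<gamma>1 (pos \<gamma>1 y))"
          by (simp add: subtopology_subtopology Int_def conj_ac)
        have "continuous_map (top_of_set ({- \<epsilon><..<\<epsilon>} \<inter> {x. x \<le> 0})) (top_of_set {0..l (fst \<gamma>2)}) uminus"
          using le by (auto intro!: continuous_intros)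
        from continuous_map_compose[OF this unit_speed_continuous[OF ii(2)]]
        show "continuous_map (subtopology (top_of_set {- \<epsilon><..<\<epsilon>}) {x \<in> topspace (top_of_set {- \<epsilon><..<\<epsilon>}). x \<le> 0}) X
            (\<lambda>y. ray \<gamma>2 (pos \<gamma>2 (- y)))"
          by (simp add: subtopology_subtopology Int_def conj_ac o_def)
        show "ray \<gamma>1 (pos \<gamma>1 y) = ray \<gamma>2 (pos \<gamma>2 (- y))" if "0 = y" for y
          using that pos_0 ii by (metis minus_zero)
      qed (auto simp: continuous_on_id)
      then have "continuous_map (top_of_set {- \<epsilon><..<\<epsilon>}) X (through \<gamma>1 \<gamma>2)"
        by (simp add: through_def[abs_def])
      then show "continuous_map (top_of_set {- \<epsilon><..<\<epsilon>}) (subtopology X s) (through \<gamma>1 \<gamma>2)"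
        using i(2) by (simp add: continuous_map_in_subtopology)
      show "through \<gamma>1 \<gamma>2 (vertex_coord x) = x" if "x \<in> topspace (subtopology X s)" for x
        using that coord[OF i(1)] unfolding top i(2) by auto
      show "vertex_coord (through \<gamma>1 \<gamma>2 y) = y" if "y \<in> topspace (top_of_set {- \<epsilon><..<\<epsilon>})" for y
        using that coord[OF i(1)] by simp
    qed
    then show ?thesis using homeomorphic_map_maps by blast
  qed
  moreover have "\<exists>v\<in>\<Inter>S. \<forall>s\<in>S. \<forall>t\<in>S. s \<noteq> t \<longrightarrow>
      vertex_coord ` (s \<inter> t) \<in> {{vertex_coord v}, {- \<epsilon> <.. vertex_coord v}, {vertex_coord v ..< \<epsilon>}}"
  proof (intro bexI[of _ v] ballI impI)
    have v_eq: "v = through \<gamma>1 \<gamma>2 0" if "(\<gamma>1, \<gamma>2) \<in> I" for \<gamma>1 \<gamma>2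
      using ID[OF that] pos_0 by (simp add: through_def)
    show "v \<in> \<Inter>S"
    proof
      fix s assume "s \<in> S"
      then obtain \<gamma>1 \<gamma>2 where i: "(\<gamma>1, \<gamma>2) \<in> I" "s = through \<gamma>1 \<gamma>2 ` {- \<epsilon><..<\<epsilon>}"
        using S_cases by blast
      then show "v \<in> s" using v_eq[OF i(1)] \<epsilon>_pos by auto
    qed
    fix s t assume st: "s \<in> S" "t \<in> S" "s \<noteq> t"
    obtain \<gamma>1 \<gamma>2 where i: "(\<gamma>1, \<gamma>2) \<in> I" "s = through \<gamma>1 \<gamma>2 ` {- \<epsilon><..<\<epsilon>}"
      using S_cases[OF st(1)] by blast
    obtain \<gamma>1' \<gamma>2' where j: "(\<gamma>1', \<gamma>2') \<in> I" "t = through \<gamma>1' \<gamma>2' ` {- \<epsilon><..<\<epsilon>}"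
      using S_cases[OF st(2)] by blast
    have ne: "\<not> (\<gamma>1' = \<gamma>1 \<and> \<gamma>2' = \<gamma>2)" using st(3) i j by auto
    \<comment> \<open>Away from the vertex two arcs agree at \<open>y\<close> exactly if they use
      the same germ on that side.\<close>
    have same: "through \<gamma>1 \<gamma>2 y = through \<gamma>1' \<gamma>2' y \<longleftrightarrow> y = 0 \<or> (0 < y \<and> \<gamma>1' = \<gamma>1) \<or> (y < 0 \<and> \<gamma>2' = \<gamma>2)"
      if y: "y \<in> {- \<epsilon><..<\<epsilon>}" for y
    proof -
      consider "y = 0" | "0 < y" | "y < 0" by linarith
      then show ?thesis
      proof cases
        case 1
        then show ?thesis using v_eq[OF i(1)] v_eq[OF j(1)] by simp
      next
        case 2
        then show ?thesis
          using same_germ_if_point_eq[OF ID(1)[OF i(1)] ID(1)[OF j(1)], of y] y by (auto simp: through_def)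
      next
        case 3
        then show ?thesis
          using same_germ_if_point_eq[OF ID(2)[OF i(1)] ID(2)[OF j(1)], of "- y"] y by (auto simp: through_def)
      qed
    qed
    \<comment> \<open>The parameter of a point on any arc is its chart coordinate, so a common point
      has the same parameter on both arcs.\<close>
    have "vertex_coord ` (s \<inter> t) = {y\<in>{- \<epsilon><..<\<epsilon>}. through \<gamma>1 \<gamma>2 y = through \<gamma>1' \<gamma>2' y}"
    proof (intro equalityI subsetI)
      fix z assume "z \<in> vertex_coord ` (s \<inter> t)"
      then obtain x where x: "x \<in> s" "x \<in> t" "z = vertex_coord x" by blast
      obtain y where y: "y \<in> {- \<epsilon><..<\<epsilon>}" "x = through \<gamma>1 \<gamma>2 y" using x(1) i(2) by blast
      obtain y' where y': "y' \<in> {- \<epsilon><..<\<epsilon>}" "x = through \<gamma>1' \<gamma>2' y'" using x(2) j(2) by blast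
      have "z = y" "z = y'" using coord[OF i(1) y(1)] coord[OF j(1) y'(1)] x(3) y(2) y'(2) by simp_all
      then show "z \<in> {y\<in>{- \<epsilon><..<\<epsilon>}. through \<gamma>1 \<gamma>2 y = through \<gamma>1' \<gamma>2' y}" using y y' by simp
    next
      fix z assume z: "z \<in> {y\<in>{- \<epsilon><..<\<epsilon>}. through \<gamma>1 \<gamma>2 y = through \<gamma>1' \<gamma>2' y}"
      then have "through \<gamma>1 \<gamma>2 z \<in> s" "through \<gamma>1' \<gamma>2' z \<in> t" using i(2) j(2) by blast+
      then have "through \<gamma>1 \<gamma>2 z \<in> s \<inter> t" using z by simp
      moreover have "z = vertex_coord (through \<gamma>1 \<gamma>2 z)" using coord[OF i(1), of z] z by auto
      ultimately show "z \<in> vertex_coord ` (s \<inter> t)" by blast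
    qed
    also have "\<dots> = {y\<in>{- \<epsilon><..<\<epsilon>}. y = 0 \<or> (0 < y \<and> \<gamma>1' = \<gamma>1) \<or> (y < 0 \<and> \<gamma>2' = \<gamma>2)}"
      using same by blast
    also have "\<dots> \<in> {{0}, {- \<epsilon> <.. 0}, {0 ..< \<epsilon>}}"
    proof -
      consider "\<gamma>1' \<noteq> \<gamma>1" "\<gamma>2' \<noteq> \<gamma>2" | "\<gamma>1' \<noteq> \<gamma>1" "\<gamma>2' = \<gamma>2" | "\<gamma>1' = \<gamma>1" "\<gamma>2' \<noteq> \<gamma>2" using ne by blast
      then show ?thesis
      proof cases
        case 1
        then have "{y\<in>{- \<epsilon><..<\<epsilon>}. y = 0 \<or> (0 < y \<and> \<gamma>1' = \<gamma>1) \<or> (y < 0 \<and> \<gamma>2' = \<gamma>2)} = {0}"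
          using \<epsilon>_pos by auto
        then show ?thesis by simp
      next
        case 2
        then have "{y\<in>{- \<epsilon><..<\<epsilon>}. y = 0 \<or> (0 < y \<and> \<gamma>1' = \<gamma>1) \<or> (y < 0 \<and> \<gamma>2' = \<gamma>2)} = {- \<epsilon> <.. 0}"
          using \<epsilon>_pos by auto
        then show ?thesis by simp
      next
        case 3
        then have "{y\<in>{- \<epsilon><..<\<epsilon>}. y = 0 \<or> (0 < y \<and> \<gamma>1' = \<gamma>1) \<or> (y < 0 \<and> \<gamma>2' = \<gamma>2)} = {0 ..< \<epsilon>}"
          using \<epsilon>_pos by auto
        then show ?thesis by simp
      qed
    qed
    finally show "vertex_coord ` (s \<inter> t) \<in> {{vertex_coord v}, {- \<epsilon> <.. vertex_coord v}, {vertex_coord v ..< \<epsilon>}}"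
      using vertex_coord_V[OF v] by simp
  qed
  ultimately show ?thesis
    unfolding branched_chart_def chart_simps
    using st finS \<epsilon>_pos by (intro conjI exI[of _ "- \<epsilon>"] exI[of _ \<epsilon>] exI[of _ S]) auto
qed

lemma atlas_williams:
  "branched_manifold X atlas \<and> immersion X atlas f \<and> williams_solenoid_presentation X atlas f"
proof (rule williams_if_scales[OF compact_X Hausdorff _ _ atlas_cover atlas_transition continuous_f atlas_scales \<mu>
      indecomposable nonwandering flattening])
  show "finite atlas" using finite_V finite_E by (simp add: atlas_def)
  show "branched_chart X c" if "c \<in> atlas" for c
    using that by (rule atlas_cases) (simp_all add: branched_vertex_chart branched_edge_chart)
qed

end

section \<open>Graphs without edges, and the conclusion\<close>

text \<open>Without edges the space is finite, while flattening at a point makes a subset of it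
  homeomorphic to an open interval.\<close>

lemma empty_if_no_edges:
  assumes "graph_space X G \<phi>" "flattening X f" "arcs G = {}"
  shows "topspace X = {}"
proof (rule ccontr)
  assume "topspace X \<noteq> {}"
  then obtain x where x: "x \<in> topspace X" by blast
  obtain k where "\<forall>x\<in>topspace X. \<exists>U \<epsilon>. openin X U \<and> x \<in> U \<and> \<epsilon> > 0 \<and>
       subtopology X ((f ^^ k) ` U) homeomorphic_space top_of_set {- \<epsilon> <..< \<epsilon> :: real}"
    using assms(2) unfolding flattening_def by blast
  then obtain U \<epsilon> where U: "openin X U" "\<epsilon> > 0"
    "subtopology X ((f ^^ k) ` U) homeomorphic_space top_of_set {- \<epsilon> <..< \<epsilon> :: real}" using x by blast
  then obtain \<theta> where "homeomorphic_map (subtopology X ((f ^^ k) ` U)) (top_of_set {- \<epsilon> <..< \<epsilon>}) \<theta>"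
    unfolding homeomorphic_space by blast
  then have "\<theta> ` topspace (subtopology X ((f ^^ k) ` U)) = {- \<epsilon> <..< \<epsilon>}"
    using homeomorphic_imp_surjective_map by fastforce
  moreover have "finite (topspace X)"
    using assms(1,3) fin_digraph.finite_verts by (auto simp: graph_space_def)
  ultimately have "finite {- \<epsilon> <..< \<epsilon>}" by (metis finite_Int finite_imageI topspace_subtopology)
  then show False using U(2) by (simp add: infinite_Ioo)
qed

theorem propositionB2:
  fixes X :: "'a topology"
    and G :: "('a, 'e) pre_digraph"
    and \<phi> :: "'e \<Rightarrow> real \<Rightarrow> 'a"
    and f :: "'a \<Rightarrow> 'a"
  assumes "topological_solenoid_presentation X G \<phi> f"
  shows "\<exists>A. branched_manifold X A \<and> immersion X A f \<and> williams_solenoid_presentation X A f"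
proof -
  have *: "graph_space X G \<phi>" "continuous_map X X f" "indecomposable X f" "nonwandering X f" "flattening X f"
    "expansion X G \<phi> f" "nonfolding X G f" "f ` verts G \<subseteq> verts G"
    using assms by (auto simp: topological_solenoid_presentation_def)
  interpret solenoid X G \<phi> f
    by unfold_locales (rule *)+
  show ?thesis
  proof (cases "E = {}")
    case True
    then have X: "topspace X = {}" using empty_if_no_edges * by blast
    \<comment> \<open>Over the empty atlas the condition is vacuous; 2 is just a number greater than
      1.\<close>
    have "scales X {} f 2" by (simp add: scales_def)
    then have "branched_manifold X {} \<and> immersion X {} f \<and> williams_solenoid_presentation X {} f"
      by (intro williams_if_scales[where \<mu> = 2]) (use X compact_X Hausdorff * in auto)
    then show ?thesis by blast
  next
    case False
    obtain \<mu> :: real and l where ml: "\<mu> > 1" "\<forall>e\<in>E. l e > 0"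
      "\<forall>e\<in>E. (\<Sum>p\<in>P (e, False) - {1}. l (fst (tgt (e, False) p))) = \<mu> * l e"
      using edge_lengths[OF False] by blast
    obtain sg :: "'e \<times> bool \<Rightarrow> real" where sg: "\<forall>\<gamma>. sg \<gamma> = 1 \<or> sg \<gamma> = - 1"
      "\<forall>\<gamma>. fst \<gamma> \<in> E \<longrightarrow> (\<exists>\<gamma>'. fst \<gamma>' \<in> E \<and> ray \<gamma>' 0 = ray \<gamma> 0 \<and> sg \<gamma>' = - sg \<gamma>)"
      "\<forall>\<gamma> \<gamma>'. fst \<gamma> \<in> E \<longrightarrow> fst \<gamma>' \<in> E \<longrightarrow> ray \<gamma>' 0 = ray \<gamma> 0 \<longrightarrow> sg (DF \<gamma>) * sg (DF \<gamma>') = sg \<gamma> * sg \<gamma>'"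
      "\<forall>\<gamma> t q1 \<gamma>1 \<kappa>1 q2 \<gamma>2 \<kappa>2. piece \<gamma> t q1 \<gamma>1 \<kappa>1 \<longrightarrow> piece (opp \<gamma>) (1 - t) q2 \<gamma>2 \<kappa>2 \<longrightarrow> t \<in> {0<..<1} \<longrightarrow>
        sg \<gamma>2 = - sg \<gamma>1"
      using sides by (elim exE conjE)
    interpret sided_solenoid X G \<phi> f \<mu> l sg
    proof unfold_locales
      show "sg \<gamma> = 1 \<or> sg \<gamma> = - 1" for \<gamma> using sg(1) by blast
    qed (use False ml sg(2,3,4) in blast)+
    show ?thesis using atlas_williams by blast
  qed
qed

end
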